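(* Consider $K$ moving dipole sources $F(t,\boldsymbol r)=-\sum_{k=1}^K\boldsymbol m_k(t)\cdot\nabla\delta(\boldsymbol r-\boldsymbol p_k(t))$, where for each $k$: $\boldsymbol p_k\in C^6([0,T];D)$, $|d_t\boldsymbol p_k(t)|<c$ on $[0,T]$, $\boldsymbol m_k=(m_{k,x},m_{k,y},m_{k,z})\in C^6([0,T];\mathbb R^3)$, and $\boldsymbol m_k(0)=d_t\boldsymbol m_k(0)=\cdots=d_t^6\boldsymbol m_k(0)=\boldsymbol0$. Let $\phi=\partial_\nu u$ on $[0,T]\times\Gamma$ be the observation data, where $u$ is the corresponding wave field, and let $$I_0=\Big[\max\{0,\sup_{\boldsymbol r\in\Omega}z/c\},\ \min\{T+\inf_{\boldsymbol r\in\Omega}z/c,\,T\}\Big]\subset[0,T].$$ For each $\tau\in I_0$, let $t_k(\tau)$ be the unique solution $t$ of $t-\tau+p_{k,z}(t)/c=0$, and let $K(\tau)$ be the number of dipole sources such that $\boldsymbol m_k(t_k(\tau))\neq\boldsymbol0$. Assume that $K(\tau)\le K_M$ for a given $K_M$, that $p_{j,xy}(t_j(\tau))\ne p_{k,xy}(t_k(\tau))$ if $j\neq k$, where $p_{k,xy}=p_{k,x}+\mathrm i\,p_{k,y}$, and that $m_{k,z}(t)\equiv0$ for all $k$. Then $K(\tau)$ is uniquely determined by the reciprocity gap functionals $\mathcal R_\phi(f_n)(\tau)$, $n=1,2,\dots,2K_M+1$. Moreover, numbering the sources with $\boldsymbol m_k(t_k(\tau))\ne\boldsymbol0$ as $k=1,\dots,K(\tau)$,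 the locations $\boldsymbol p_k(t_k(\tau))$ and moments $\boldsymbol m_k(t_k(\tau))$, $k=1,2,\dots,K(\tau)$, are uniquely determined (up to the numbering of the sources) by the values - $\mathcal R_\phi(f_n)(\tau)$, $n=1,2,3,\dots,2K(\tau)$, - $\mathcal R_\phi(g_n)(\tau)$, $n=1,2,3,\dots,2K(\tau)$, - $\mathcal R_\phi(h_n)(\tau)$, $n=2,3,4,\dots,K(\tau)+1$, - $\mathcal R_\phi(i_n)(\tau)$, $n=1,2,3,\dots,2K(\tau)$, - $\mathcal R_\phi(j_n)(\tau)$, $n=2,3,4,\dots,K(\tau)+1$.
   Context: $\Omega\subset\mathbb R^3$ is a simply connected bounded domain with $C^\infty$ boundary $\Gamma=\partial\Omega$; $D$ is a compact subset of $\Omega$; $c>0$ is the known wave speed; $T>2\,\mathrm{diam}(\Omega)/c$ is a constant. $\boldsymbol r=(x,y,z)$, $\boldsymbol p_k=(p_{k,x},p_{k,y},p_{k,z})$, $\mathrm i=\sqrt{-1}$, $d_t$ is the derivative in $t$, $\partial_\nu$ is the outward normal derivative on $\Gamma$, and $\delta$ is the Dirac distribution, with $\langle\nabla\delta(\cdot-\boldsymbol p),v\rangle_\Omega=-\nabla v(\boldsymbol p)$. Wave field: $u$ is the weak solution of $\frac1{c^2}\partial_t^2u-\Delta u=F$ in $(0,T)\times\Omega$, $u(0,\cdot)=\partial_tu(0,\cdot)=0$ in $\Omega$, $u=0$ on $(0,T)\times\Gamma$; that is, for every $v\in C^\infty([0,T]\times\overline\Omega)$, $$\frac1{c^2}\int_\Omega\partial_tu(T,\boldsymbol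 r)v(T,\boldsymbol r)\,dV-\frac1{c^2}\int_\Omega u(T,\boldsymbol r)\partial_tv(T,\boldsymbol r)\,dV-\int_0^T\!\!\int_\Gamma\partial_\nu u\,v\,dS\,dt+\int_0^T\!\!\int_\Omega u\Big(\frac1{c^2}\partial_t^2v-\Delta v\Big)dV\,dt=\mathcal F(v),$$ with $\mathcal F(v)=\sum_{k=1}^K\int_0^T\boldsymbol m_k(t)\cdot\nabla v(t,\boldsymbol p_k(t))\,dt$. Here $u\in C^1([0,T];\mathcal D'(\Omega))$ is, near $\Gamma$ (on $\Omega\setminus D$), a function with values in $H^1$, with vanishing trace on $\Gamma$, and with $\partial_tu$ having values in $L^2$ there and $\partial_\nu u\in L^2((0,T)\times\Gamma)$; volume integrals of $u$ and $\partial_tu$ are duality pairings where $u$ is not a function (split $v$ by a smooth cutoff that equals $1$ near $D$ and has compact support in $\Omega$). Reciprocity gap functional: for $v\in C^\infty([0,T]\times\overline\Omega;\mathbb C)$ with $\frac1{c^2}\partial_t^2v-\Delta v=0$ in $(0,T)\times\Omega$ and $v(T,\cdot)=\partial_tv(T,\cdot)=0$ in $\Omega$, $$\mathcal R_\phi(v)=-\int_0^T\!\!\int_\Gamma\phi(t,\boldsymbol r)v(t,\boldsymbol r)\,dS(\boldsymbol r)\,dt.$$ Test functions: let $\eta_\varepsilon\in C^\infty(\mathbb R;\mathbb R)$ be the standard mollifier with support $[-\varepsilon,\varepsilon]$, $0<\varepsilon\ll1$, and put $$f_{n,\varepsilon}(t,\boldsymbol r;\tau)=(x+\mathrm iy)^n\,\eta_\varepsilon\big(t-(\tau-z/c)\big)\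 (n\ge0),\qquad g_{n,\varepsilon}=-\partial_tf_{n,\varepsilon}\ (n\ge0),$$ $$h_{n,\varepsilon}=z(\partial_x-\mathrm i\partial_y)f_{n,\varepsilon}-(x-\mathrm iy)\partial_zf_{n,\varepsilon}\ (n\ge1),\qquad i_{n,\varepsilon}=\partial_t^2f_{n,\varepsilon}\ (n\ge0),\qquad j_{n,\varepsilon}=-\partial_th_{n,\varepsilon}\ (n\ge1).$$ For $w\in\{f,g,h,i,j\}$, $\mathcal R_\phi(w_n)(\tau)=\lim_{\varepsilon\to+0}\mathcal R_\phi(w_{n,\varepsilon}(\cdot,\cdot;\tau))$ for $\tau$ in the interior of $I_0$, extended by continuity to the endpoints of $I_0$. (For example $\mathcal R_\phi(f_n)(\tau)=-\int_\Gamma(x+\mathrm iy)^n\phi(\tau-z/c,\boldsymbol r)\,dS(\boldsymbol r)$.) "Uniquely determined by given values" means: for any two source configurations satisfying the hypotheses (with the same $\Omega,D,c,T,K_M,\tau$; the number $K$ of sources may differ), equality of the listed values implies equality of the quantities said to be determined.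
   Formalization: In the second claim, for both configurations, every source with m_k(t_k(τ))=0 is also assumed to satisfy d_t m_k(t_k(τ))=d_t² m_k(t_k(τ))=0 (without this the claim fails); I_0 is assumed to have non-empty interior, so that the extension to its endpoints makes sense. *)

theory Defs
  imports "HOL-Analysis.Analysis"
begin

section \<open>Calculus\<close>

definition pd :: "'a::real_normed_vector \<Rightarrow> ('a \<Rightarrow> 'b::real_normed_vector) \<Rightarrow> 'a \<Rightarrow> 'b" where
  "pd e f x = frechet_derivative f (at x) e"

text \<open>For open \<open>S\<close>: \<open>f\<close> is of class \<open>C\<^sup>\<infinity>\<close> on \<open>S\<close>. For a closed set such as
  \<open>[0,T] \<times> closure \<Omega>\<close>, a smooth function is understood as the restriction of a function
  that is smooth on the whole space.\<close>

definition smooth_on :: "'a::euclidean_space set \<Rightarrow> ('a \<Rightarrow> 'b::real_normed_vector) \<Rightarrow> bool" where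
  "smooth_on S f \<longleftrightarrow>
     (\<forall>es. set es \<subseteq> Basis \<longrightarrow> (\<forall>x\<in>S. foldr pd es f differentiable (at x)))"

abbreviation D_t :: "(real \<times> (real^3) \<Rightarrow> complex) \<Rightarrow> real \<times> (real^3) \<Rightarrow> complex" where
  "D_t \<equiv> pd (1, 0)"

abbreviation D_sp :: "3 \<Rightarrow> (real \<times> (real^3) \<Rightarrow> complex) \<Rightarrow> real \<times> (real^3) \<Rightarrow> complex" where
  "D_sp i \<equiv> pd (0, axis i 1)"

definition wave_op :: "real \<Rightarrow> (real \<times> (real^3) \<Rightarrow> complex) \<Rightarrow> real \<times> (real^3) \<Rightarrow> complex" where
  "wave_op c v x = of_real (1 / c\<^sup>2) * D_t (D_t v) x - (\<Sum>i\<in>UNIV. D_sp i (D_sp i v) x)"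

text \<open>Derivative in time on \<open>[0,T]\<close>, one-sided at the two end points.\<close>

definition time_deriv :: "real \<Rightarrow> (real \<Rightarrow> 'b::real_normed_vector) \<Rightarrow> real \<Rightarrow> 'b" where
  "time_deriv T f t = vector_derivative f (at t within {0..T})"

definition C_time :: "nat \<Rightarrow> real \<Rightarrow> (real \<Rightarrow> 'b::real_normed_vector) \<Rightarrow> bool" where
  "C_time k T f \<longleftrightarrow>
     (\<forall>j<k. \<forall>t\<in>{0..T}. (time_deriv T ^^ j) f differentiable (at t within {0..T})) \<and>
     continuous_on {0..T} ((time_deriv T ^^ k) f)"

section \<open>Smooth domains and surface measure\<close>

definition smooth_boundary :: "(real^3) set \<Rightarrow> bool" where
  "smooth_boundary \<Omega> \<longleftrightarrow>
     (\<forall>q\<in>frontier \<Omega>. \<exists>W \<rho>. open W \<and> q \<in> W \<and> smooth_on W (\<rho> :: real^3 \<Rightarrow> real) \<and>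
        (\<forall>x\<in>W. frechet_derivative \<rho> (at x) \<noteq> (\<lambda>_. 0)) \<and>
        \<Omega> \<inter> W = {x\<in>W. \<rho> x < 0} \<and> frontier \<Omega> \<inter> W = {x\<in>W. \<rho> x = 0})"

definition smooth_sc_domain :: "(real^3) set \<Rightarrow> bool" where
  "smooth_sc_domain \<Omega> \<longleftrightarrow>
     open \<Omega> \<and> \<Omega> \<noteq> {} \<and> connected \<Omega> \<and> bounded \<Omega> \<and> simply_connected \<Omega> \<and> smooth_boundary \<Omega>"

text \<open>Two-dimensional Hausdorff measure, normalised by the area \<open>pi/4 \<cdot> d\<^sup>2\<close> of a disc of
  diameter \<open>d\<close>. On Borel sets it is countably additive (it is a metric outer measure), and on a
  smooth surface it is the usual surface measure \<open>dS\<close>.\<close>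

definition hausdorff2_pre :: "real \<Rightarrow> (real^3) set \<Rightarrow> ennreal" where
  "hausdorff2_pre \<delta> A =
     (INF C \<in> {C :: nat \<Rightarrow> (real^3) set.
                 A \<subseteq> (\<Union>i. C i) \<and> (\<forall>i. bounded (C i) \<and> diameter (C i) \<le> \<delta>)}.
        (\<Sum>i. ennreal (pi / 4 * (diameter (C i))\<^sup>2)))"

definition hausdorff2 :: "(real^3) set \<Rightarrow> ennreal" where
  "hausdorff2 A = (SUP \<delta>\<in>{0<..}. hausdorff2_pre \<delta> A)"

definition surface_measure :: "(real^3) set \<Rightarrow> (real^3) measure" where
  "surface_measure \<Gamma> = restrict_space (measure_of UNIV (sets borel) hausdorff2) \<Gamma>"

text \<open>\<open>\<integral>\<^sub>0\<^sup>T \<integral>\<^sub>\<Gamma> \<phi> v dS dt\<close> with \<open>\<Gamma> = frontier \<Omega>\<close>\<close>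

definition lateral_integral ::
    "(real^3) set \<Rightarrow> real \<Rightarrow> (real \<Rightarrow> real^3 \<Rightarrow> real) \<Rightarrow> (real \<times> (real^3) \<Rightarrow> complex) \<Rightarrow> complex" where
  "lateral_integral \<Omega> T \<phi> v =
     (LINT t:{0..T}|lborel. (LINT r|surface_measure (frontier \<Omega>). of_real (\<phi> t r) * v (t, r)))"

section \<open>Distributions and Sobolev functions\<close>

definition test_fun :: "(real^3) set \<Rightarrow> (real^3 \<Rightarrow> complex) \<Rightarrow> bool" where
  "test_fun A \<psi> \<longleftrightarrow>
     smooth_on UNIV \<psi> \<and> compact (closure {x. \<psi> x \<noteq> 0}) \<and> closure {x. \<psi> x \<noteq> 0} \<subseteq> A"

definition distribution :: "(real^3) set \<Rightarrow> ((real^3 \<Rightarrow> complex) \<Rightarrow> complex) \<Rightarrow> bool" where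
  "distribution A u \<longleftrightarrow>
     (\<forall>\<psi> \<theta> a b. test_fun A \<psi> \<and> test_fun A \<theta> \<longrightarrow>
        u (\<lambda>x. a * \<psi> x + b * \<theta> x) = a * u \<psi> + b * u \<theta>) \<and>
     (\<forall>C. compact C \<and> C \<subseteq> A \<longrightarrow>
        (\<exists>N B. \<forall>\<psi> M. test_fun C \<psi> \<and>
            (\<forall>es x. set es \<subseteq> Basis \<and> length es \<le> N \<longrightarrow> norm (foldr pd es \<psi> x) \<le> M) \<longrightarrow>
            norm (u \<psi>) \<le> B * M))"

definition L2_on :: "'a::euclidean_space set \<Rightarrow> ('a \<Rightarrow> 'b::euclidean_space) \<Rightarrow> bool" where
  "L2_on A f \<longleftrightarrow>
     set_borel_measurable lebesgue A f \<and> set_integrable lebesgue A (\<lambda>x. (norm (f x))\<^sup>2)"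

definition represents :: "(real^3) set \<Rightarrow> (real^3 \<Rightarrow> real) \<Rightarrow> ((real^3 \<Rightarrow> complex) \<Rightarrow> complex) \<Rightarrow> bool" where
  "represents A w u \<longleftrightarrow>
     (\<forall>\<psi>. test_fun A \<psi> \<longrightarrow> u \<psi> = (LINT r:A|lebesgue. of_real (w r) * \<psi> r))"

definition weak_gradient :: "(real^3) set \<Rightarrow> (real^3 \<Rightarrow> real) \<Rightarrow> (real^3 \<Rightarrow> real^3) \<Rightarrow> bool" where
  "weak_gradient A w G \<longleftrightarrow>
     (\<forall>\<psi> i. test_fun A \<psi> \<longrightarrow>
        (LINT r:A|lebesgue. of_real (w r) * pd (axis i 1) \<psi> r) =
        - (LINT r:A|lebesgue. of_real (G r $ i) * \<psi> r))"

definition compact_nbhd :: "(real^3) set \<Rightarrow> (real^3) set \<Rightarrow> (real^3) set \<Rightarrow> bool" where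
  "compact_nbhd \<Omega> D N \<longleftrightarrow> compact N \<and> D \<subseteq> interior N \<and> N \<subseteq> \<Omega>"

text \<open>\<open>\<Omega> - N\<close>, for a compact neighbourhood \<open>N\<close> of \<open>D\<close> in \<open>\<Omega>\<close>, is a one-sided neighbourhood of
  \<open>\<Gamma>\<close>. \<open>H\<^sup>1\<close> regularity is required on each of these sets and not up to \<open>\<partial>D\<close>, where sources
  may be located.\<close>

definition H1_near :: "(real^3) set \<Rightarrow> (real^3) set \<Rightarrow> (real^3 \<Rightarrow> real) \<Rightarrow> (real^3 \<Rightarrow> real^3) \<Rightarrow> bool" where
  "H1_near \<Omega> D w G \<longleftrightarrow>
     weak_gradient (\<Omega> - D) w G \<and>
     (\<forall>N. compact_nbhd \<Omega> D N \<longrightarrow> L2_on (\<Omega> - N) w \<and> L2_on (\<Omega> - N) G)"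

text \<open>The trace of an \<open>H\<^sup>1\<close> function is the \<open>L\<^sup>2(\<Gamma>)\<close> limit of the boundary values of smooth
  functions that converge to it in \<open>H\<^sup>1\<close> near \<open>\<Gamma>\<close>.\<close>

definition has_trace ::
    "(real^3) set \<Rightarrow> (real^3) set \<Rightarrow> (real^3 \<Rightarrow> real) \<Rightarrow> (real^3 \<Rightarrow> real^3) \<Rightarrow> (real^3 \<Rightarrow> real) \<Rightarrow> bool" where
  "has_trace \<Omega> D w G b \<longleftrightarrow>
     (\<exists>N (s :: nat \<Rightarrow> real^3 \<Rightarrow> real). compact_nbhd \<Omega> D N \<and> (\<forall>j. smooth_on UNIV (s j)) \<and>
        (\<lambda>j. LINT r:\<Omega> - N|lebesgue. (s j r - w r)\<^sup>2 + (norm ((\<chi> i. pd (axis i 1) (s j) r) - G r))\<^sup>2)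
          \<longlonglongrightarrow> 0 \<and>
        (\<lambda>j. LINT r|surface_measure (frontier \<Omega>). (s j r - b r)\<^sup>2) \<longlonglongrightarrow> 0)"

section \<open>Wave field\<close>

definition cutoff :: "(real^3) set \<Rightarrow> (real^3) set \<Rightarrow> (real^3 \<Rightarrow> real) \<Rightarrow> bool" where
  "cutoff \<Omega> D \<kappa> \<longleftrightarrow>
     smooth_on UNIV \<kappa> \<and> (\<exists>W. open W \<and> D \<subseteq> W \<and> (\<forall>r\<in>W. \<kappa> r = 1)) \<and>
     compact (closure {r. \<kappa> r \<noteq> 0}) \<and> closure {r. \<kappa> r \<noteq> 0} \<subseteq> \<Omega>"

text \<open>\<open>\<integral>\<^sub>\<Omega> u \<psi> dV\<close> for \<open>\<psi>\<close> smooth up to \<open>\<Gamma>\<close>, where the distribution \<open>u\<close> is represented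
  by \<open>U\<close> on \<open>\<Omega> - D\<close>. The value does not depend on the cutoff \<open>\<kappa>\<close>.\<close>

definition pairing ::
    "(real^3) set \<Rightarrow> (real^3 \<Rightarrow> real) \<Rightarrow> ((real^3 \<Rightarrow> complex) \<Rightarrow> complex) \<Rightarrow> (real^3 \<Rightarrow> real)
      \<Rightarrow> (real^3 \<Rightarrow> complex) \<Rightarrow> complex" where
  "pairing \<Omega> \<kappa> u U \<psi> =
     u (\<lambda>r. of_real (\<kappa> r) * \<psi> r) + (LINT r:\<Omega>|lebesgue. of_real (U r * (1 - \<kappa> r)) * \<psi> r)"

definition dist_time_deriv ::
    "real \<Rightarrow> (real \<Rightarrow> (real^3 \<Rightarrow> complex) \<Rightarrow> complex) \<Rightarrow> real \<Rightarrow> (real^3 \<Rightarrow> complex) \<Rightarrow> complex" where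
  "dist_time_deriv T u t \<psi> = time_deriv T (\<lambda>s. u s \<psi>) t"

text \<open>\<open>\<phi> = \<partial>\<^sub>\<nu> u\<close> for a field that has gradient \<open>G\<close> and time derivative \<open>V\<close> near \<open>\<Gamma>\<close> and
  solves the homogeneous wave equation there. For \<open>H\<^sup>1\<close> functions the outward normal derivative is
  defined by Green's formula
  \<open>\<integral>\<integral>\<^sub>\<Gamma> \<partial>\<^sub>\<nu>u v = \<integral>\<integral>\<^sub>\<Omega> (\<nabla>u \<cdot> \<nabla>v + \<Delta>u v)\<close>, in which \<open>\<Delta>u = \<partial>\<^sub>t\<^sup>2u / c\<^sup>2\<close> has been
  integrated by parts in time.\<close>

definition has_normal_derivative ::
    "(real^3) set \<Rightarrow> (real^3) set \<Rightarrow> real \<Rightarrow> real \<Rightarrow> (real \<Rightarrow> real^3 \<Rightarrow> real^3)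
      \<Rightarrow> (real \<Rightarrow> real^3 \<Rightarrow> real) \<Rightarrow> (real \<Rightarrow> real^3 \<Rightarrow> real) \<Rightarrow> bool" where
  "has_normal_derivative \<Omega> D c T G V \<phi> \<longleftrightarrow>
     (\<forall>v. smooth_on UNIV v \<and>
          (\<exists>N \<delta>. compact_nbhd \<Omega> D N \<and> \<delta> > 0 \<and>
             (\<forall>t r. t < \<delta> \<or> t > T - \<delta> \<or> r \<in> N \<longrightarrow> v (t, r) = 0)) \<longrightarrow>
        lateral_integral \<Omega> T \<phi> v =
        (LINT x:{0..T} \<times> \<Omega>|lebesgue.
           (\<Sum>i\<in>UNIV. of_real (G (fst x) (snd x) $ i) * D_sp i v x)
           - of_real (V (fst x) (snd x) / c\<^sup>2) * D_t v x))"

definition dipole_functional ::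
    "real \<Rightarrow> nat \<Rightarrow> (nat \<Rightarrow> real \<Rightarrow> real^3) \<Rightarrow> (nat \<Rightarrow> real \<Rightarrow> real^3)
      \<Rightarrow> (real \<times> (real^3) \<Rightarrow> complex) \<Rightarrow> complex" where
  "dipole_functional T K p m v =
     (\<Sum>k<K. integral {0..T} (\<lambda>t. \<Sum>i\<in>UNIV. of_real (m k t $ i) * D_sp i v (t, p k t)))"

text \<open>\<open>u\<close> is the weak solution of the initial-boundary value problem with the moving dipoles
  \<open>(p k, m k)\<close>, \<open>k < K\<close>, as source, and \<open>\<phi>\<close> is its normal derivative on \<open>(0,T) \<times> \<Gamma>\<close>.
  \<open>U\<close>, \<open>G\<close>, \<open>V\<close> represent \<open>u\<close>, \<open>\<nabla>u\<close>, \<open>\<partial>\<^sub>tu\<close> off \<open>D\<close>.\<close>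

definition weak_solution ::
    "(real^3) set \<Rightarrow> (real^3) set \<Rightarrow> real \<Rightarrow> real \<Rightarrow> nat
      \<Rightarrow> (nat \<Rightarrow> real \<Rightarrow> real^3) \<Rightarrow> (nat \<Rightarrow> real \<Rightarrow> real^3)
      \<Rightarrow> (real \<Rightarrow> (real^3 \<Rightarrow> complex) \<Rightarrow> complex) \<Rightarrow> (real \<Rightarrow> real^3 \<Rightarrow> real) \<Rightarrow> bool" where
  "weak_solution \<Omega> D c T K p m u \<phi> \<longleftrightarrow>
     (\<forall>t\<in>{0..T}. distribution \<Omega> (u t)) \<and>
     (\<forall>\<psi>. test_fun \<Omega> \<psi> \<longrightarrow> C_time 1 T (\<lambda>t. u t \<psi>)) \<and>
     (\<forall>\<psi>. test_fun \<Omega> \<psi> \<longrightarrow> u 0 \<psi> = 0 \<and> dist_time_deriv T u 0 \<psi> = 0) \<and>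
     (\<lambda>x. \<phi> (fst x) (snd x)) \<in>
        borel_measurable (restrict_space lborel {0..T} \<Otimes>\<^sub>M surface_measure (frontier \<Omega>)) \<and>
     integrable (restrict_space lborel {0..T} \<Otimes>\<^sub>M surface_measure (frontier \<Omega>))
        (\<lambda>x. (\<phi> (fst x) (snd x))\<^sup>2) \<and>
     (\<exists>U G V \<kappa>. cutoff \<Omega> D \<kappa> \<and>
        (\<forall>t\<in>{0..T}. represents (\<Omega> - D) (U t) (u t) \<and> H1_near \<Omega> D (U t) (G t) \<and>
           has_trace \<Omega> D (U t) (G t) (\<lambda>_. 0) \<and>
           represents (\<Omega> - D) (V t) (dist_time_deriv T u t)) \<and>
        (\<forall>N. compact_nbhd \<Omega> D N \<longrightarrow>
           (\<forall>t\<in>{0..T}. L2_on (\<Omega> - N) (V t)) \<and>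
           L2_on ({0..T} \<times> (\<Omega> - N)) (\<lambda>x. U (fst x) (snd x)) \<and>
           L2_on ({0..T} \<times> (\<Omega> - N)) (\<lambda>x. G (fst x) (snd x)) \<and>
           L2_on ({0..T} \<times> (\<Omega> - N)) (\<lambda>x. V (fst x) (snd x))) \<and>
        has_normal_derivative \<Omega> D c T G V \<phi> \<and>
        (\<forall>v. smooth_on UNIV v \<longrightarrow>
           of_real (1 / c\<^sup>2) * pairing \<Omega> \<kappa> (dist_time_deriv T u T) (V T) (\<lambda>r. v (T, r))
           - of_real (1 / c\<^sup>2) * pairing \<Omega> \<kappa> (u T) (U T) (\<lambda>r. D_t v (T, r))
           - lateral_integral \<Omega> T \<phi> v
           + integral {0..T} (\<lambda>t. pairing \<Omega> \<kappa> (u t) (U t) (\<lambda>r. wave_op c v (t, r)))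
           = dipole_functional T K p m v))"

section \<open>Reciprocity gap functional and test functions\<close>

text \<open>To be applied to solutions of the homogeneous wave equation in \<open>(0,T) \<times> \<Omega>\<close> that vanish,
  with their time derivative, at \<open>t = T\<close>. The test functions below are of this kind
  for \<open>\<tau>\<close> in the interior of \<open>I\<^sub>0\<close> and small \<open>\<epsilon>\<close>.\<close>

definition recip_gap ::
    "(real^3) set \<Rightarrow> real \<Rightarrow> (real \<Rightarrow> real^3 \<Rightarrow> real) \<Rightarrow> (real \<times> (real^3) \<Rightarrow> complex) \<Rightarrow> complex" where
  "recip_gap \<Omega> T \<phi> v = - lateral_integral \<Omega> T \<phi> v"

definition bump :: "real \<Rightarrow> real" where
  "bump s = (if \<bar>s\<bar> < 1 then exp (- 1 / (1 - s\<^sup>2)) else 0)"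

definition mollifier :: "real \<Rightarrow> real \<Rightarrow> real" where
  "mollifier \<epsilon> s = bump (s / \<epsilon>) / (\<epsilon> * integral UNIV bump)"

definition cxy :: "real^3 \<Rightarrow> complex" where
  "cxy r = Complex (r $ 1) (r $ 2)"

type_synonym test_family = "nat \<Rightarrow> real \<Rightarrow> real \<Rightarrow> real \<times> (real^3) \<Rightarrow> complex"

definition f_test :: "real \<Rightarrow> test_family" where
  "f_test c n \<epsilon> \<tau> = (\<lambda>(t, r). cxy r ^ n * of_real (mollifier \<epsilon> (t - (\<tau> - r $ 3 / c))))"

definition g_test :: "real \<Rightarrow> test_family" where
  "g_test c n \<epsilon> \<tau> = (\<lambda>x. - D_t (f_test c n \<epsilon> \<tau>) x)"

definition h_test :: "real \<Rightarrow> test_family" where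
  "h_test c n \<epsilon> \<tau> = (\<lambda>x.
     of_real (snd x $ 3) * (D_sp 1 (f_test c n \<epsilon> \<tau>) x - \<i> * D_sp 2 (f_test c n \<epsilon> \<tau>) x)
     - cnj (cxy (snd x)) * D_sp 3 (f_test c n \<epsilon> \<tau>) x)"

definition i_test :: "real \<Rightarrow> test_family" where
  "i_test c n \<epsilon> \<tau> = D_t (D_t (f_test c n \<epsilon> \<tau>))"

definition j_test :: "real \<Rightarrow> test_family" where
  "j_test c n \<epsilon> \<tau> = (\<lambda>x. - D_t (h_test c n \<epsilon> \<tau>) x)"

definition I0 :: "(real^3) set \<Rightarrow> real \<Rightarrow> real \<Rightarrow> real set" where
  "I0 \<Omega> c T = {max 0 (SUP r\<in>\<Omega>. r $ 3 / c) .. min (T + (INF r\<in>\<Omega>. r $ 3 / c)) T}"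

definition recip_gap_lim ::
    "(real^3) set \<Rightarrow> real \<Rightarrow> (real \<Rightarrow> real^3 \<Rightarrow> real) \<Rightarrow> test_family \<Rightarrow> nat \<Rightarrow> real \<Rightarrow> complex" where
  "recip_gap_lim \<Omega> T \<phi> w n \<tau> = Lim (at_right 0) (\<lambda>\<epsilon>. recip_gap \<Omega> T \<phi> (w n \<epsilon> \<tau>))"

text \<open>\<open>\<R>\<^sub>\<phi>(w\<^sub>n)(\<tau>)\<close>: the limit \<open>\<epsilon> \<rightarrow> +0\<close> for \<open>\<tau>\<close> in the interior of \<open>I\<^sub>0\<close>,
  extended by continuity to the end points.\<close>

definition RG ::
    "(real^3) set \<Rightarrow> real \<Rightarrow> real \<Rightarrow> (real \<Rightarrow> real^3 \<Rightarrow> real) \<Rightarrow> (real \<Rightarrow> test_family)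
      \<Rightarrow> nat \<Rightarrow> real \<Rightarrow> complex" where
  "RG \<Omega> c T \<phi> w n \<tau> =
     (if \<tau> \<in> interior (I0 \<Omega> c T) then recip_gap_lim \<Omega> T \<phi> (w c) n \<tau>
      else Lim (at \<tau> within interior (I0 \<Omega> c T)) (recip_gap_lim \<Omega> T \<phi> (w c) n))"

section \<open>Source configurations\<close>

definition dipole_sources ::
    "(real^3) set \<Rightarrow> real \<Rightarrow> real \<Rightarrow> nat
      \<Rightarrow> (nat \<Rightarrow> real \<Rightarrow> real^3) \<Rightarrow> (nat \<Rightarrow> real \<Rightarrow> real^3) \<Rightarrow> bool" where
  "dipole_sources D c T K p m \<longleftrightarrow>
     (\<forall>k<K. C_time 6 T (p k) \<and> (\<forall>t\<in>{0..T}. p k t \<in> D) \<and>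
        (\<forall>t\<in>{0..T}. norm (time_deriv T (p k) t) < c) \<and>
        C_time 6 T (m k) \<and> (\<forall>j\<le>6. (time_deriv T ^^ j) (m k) 0 = 0))"

definition arrival_time :: "real \<Rightarrow> real \<Rightarrow> (real \<Rightarrow> real^3) \<Rightarrow> real \<Rightarrow> real" where
  "arrival_time c T q \<tau> = (THE t. t \<in> {0..T} \<and> t - \<tau> + q t $ 3 / c = 0)"

definition active ::
    "real \<Rightarrow> real \<Rightarrow> nat \<Rightarrow> (nat \<Rightarrow> real \<Rightarrow> real^3) \<Rightarrow> (nat \<Rightarrow> real \<Rightarrow> real^3) \<Rightarrow> real \<Rightarrow> nat set" where
  "active c T K p m \<tau> = {k. k < K \<and> m k (arrival_time c T (p k) \<tau>) \<noteq> 0}"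

text \<open>The hypotheses on one configuration and its observation, at the parameter \<open>\<tau>\<close>.\<close>

definition admissible ::
    "(real^3) set \<Rightarrow> (real^3) set \<Rightarrow> real \<Rightarrow> real \<Rightarrow> nat \<Rightarrow> real \<Rightarrow> nat
      \<Rightarrow> (nat \<Rightarrow> real \<Rightarrow> real^3) \<Rightarrow> (nat \<Rightarrow> real \<Rightarrow> real^3)
      \<Rightarrow> (real \<Rightarrow> (real^3 \<Rightarrow> complex) \<Rightarrow> complex) \<Rightarrow> (real \<Rightarrow> real^3 \<Rightarrow> real) \<Rightarrow> bool" where
  "admissible \<Omega> D c T KM \<tau> K p m u \<phi> \<longleftrightarrow>
     dipole_sources D c T K p m \<and> weak_solution \<Omega> D c T K p m u \<phi> \<and>
     card (active c T K p m \<tau>) \<le> KM \<and>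
     (\<forall>j<K. \<forall>k<K. j \<noteq> k \<longrightarrow>
        cxy (p j (arrival_time c T (p j) \<tau>)) \<noteq> cxy (p k (arrival_time c T (p k) \<tau>))) \<and>
     (\<forall>k<K. \<forall>t\<in>{0..T}. m k t $ 3 = 0)"

text \<open>A source whose moment vanishes at the instant \<open>t\<^sub>k(\<tau>)\<close> is off to second order there.
  Otherwise, although not counted in \<open>K(\<tau>)\<close>, it enters the functionals of the \<open>g\<close>, \<open>h\<close>, \<open>i\<close>,
  \<open>j\<close> families through the derivatives of \<open>m k\<close> at \<open>t\<^sub>k(\<tau>)\<close>, and their values at the single
  \<open>\<tau>\<close> do not determine the active sources. With \<open>c = 1\<close>, small real \<open>s \<noteq> 0\<close>, and
  \<open>(w, z, q) = (p\<^sub>x\<^sub>y, p\<^sub>z, m\<^sub>x\<^sub>y dt\<^sub>k/d\<tau>)\<close> as functions of \<open>\<tau>\<close> near \<open>0\<close> (time shifted), the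
  configuration of the two sources \<open>(0, 0, 1)\<close> and \<open>(1, 0, s \<tau>)\<close> and that of the single source
  \<open>(s \<tau> - s\<^sup>2 \<tau>\<^sup>2, 3 s/4 - 9 s\<^sup>2 \<tau>/4, 1 + s \<tau>)\<close> have one active source each and the same listed
  values at \<open>\<tau> = 0\<close>.\<close>

definition inactive_flat ::
    "real \<Rightarrow> real \<Rightarrow> nat \<Rightarrow> (nat \<Rightarrow> real \<Rightarrow> real^3) \<Rightarrow> (nat \<Rightarrow> real \<Rightarrow> real^3) \<Rightarrow> real \<Rightarrow> bool" where
  "inactive_flat c T K p m \<tau> \<longleftrightarrow>
     (\<forall>k<K. m k (arrival_time c T (p k) \<tau>) = 0 \<longrightarrow>
        (\<forall>j\<le>2. (time_deriv T ^^ j) (m k) (arrival_time c T (p k) \<tau>) = 0))"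

end

theory Submission
  imports Defs "HOL-Computational_Algebra.Polynomial"
begin

text \<open>The weak formulation, tested with a solution \<open>v\<close> of the homogeneous wave equation that vanishes
together with \<open>\<partial>\<^sub>t v\<close> at time \<open>T\<close>, leaves only the boundary term and the source term. Hence the
reciprocity gap of \<open>v\<close> equals \<open>\<Sum>k. \<integral> m k(t) \<cdot> \<nabla>v(t, p k(t)) dt\<close>
(\<open>recip_gap_eq_dipole_functional\<close>).

Write \<open>w = x + iy\<close>. All five test families are combinations of at most two packets
\<open>w^a (cnj w)^b z^d \<eta>\<^sub>\<epsilon>^(e)(t - \<tau> + z/c)\<close>, which concentrate on a plane front travelling downwards in \<open>z\<close>. A source
meets the front of parameter \<open>\<tau>\<close> exactly once, at the time \<open>t\<^sub>k(\<tau>)\<close>, because its speed is below \<open>c\<close>.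
The substitution \<open>s = t + z/c\<close> along the path and \<open>e\<close> integrations by parts therefore turn the
functional of a packet, in the limit \<open>\<epsilon> \<rightarrow> 0\<close>, into \<open>(-1)^e\<close> times the \<open>e\<close>-th derivative at \<open>\<tau>\<close> of
an expression in
\<open>w\<^sub>k(\<tau>)\<close>, \<open>z\<^sub>k(\<tau>)\<close> (the position at time \<open>t\<^sub>k(\<tau>)\<close>) and \<open>q\<^sub>k(\<tau>) = t\<^sub>k'(\<tau>) (m\<^sub>x + i m\<^sub>y)(t\<^sub>k(\<tau>))\<close>.
With \<open>'\<close> for \<open>d/d\<tau>\<close>, the values of the functionals are

  \<^item> \<open>f\<^sub>n: n \<Sum> q w^(n-1)\<close>, and its first and second derivatives for \<open>g\<^sub>n\<close> and \<open>i\<^sub>n\<close>;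
  \<^item> \<open>h\<^sub>n: 2n(n-1) \<Sum> z q w^(n-2) + (1/c) (\<Sum> n w^(n-1) cnj w q + w^n cnj q)'\<close>, and its derivative
    for \<open>j\<^sub>n\<close>.

A source that is inactive at \<open>\<tau>\<close> has \<open>q\<^sub>k = 0\<close> there, and \<open>q\<^sub>k' = q\<^sub>k'' = 0\<close> if it is flat, so the sums
run over the active sources.

What remains is algebra in the nodes \<open>w\<^sub>k\<close>, which are distinct. The \<open>f\<close> values are power moments of the
measure with weight \<open>q\<^sub>k \<noteq> 0\<close> at \<open>w\<^sub>k\<close>; the difference of two such measures has at most as many nodes as
there are vanishing moments, so by Vandermonde the measures agree (\<open>prony_uniqueness\<close>). This gives
the number of active sources, a matching of the two configurations, and the equality of \<open>w\<close> and \<open>q\<close>.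
In the \<open>g\<close> values the unknowns \<open>q'\<close> and \<open>q w'\<close> multiply \<open>w^j\<close> and \<open>j w^(j-1)\<close>, so the confluent
Vandermonde system determines them; then the same system determines \<open>q''\<close> and \<open>q w''\<close> from the \<open>i\<close>
values. Now the derivative terms of the \<open>h\<close> and \<open>j\<close> values are known, and a Vandermonde system
determines \<open>z\<close> and afterwards \<open>z'\<close>. Finally \<open>t\<^sub>k(\<tau>) = \<tau> - z\<^sub>k(\<tau>)/c\<close> gives \<open>t\<^sub>k' = 1 - z\<^sub>k'/c\<close>, and the moment is
\<open>q\<^sub>k\<close> divided by \<open>t\<^sub>k'\<close>.\<close>

section \<open>Weighted nodes from their power moments\<close>

text \<open>The system with matrix entries \<open>w^j\<close> and \<open>j w^(j-1)\<close> says that the functional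
\<open>P \<mapsto> \<Sum> a P(w) + b P'(w)\<close> kills all monomials of degree below \<open>n\<close>. In this form the unknowns are
isolated by a choice of \<open>P\<close>.\<close>

lemma sum_poly_eq_0_of_moments:
  fixes w a b :: "'k \<Rightarrow> 'a::idom"
  assumes "finite S"
    and "\<And>j. j < n \<Longrightarrow> (\<Sum>k\<in>S. a k * w k ^ j + b k * (of_nat j * w k ^ (j - 1))) = 0"
    and "degree P < n"
  shows "(\<Sum>k\<in>S. a k * poly P (w k) + b k * poly (pderiv P) (w k)) = 0"
proof -
  have poly_pderiv_sum: "poly (pderiv P) x = (\<Sum>j\<le>degree P. coeff P j * (of_nat j * x ^ (j - 1)))" for x
  proof -
    have "pderiv P = (\<Sum>j\<le>degree P. pderiv (monom (coeff P j) j))"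
      by (simp add: poly_as_sum_of_monoms higher_pderiv_sum[of 1, simplified, symmetric])
    then show ?thesis
      by (simp add: pderiv_monom poly_sum poly_monom mult_ac)
  qed
  have "(\<Sum>k\<in>S. a k * poly P (w k) + b k * poly (pderiv P) (w k)) =
      (\<Sum>k\<in>S. \<Sum>j\<le>degree P. coeff P j * (a k * w k ^ j + b k * (of_nat j * w k ^ (j - 1))))"
    by (simp add: poly_pderiv_sum poly_altdef[of P] sum_distrib_left sum.distrib [symmetric] algebra_simps)
  also have "\<dots> = (\<Sum>j\<le>degree P. coeff P j * (\<Sum>k\<in>S. a k * w k ^ j + b k * (of_nat j * w k ^ (j - 1))))"
    by (subst sum.swap) (simp add: sum_distrib_left)
  also have "\<dots> = 0"
    using assms(2,3) by (intro sum.neutral) auto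
  finally show ?thesis .
qed

text \<open>Test with a polynomial that has double zeros at all nodes but \<open>w k\<close>: there both \<open>P\<close> and \<open>P'\<close> vanish.
A further simple zero at \<open>w k\<close> isolates \<open>b k\<close>, and without it \<open>a k\<close> is left.\<close>

lemma confluent_vandermonde:
  fixes w a b :: "'k \<Rightarrow> 'a::field"
  assumes fin: "finite S" and inj: "inj_on w S"
    and mom: "\<And>j. j < 2 * card S \<Longrightarrow> (\<Sum>k\<in>S. a k * w k ^ j + b k * (of_nat j * w k ^ (j - 1))) = 0"
    and k: "k \<in> S"
  shows "a k = 0" and "b k = 0"
proof -
  define R where "R = (\<Prod>l\<in>S - {k}. [:- w l, 1:]\<^sup>2)"
  have R_pos: "poly R (w k) \<noteq> 0"
    using fin inj k unfolding R_def poly_prod by (auto simp: inj_on_def)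
  have R_dvd: "[:- w l, 1:]\<^sup>2 dvd R" if "l \<in> S" "l \<noteq> k" for l
    using fin that unfolding R_def by (intro dvd_prodI) auto
  have "degree R = (\<Sum>l\<in>S - {k}. 2)"
    unfolding R_def by (subst degree_prod_eq_sum_degree) (simp_all add: degree_power_eq)
  then have R_deg: "degree R = 2 * (card S - 1)"
    using fin k by simp
  have card: "card S > 0"
    using fin k card_gt_0_iff by blast
  have test: "a k * poly P (w k) + b k * poly (pderiv P) (w k) = 0"
    if "R dvd P" "degree P < 2 * card S" for P
  proof -
    have "a l * poly P (w l) + b l * poly (pderiv P) (w l) = 0" if "l \<in> S - {k}" for l
    proof -
      have "[:- w l, 1:]\<^sup>2 dvd P"
        using \<open>R dvd P\<close> R_dvd that dvd_trans by blast
      then obtain q where "P = [:- w l, 1:]\<^sup>2 * q" ..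
      then show ?thesis
        unfolding power2_eq_square by (simp add: pderiv_mult pderiv_pCons del: mult_pCons_left mult_pCons_right)
    qed
    then have "(\<Sum>l\<in>S. a l * poly P (w l) + b l * poly (pderiv P) (w l)) =
        a k * poly P (w k) + b k * poly (pderiv P) (w k)"
      using fin k by (subst sum.remove[of S k]) auto
    then show ?thesis
      using sum_poly_eq_0_of_moments[OF fin mom that(2)] by simp
  qed
  have "R \<noteq> 0"
    using R_pos by auto
  then have "degree (R * [:- w k, 1:]) < 2 * card S"
    using R_deg card by (subst degree_mult_eq) auto
  from test[OF _ this] R_pos show b: "b k = 0"
    by (simp add: pderiv_mult pderiv_pCons del: mult_pCons_left mult_pCons_right)
  from test[of R] R_deg card b R_pos show "a k = 0"
    by simp
qed

text \<open>Same argument with simple zeros at the other nodes.\<close>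

lemma vandermonde:
  fixes w a :: "'k \<Rightarrow> 'a::field"
  assumes fin: "finite S" and inj: "inj_on w S"
    and mom: "\<And>j. j < card S \<Longrightarrow> (\<Sum>k\<in>S. a k * w k ^ j) = 0"
    and k: "k \<in> S"
  shows "a k = 0"
proof -
  define P where "P = (\<Prod>l\<in>S - {k}. [:- w l, 1:])"
  have P_k: "poly P (w k) \<noteq> 0"
    using fin inj k unfolding P_def poly_prod by (auto simp: inj_on_def)
  have P_l: "poly P (w l) = 0" if "l \<in> S - {k}" for l
    using fin that unfolding P_def poly_prod by (auto intro!: bexI[of _ l])
  have "degree P = card S - 1"
    using fin k unfolding P_def by (subst degree_prod_eq_sum_degree) simp_all
  then have deg: "degree P < card S"
    using fin k card_gt_0_iff[of S] by fastforce
  have "(\<Sum>l\<in>S. a l * poly P (w l)) = 0"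
    using sum_poly_eq_0_of_moments[OF fin _ deg, of a w "\<lambda>_. 0"] mom by simp
  moreover have "(\<Sum>l\<in>S. a l * poly P (w l)) = a k * poly P (w k)"
    using fin k P_l by (subst sum.remove[of S k]) auto
  ultimately show ?thesis
    using P_k by simp
qed

text \<open>Both sides are moments of finitely supported weights on the plane. Their difference lives on at most
\<open>card A + card B\<close> nodes and vanishes by Vandermonde. As the weights are nonzero, the two
sets of nodes coincide, and \<open>\<sigma>\<close> pairs equal nodes.\<close>

lemma prony_uniqueness:
  fixes w q :: "'k \<Rightarrow> 'a::field" and w' q' :: "'l \<Rightarrow> 'a"
  assumes fin: "finite A" "finite B" and inj: "inj_on w A" "inj_on w' B"
    and nz: "\<And>k. k \<in> A \<Longrightarrow> q k \<noteq> 0" "\<And>k. k \<in> B \<Longrightarrow> q' k \<noteq> 0"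
    and mom: "\<And>j. j < card A + card B \<Longrightarrow> (\<Sum>k\<in>A. q k * w k ^ j) = (\<Sum>k\<in>B. q' k * w' k ^ j)"
  obtains \<sigma> where "bij_betw \<sigma> A B" and "\<And>k. k \<in> A \<Longrightarrow> w' (\<sigma> k) = w k"
    and "\<And>k. k \<in> A \<Longrightarrow> q' (\<sigma> k) = q k"
proof -
  define X where "X = w ` A \<union> w' ` B"
  \<comment> \<open>the total weight that each family places at the node \<open>x\<close>\<close>
  define f where "f x = (\<Sum>k\<in>{k\<in>A. w k = x}. q k)" for x
  define f' where "f' x = (\<Sum>k\<in>{k\<in>B. w' k = x}. q' k)" for x
  have finX: "finite X"
    using fin by (simp add: X_def)
  have "card X \<le> card A + card B"
    unfolding X_def
    using card_Un_le[of "w ` A" "w' ` B"] card_image_le[OF fin(1), of w] card_image_le[OF fin(2), of w']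
    by linarith
  moreover have "(\<Sum>x\<in>X. f x * x ^ j) = (\<Sum>k\<in>A. q k * w k ^ j)" for j
  proof -
    have "(\<Sum>x\<in>X. f x * x ^ j) = (\<Sum>x\<in>X. \<Sum>k\<in>{k\<in>A. w k = x}. q k * w k ^ j)"
      by (simp add: f_def sum_distrib_right)
    also have "\<dots> = (\<Sum>k\<in>A. q k * w k ^ j)"
      using fin finX by (intro sum.group) (auto simp: X_def)
    finally show ?thesis .
  qed
  moreover have "(\<Sum>x\<in>X. f' x * x ^ j) = (\<Sum>k\<in>B. q' k * w' k ^ j)" for j
  proof -
    have "(\<Sum>x\<in>X. f' x * x ^ j) = (\<Sum>x\<in>X. \<Sum>k\<in>{k\<in>B. w' k = x}. q' k * w' k ^ j)"
      by (simp add: f'_def sum_distrib_right)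
    also have "\<dots> = (\<Sum>k\<in>B. q' k * w' k ^ j)"
      using fin finX by (intro sum.group) (auto simp: X_def)
    finally show ?thesis .
  qed
  ultimately have "(\<Sum>x\<in>X. (f x - f' x) * x ^ j) = 0" if "j < card X" for j
    using mom[of j] that by (simp add: left_diff_distrib sum_subtractf)
  then have eq: "f x = f' x" if "x \<in> X" for x
    using vandermonde[of X "\<lambda>x. x" "\<lambda>x. f x - f' x"] finX that by (auto simp: inj_on_def)
  have f_w: "f (w k) = q k" if "k \<in> A" for k
  proof -
    have "{l \<in> A. w l = w k} = {k}"
      using that inj by (auto simp: inj_on_def)
    then show ?thesis by (simp add: f_def)
  qed
  have f'_w: "f' (w' k) = q' k" if "k \<in> B" for k
  proof -
    have "{l \<in> B. w' l = w' k} = {k}"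
      using that inj by (auto simp: inj_on_def)
    then show ?thesis by (simp add: f'_def)
  qed
  have sub1: "w k \<in> w' ` B" if "k \<in> A" for k
  proof (rule ccontr)
    assume "w k \<notin> w' ` B"
    then have "f' (w k) = 0"
      unfolding f'_def by (intro sum.neutral) (metis (mono_tags, lifting) imageI mem_Collect_eq)
    then show False
      using eq[of "w k"] f_w[OF that] nz(1)[OF that] that by (simp add: X_def)
  qed
  have sub2: "w' k \<in> w ` A" if "k \<in> B" for k
  proof (rule ccontr)
    assume "w' k \<notin> w ` A"
    then have "f (w' k) = 0"
      unfolding f_def by (intro sum.neutral) (metis (mono_tags, lifting) imageI mem_Collect_eq)
    then show False
      using eq[of "w' k"] f'_w[OF that] nz(2)[OF that] that by (simp add: X_def)
  qed
  have "bij_betw w A (w' ` B)"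
    using inj(1) sub1 sub2 by (auto simp: bij_betw_def)
  moreover have "bij_betw (inv_into B w') (w' ` B) B"
    using inj(2) by (simp add: bij_betw_inv_into inj_on_imp_bij_betw)
  ultimately have bij: "bij_betw (inv_into B w' \<circ> w) A B"
    by (rule bij_betw_trans)
  have w'_eq: "w' ((inv_into B w' \<circ> w) k) = w k" if "k \<in> A" for k
    using sub1[OF that] by (simp add: f_inv_into_f)
  moreover have "q' ((inv_into B w' \<circ> w) k) = q k" if "k \<in> A" for k
  proof -
    have "(inv_into B w' \<circ> w) k \<in> B"
      using bij that by (meson bij_betwE)
    then show ?thesis
      using f'_w w'_eq[OF that] eq[of "w k"] f_w[OF that] that by (fastforce simp: X_def)
  qed
  ultimately show ?thesis
    using that bij by blast
qed

section \<open>The mollifier and its derivatives\<close>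

text \<open>The standard bump is smooth because these functions form a family that contains it and is closed
under differentiation, also at the end points \<open>\<plusminus>1\<close>.\<close>

definition bump_term :: "real poly \<Rightarrow> nat \<Rightarrow> real \<Rightarrow> real" where
  "bump_term P k s = (if \<bar>s\<bar> < 1 then poly P s / (1 - s\<^sup>2) ^ k * exp (- 1 / (1 - s\<^sup>2)) else 0)"

text \<open>From \<open>exp (1 / y) = exp (1 / (n y)) ^ n\<close> and \<open>exp x \<ge> x\<close>.\<close>

lemma exp_neg_inverse_le_power:
  fixes y :: real
  assumes "y > 0"
  shows "exp (- 1 / y) \<le> real n ^ n * y ^ n"
proof (cases "n = 0")
  case False
  have "1 / y / real n \<le> exp (1 / y / real n)"
    using exp_ge_add_one_self[of "1 / y / real n"] by linarith
  then have "(1 / y / real n) ^ n \<le> exp (1 / y / real n) ^ n"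
    using assms by (intro power_mono) auto
  also have "\<dots> = exp (1 / y)"
    using False by (simp flip: exp_of_nat_mult)
  finally have "1 / (real n * y) ^ n \<le> exp (1 / y)"
    using assms by (simp add: power_divide power_mult_distrib mult_ac)
  then have "1 / exp (1 / y) \<le> (real n * y) ^ n"
    using False assms by (simp add: field_simps)
  then show ?thesis
    by (simp add: exp_minus inverse_eq_divide power_mult_distrib)
qed (use assms in simp)

text \<open>Quadratic decay at \<open>\<plusminus>1\<close>, so that the difference quotients there tend to \<open>0\<close>. The
exponential beats \<open>k + 2\<close> powers of \<open>1 - s\<^sup>2\<close>: \<open>k\<close> of them cancel the denominator and two remain.\<close>

lemma bump_term_bound: "\<exists>B. \<forall>s. \<bar>bump_term P k s\<bar> \<le> B * (1 - s\<^sup>2)\<^sup>2"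
proof -
  have "bounded (poly P ` {-1..1})"
    by (intro compact_imp_bounded compact_continuous_image continuous_intros) auto
  then obtain M where "\<forall>x\<in>poly P ` {-1..1}. norm x \<le> M"
    unfolding bounded_iff by blast
  then have M: "\<And>s. s \<in> {-1..1} \<Longrightarrow> \<bar>poly P s\<bar> \<le> M"
    by auto
  have M0: "M \<ge> 0"
    using M[of 0] by auto
  define C where "C = real (k + 2) ^ (k + 2)"
  have "\<bar>bump_term P k s\<bar> \<le> M * C * (1 - s\<^sup>2)\<^sup>2" for s
  proof (cases "\<bar>s\<bar> < 1")
    case True
    define y where "y = 1 - s\<^sup>2"
    have y: "y > 0"
      using True by (simp add: y_def abs_square_less_1)
    have "\<bar>bump_term P k s\<bar> = \<bar>poly P s\<bar> / y ^ k * exp (- 1 / y)"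
      using True y by (simp add: bump_term_def abs_mult flip: y_def)
    also have "\<dots> \<le> M / y ^ k * (C * y ^ (k + 2))"
      using y M[of s] M0 True[unfolded abs_less_iff] exp_neg_inverse_le_power[OF y, of "k + 2"] unfolding C_def
      by (intro mult_mono divide_right_mono) auto
    also have "\<dots> = M * C * y\<^sup>2"
      using y by (simp add: power_add power2_eq_square)
    finally show ?thesis
      by (simp add: y_def)
  next
    case False
    then show ?thesis
      using M0 by (simp add: bump_term_def C_def)
  qed
  then show ?thesis by blast
qed

text \<open>In the interior this is the quotient and chain rule over the denominator \<open>(1 - s\<^sup>2) ^ (k + 2)\<close>.\<close>

lemma DERIV_bump_term:
  "(bump_term P k has_real_derivative
     bump_term (pderiv P * [:1, 0, -1:]\<^sup>2 + P * ([:0, 2 * of_nat k:] * [:1, 0, -1:] - [:0, 2:])) (k + 2) s) (at s)"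
  (is "(_ has_real_derivative bump_term ?Q _ _) _")
proof -
  consider "\<bar>s\<bar> < 1" | "\<bar>s\<bar> > 1" | "\<bar>s\<bar> = 1" by linarith
  then show ?thesis
  proof cases
    case 1
    define y where "y = 1 - s\<^sup>2"
    have y: "y > 0"
      using 1 by (simp add: y_def abs_square_less_1)
    have q: "poly [:1, 0, -1:] s = y"
      by (simp add: y_def power2_eq_square)
    have "((\<lambda>s. poly P s / (1 - s\<^sup>2) ^ k * exp (- 1 / (1 - s\<^sup>2))) has_real_derivative
        (poly (pderiv P) s * y ^ k - poly P s * (of_nat k * y ^ (k - 1) * (- (2 * s)))) / (y ^ k * y ^ k) *
          exp (- 1 / y) + exp (- 1 / y) * (- (2 * s) / y\<^sup>2) * (poly P s / y ^ k)) (at s)"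
    proof -
      have dy: "((\<lambda>s. 1 - s\<^sup>2) has_real_derivative - (2 * s)) (at s)"
        by (auto intro!: derivative_eq_intros)
      have "((\<lambda>s. - 1 / (1 - s\<^sup>2)) has_real_derivative - (2 * s) / y\<^sup>2) (at s)"
        using DERIV_divide[OF DERIV_const dy, of "-1"] y by (simp add: y_def power2_eq_square)
      note de = DERIV_fun_exp[OF this]
      have "((\<lambda>s. (1 - s\<^sup>2) ^ k) has_real_derivative of_nat k * y ^ (k - 1) * (- (2 * s))) (at s)"
        using DERIV_power[OF dy, of k] by (simp add: y_def mult_ac)
      from DERIV_mult[OF DERIV_divide[OF poly_DERIV[of P] this] de] y show ?thesis
        by (simp add: y_def)
    qed
    moreover have "(poly (pderiv P) s * y ^ k - poly P s * (of_nat k * y ^ (k - 1) * (- (2 * s)))) / (y ^ k * y ^ k) * e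
          + e * (- (2 * s) / y\<^sup>2) * (poly P s / y ^ k) =
        (poly (pderiv P) s * y\<^sup>2 + poly P s * (2 * of_nat k * s * y - 2 * s)) / y ^ (k + 2) * e" for e
      using y by (cases k) (simp_all add: field_simps power2_eq_square)
    moreover have "bump_term ?Q (k + 2) s =
        (poly (pderiv P) s * y\<^sup>2 + poly P s * (2 * of_nat k * s * y - 2 * s)) / y ^ (k + 2) * exp (- 1 / y)"
      unfolding bump_term_def poly_add poly_mult poly_diff poly_power q
      using 1 by (simp add: mult_ac flip: y_def)
    ultimately have "((\<lambda>s. poly P s / (1 - s\<^sup>2) ^ k * exp (- 1 / (1 - s\<^sup>2))) has_real_derivative
        bump_term ?Q (k + 2) s) (at s)" by simp
    then show ?thesis
      by (rule has_field_derivative_transform_within_open[where S="{-1<..<1}"])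
        (use 1 in \<open>auto simp: bump_term_def\<close>)
  next
    case 2
    have "((\<lambda>_. 0) has_real_derivative bump_term ?Q (k + 2) s) (at s)"
      using 2 by (simp add: bump_term_def)
    then show ?thesis
      by (rule has_field_derivative_transform_within_open[where S="- {-1..1}"])
        (use 2 in \<open>auto simp: bump_term_def\<close>)
  next
    case 3
    then have s2: "s\<^sup>2 = 1"
      by (metis abs_square_eq_1)
    obtain B where B: "\<And>x. \<bar>bump_term P k x\<bar> \<le> B * (1 - x\<^sup>2)\<^sup>2"
      using bump_term_bound by blast
    have "((\<lambda>x. (bump_term P k x - bump_term P k s) / (x - s)) \<longlongrightarrow> 0) (at s)"
    proof (rule Lim_null_comparison)
      show "\<forall>\<^sub>F x in at s. norm ((bump_term P k x - bump_term P k s) / (x - s)) \<le> \<bar>B * (x - s) * (x + s)\<^sup>2\<bar>"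
        unfolding eventually_at_filter
      proof (rule always_eventually, intro allI impI)
        fix x assume "x \<noteq> s"
        have "1 - x\<^sup>2 = - ((x - s) * (x + s))"
          using s2 by (simp add: algebra_simps power2_eq_square)
        then have "(1 - x\<^sup>2)\<^sup>2 = ((x - s) * (x + s))\<^sup>2"
          by (simp only: power2_minus)
        then have "\<bar>bump_term P k x\<bar> \<le> B * ((x - s) * (x + s))\<^sup>2"
          using B[of x] by simp
        also have "\<dots> \<le> \<bar>B * ((x - s) * (x + s))\<^sup>2\<bar>" by simp
        finally have "\<bar>bump_term P k x\<bar> \<le> \<bar>B * (x - s) * (x + s)\<^sup>2\<bar> * \<bar>x - s\<bar>"
          by (simp add: abs_mult power2_eq_square mult_ac)
        moreover have "bump_term P k s = 0"
          using 3 by (simp add: bump_term_def)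
        ultimately show "norm ((bump_term P k x - bump_term P k s) / (x - s)) \<le> \<bar>B * (x - s) * (x + s)\<^sup>2\<bar>"
          using \<open>x \<noteq> s\<close> by (simp add: divide_le_eq)
      qed
      have "((\<lambda>x. \<bar>B * (x - s) * (x + s)\<^sup>2\<bar>) \<longlongrightarrow> \<bar>B * (s - s) * (s + s)\<^sup>2\<bar>) (at s)"
        by (intro tendsto_intros)
      then show "((\<lambda>x. \<bar>B * (x - s) * (x + s)\<^sup>2\<bar>) \<longlongrightarrow> 0) (at s)" by simp
    qed
    then show ?thesis
      using 3 by (simp add: bump_term_def has_field_derivative_iff)
  qed
qed

lemma deriv_bump_is_bump_term: "\<exists>P j. (deriv ^^ k) bump = bump_term P j"
proof (induction k)
  case 0
  have "bump = bump_term 1 0"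
    by (auto simp: bump_def bump_term_def)
  then show ?case by (metis funpow_0)
next
  case (Suc k)
  then obtain P j where "(deriv ^^ k) bump = bump_term P j" by blast
  then have "(deriv ^^ Suc k) bump = deriv (bump_term P j)" by simp
  moreover obtain Q where "deriv (bump_term P j) = bump_term Q (j + 2)"
    using DERIV_imp_deriv[OF DERIV_bump_term] by blast
  ultimately show ?case by metis
qed

lemma DERIV_deriv_bump: "((deriv ^^ k) bump has_real_derivative (deriv ^^ Suc k) bump s) (at s)"
  using deriv_bump_is_bump_term[of k] DERIV_bump_term DERIV_imp_deriv
  by (metis (no_types, lifting) funpow.simps(2) comp_apply)

lemma deriv_bump_eq_0: "\<bar>s\<bar> \<ge> 1 \<Longrightarrow> (deriv ^^ k) bump s = 0"
  using deriv_bump_is_bump_term[of k] by (auto simp: bump_term_def)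

lemma continuous_on_bump: "continuous_on A bump"
  using DERIV_deriv_bump[of 0] by (intro DERIV_continuous_on[of A bump]) (auto intro: DERIV_subset)

lemma bump_nonneg: "bump s \<ge> 0"
  by (simp add: bump_def)

lemma integral_bump_pos: "integral UNIV bump > 0"
proof -
  have "integral UNIV bump = integral {-1..1} bump"
    by (rule integral_spike_set) (auto intro!: negligible_subset[of "{}"] simp: bump_def)
  moreover have "integral {-1..1} bump \<ge> 0"
    by (intro integral_nonneg integrable_continuous_interval continuous_on_bump) (auto simp: bump_def)
  moreover have "integral {-1..1} bump \<noteq> 0"
  proof
    assume "integral {-1..1} bump = 0"
    then have "bump 0 = 0"
      using integral_eq_0_iff[of "-1" 1 bump] continuous_on_bump bump_nonneg by auto
    then show False by (simp add: bump_def)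
  qed
  ultimately show ?thesis by simp
qed

text \<open>The \<open>k\<close>-th derivative of \<open>mollifier \<epsilon>\<close>, by the chain rule.\<close>

definition mollifier_deriv :: "real \<Rightarrow> nat \<Rightarrow> real \<Rightarrow> real" where
  "mollifier_deriv \<epsilon> k s = (deriv ^^ k) bump (s / \<epsilon>) / (\<epsilon> ^ Suc k * integral UNIV bump)"

lemma mollifier_deriv_0: "mollifier_deriv \<epsilon> 0 = mollifier \<epsilon>"
  by (auto simp: mollifier_deriv_def mollifier_def)

lemma DERIV_mollifier_deriv:
  assumes "\<epsilon> > 0"
  shows "(mollifier_deriv \<epsilon> k has_real_derivative mollifier_deriv \<epsilon> (Suc k) s) (at s)"
proof -
  have "((\<lambda>s. (deriv ^^ k) bump (s / \<epsilon>)) has_real_derivative (deriv ^^ Suc k) bump (s / \<epsilon>) * (1 / \<epsilon>)) (at s)"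
    by (rule DERIV_chain'[OF _ DERIV_deriv_bump]) (use assms in \<open>auto intro!: derivative_eq_intros\<close>)
  from DERIV_cdivide[OF this, of "\<epsilon> ^ Suc k * integral UNIV bump"]
  show ?thesis
    using assms by (simp add: mollifier_deriv_def[abs_def] mult_ac)
qed

lemma mollifier_deriv_eq_0:
  assumes "\<epsilon> > 0" "\<bar>s\<bar> \<ge> \<epsilon>"
  shows "mollifier_deriv \<epsilon> k s = 0"
  using assms by (simp add: mollifier_deriv_def deriv_bump_eq_0 divide_simps)

lemma has_integral_mollifier:
  assumes "\<epsilon> > 0"
  shows "((\<lambda>s. mollifier \<epsilon> (s - \<tau>)) has_integral 1) {\<tau> - \<epsilon>..\<tau> + \<epsilon>}"
proof -
  have "((\<lambda>s. (1 / \<epsilon>) *\<^sub>R bump ((s - \<tau>) / \<epsilon>)) has_integral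
      integral {(\<tau> - \<epsilon> - \<tau>) / \<epsilon>..(\<tau> + \<epsilon> - \<tau>) / \<epsilon>} bump) {\<tau> - \<epsilon>..\<tau> + \<epsilon>}"
    using assms
    by (intro has_integral_substitution[where c="-1" and d=1])
       (auto intro!: continuous_on_bump derivative_eq_intros simp: divide_simps)
  moreover have "integral UNIV bump = integral {-1..1} bump"
    by (rule integral_spike_set) (auto intro!: negligible_subset[of "{}"] simp: bump_def)
  ultimately have "((\<lambda>s. (1 / \<epsilon>) *\<^sub>R bump ((s - \<tau>) / \<epsilon>)) has_integral integral UNIV bump) {\<tau> - \<epsilon>..\<tau> + \<epsilon>}"
    using assms by simp
  from has_integral_divide[OF this, of "integral UNIV bump"] show ?thesis
    using integral_bump_pos by (simp add: mollifier_def)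
qed

lemma mollifier_nonneg: "\<epsilon> > 0 \<Longrightarrow> mollifier \<epsilon> s \<ge> 0"
  using integral_bump_pos bump_nonneg[of "s / \<epsilon>"] by (simp add: mollifier_def)

section \<open>Continuously differentiable functions of a real variable\<close>

text \<open>Unlike \<open>C_time\<close>, this is for open sets, with two-sided derivatives. The recursion peels
off the first derivative, which is the step of all closure proofs below.\<close>

fun C_on :: "nat \<Rightarrow> real set \<Rightarrow> (real \<Rightarrow> 'a::real_normed_vector) \<Rightarrow> bool" where
  "C_on 0 J f = continuous_on J f"
| "C_on (Suc n) J f = ((\<forall>s\<in>J. f differentiable (at s)) \<and> C_on n J (\<lambda>s. vector_derivative f (at s)))"

abbreviation dv :: "(real \<Rightarrow> 'a::real_normed_vector) \<Rightarrow> real \<Rightarrow> 'a" where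
  "dv f \<equiv> (\<lambda>s. vector_derivative f (at s))"

lemma dv_cong:
  assumes "open J" "s \<in> J" "\<And>s. s \<in> J \<Longrightarrow> f s = g s"
  shows "dv f s = dv g s"
  using assms by (intro vector_derivative_cong_eq) (auto simp: eventually_nhds)

lemma C_on_cong:
  assumes "open J" "\<And>s. s \<in> J \<Longrightarrow> f s = g s"
  shows "C_on n J f \<longleftrightarrow> C_on n J g"
  using assms(2)
proof (induction n arbitrary: f g)
  case 0
  then show ?case by (simp cong: continuous_on_cong)
next
  case (Suc n)
  have "f differentiable (at s) \<longleftrightarrow> g differentiable (at s)" if "s \<in> J" for s
    using Suc.prems that assms(1)
    unfolding differentiable_def by (metis (no_types, lifting) has_derivative_transform_within_open)
  moreover have "C_on n J (dv f) \<longleftrightarrow> C_on n J (dv g)"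
    using Suc.prems assms(1) by (intro Suc.IH dv_cong)
  ultimately show ?case by simp
qed

lemma C_onI:
  assumes "open J" "\<And>s. s \<in> J \<Longrightarrow> (f has_vector_derivative f' s) (at s)" "C_on n J f'"
  shows "C_on (Suc n) J f"
  using assms C_on_cong[of J "dv f" f' n]
  by (auto simp: vector_derivative_at intro: differentiableI_vector)

lemma C_on_has_vector_derivative:
  assumes "C_on (Suc n) J f" "s \<in> J"
  shows "(f has_vector_derivative dv f s) (at s)"
  using assms by (simp add: vector_derivative_works)

lemma C_on_imp_continuous_on: "C_on n J f \<Longrightarrow> continuous_on J f"
proof (cases n)
  case (Suc k)
  assume f: "C_on n J f"
  show ?thesis
  proof (rule continuous_at_imp_continuous_on, rule ballI)
    fix s assume "s \<in> J"
    then have "f differentiable (at s)" using f Suc by simp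
    then show "isCont f s" by (rule differentiable_imp_continuous_within)
  qed
qed simp

lemma C_on_SucD: "C_on (Suc n) J f \<Longrightarrow> C_on n J f"
proof (induction n arbitrary: f)
  case 0
  then show ?case using C_on_imp_continuous_on[of "Suc 0" J f] by simp
next
  case (Suc n)
  then show ?case by (metis C_on.simps(2))
qed

lemma C_on_mono: "C_on n J f \<Longrightarrow> m \<le> n \<Longrightarrow> C_on m J f"
  by (induction "n - m" arbitrary: n) (auto, metis C_on_SucD Suc_diff_Suc Suc_le_D diff_Suc_Suc diff_diff_cancel diff_le_self le_antisym not_less_eq_eq)

lemma C_on_dv: "C_on (Suc n) J f \<Longrightarrow> C_on n J (dv f)"
  by simp

lemma C_on_const: "open J \<Longrightarrow> C_on n J (\<lambda>_. c)"
proof (induction n arbitrary: c)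
  case (Suc n)
  then show ?case by (intro C_onI[where f'="\<lambda>_. 0"]) (auto intro: derivative_intros)
qed auto

lemma C_on_add:
  assumes "open J" "C_on n J f" "C_on n J g"
  shows "C_on n J (\<lambda>s. f s + g s)"
  using assms(2,3)
proof (induction n arbitrary: f g)
  case (Suc n)
  then show ?case
    using assms(1)
    by (intro C_onI[where f'="\<lambda>s. dv f s + dv g s"] has_vector_derivative_add)
       (auto intro: C_on_has_vector_derivative)
qed (auto intro: continuous_intros)

lemma C_on_bounded_linear:
  assumes "open J" "bounded_linear L" "C_on n J f"
  shows "C_on n J (\<lambda>s. L (f s))"
  using assms(3)
proof (induction n arbitrary: f)
  case 0
  then show ?case
    using assms(2) by (auto intro: bounded_linear.continuous_on)
next
  case (Suc n)
  then show ?case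
    using assms(1)
    by (intro C_onI[where f'="\<lambda>s. L (dv f s)"] bounded_linear.has_vector_derivative[OF assms(2)])
       (auto intro: C_on_has_vector_derivative)
qed

text \<open>By Leibniz, the derivative of a product is a sum of products of functions of class \<open>C n\<close>, to which the
induction hypothesis applies. The chain rule and the rule for inverses work in the same way.\<close>

lemma C_on_bounded_bilinear:
  assumes "open J" "bounded_bilinear pr" "C_on n J f" "C_on n J g"
  shows "C_on n J (\<lambda>s. pr (f s) (g s))"
  using assms(3,4)
proof (induction n arbitrary: f g)
  case 0
  then show ?case
    by (simp add: bounded_bilinear.continuous_on[OF assms(2)])
next
  case (Suc n)
  show ?case
  proof (rule C_onI[OF assms(1)])
    fix s assume "s \<in> J"
    then show "((\<lambda>s. pr (f s) (g s)) has_vector_derivative pr (f s) (dv g s) + pr (dv f s) (g s)) (at s)"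
      using Suc.prems by (intro bounded_bilinear.has_vector_derivative[OF assms(2)] C_on_has_vector_derivative)
  next
    show "C_on n J (\<lambda>s. pr (f s) (dv g s) + pr (dv f s) (g s))"
      using Suc.prems by (intro C_on_add[OF assms(1)] Suc.IH C_on_SucD[of n] C_on_dv)
  qed
qed

lemmas C_on_mult = C_on_bounded_bilinear[OF _ bounded_bilinear_mult]
lemmas C_on_scaleR = C_on_bounded_bilinear[OF _ bounded_bilinear_scaleR]

lemma C_on_power:
  fixes f :: "real \<Rightarrow> 'a::real_normed_algebra_1"
  assumes "open J" "C_on n J f"
  shows "C_on n J (\<lambda>s. f s ^ j)"
  by (induction j) (auto intro: C_on_mult C_on_const assms)

lemma C_on_compose:
  assumes "open I" "open J" "C_on n I f" "C_on n J g" "\<And>s. s \<in> J \<Longrightarrow> g s \<in> I"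
  shows "C_on n J (\<lambda>s. f (g s))"
  using assms(3,4)
proof (induction n arbitrary: f)
  case 0
  then show ?case
    using assms(5) by (auto intro: continuous_on_compose2)
next
  case (Suc n)
  have "((\<lambda>s. f (g s)) has_vector_derivative dv g s *\<^sub>R dv f (g s)) (at s)" if "s \<in> J" for s
    using vector_diff_chain_at[OF C_on_has_vector_derivative[OF Suc.prems(2) that]
      C_on_has_vector_derivative[OF Suc.prems(1) assms(5)[OF that]]] by (simp add: o_def)
  moreover have "C_on n J (\<lambda>s. dv g s *\<^sub>R dv f (g s))"
    using Suc.prems by (intro C_on_scaleR assms(2) C_on_dv Suc.IH C_on_SucD[of n])
  ultimately show ?case
    by (rule C_onI[OF assms(2)])
qed

lemma C_on_inverse:
  fixes f :: "real \<Rightarrow> real"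
  assumes "open J" "C_on n J f" "\<And>s. s \<in> J \<Longrightarrow> f s \<noteq> 0"
  shows "C_on n J (\<lambda>s. inverse (f s))"
  using assms(2)
proof (induction n)
  case 0
  then show ?case
    using assms(3) by (auto intro: continuous_intros)
next
  case (Suc n)
  show ?case
  proof (rule C_onI[OF assms(1)])
    fix s assume "s \<in> J"
    from C_on_has_vector_derivative[OF Suc.prems this]
    have "(f has_real_derivative dv f s) (at s)"
      by (simp add: has_real_derivative_iff_has_vector_derivative)
    from DERIV_inverse'[OF this assms(3)[OF \<open>s \<in> J\<close>]]
    show "((\<lambda>s. inverse (f s)) has_vector_derivative - (inverse (f s) * dv f s * inverse (f s))) (at s)"
      by (simp add: has_real_derivative_iff_has_vector_derivative)
  next
    have "C_on n J (\<lambda>s. inverse (f s) * dv f s * inverse (f s))"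
      using Suc.prems by (intro C_on_mult assms(1) Suc.IH C_on_dv C_on_SucD[of n])
    then show "C_on n J (\<lambda>s. - (inverse (f s) * dv f s * inverse (f s)))"
      by (rule C_on_bounded_linear[OF assms(1) bounded_linear_minus[OF bounded_linear_ident]])
  qed
qed

lemma C_on_funpow_dv: "C_on (n + j) J f \<Longrightarrow> C_on n J ((dv ^^ j) f)"
  by (induction j arbitrary: f) (auto simp: funpow_Suc_right simp del: funpow.simps)

lemma C_time_Suc:
  "C_time (Suc n) T f \<longleftrightarrow>
     (\<forall>t\<in>{0..T}. f differentiable (at t within {0..T})) \<and> C_time n T (time_deriv T f)"
  unfolding C_time_def All_less_Suc2 funpow_Suc_right by auto

lemma has_vector_derivative_time_deriv:
  assumes "f differentiable (at t within {0..T})" "t \<in> {0<..<T}"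
  shows "(f has_vector_derivative time_deriv T f t) (at t)"
  using assms by (simp add: vector_derivative_works time_deriv_def at_within_Icc_at)

lemma C_time_imp_C_on: "C_time n T f \<Longrightarrow> C_on n {0<..<T} f"
proof (induction n arbitrary: f)
  case 0
  then show ?case by (auto simp: C_time_def intro: continuous_on_subset)
next
  case (Suc n)
  then show ?case
    by (intro C_onI[where f'="time_deriv T f"] has_vector_derivative_time_deriv)
       (auto simp: C_time_Suc)
qed

section \<open>Wave packets\<close>

text \<open>\<open>E e\<close> stands for the \<open>e\<close>-th derivative of the profile. A partial derivative of a packet is a
combination of packets with shifted exponents; a truncated subtraction in
\<open>a - 1\<close> is harmless since it comes with the factor \<open>a\<close>.\<close>

definition packet ::
    "real \<Rightarrow> real \<Rightarrow> (nat \<Rightarrow> real \<Rightarrow> real) \<Rightarrow> nat \<Rightarrow> nat \<Rightarrow> nat \<Rightarrow> nat \<Rightarrow> real \<times> (real^3) \<Rightarrow> complex" where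
  "packet c \<tau> E a b d e = (\<lambda>(t, r). cxy r ^ a * cnj (cxy r) ^ b * of_real (r $ 3) ^ d *
     of_real (E e (t - (\<tau> - r $ 3 / c))))"

lemma bounded_linear_cxy: "bounded_linear cxy"
  by (auto intro!: linearI simp: cxy_def complex_eq_iff simp flip: linear_conv_bounded_linear)

lemma pd_eqI: "(f has_derivative f') (at x) \<Longrightarrow> pd e f x = f' e"
  by (metis frechet_derivative_at pd_def)

lemma pd_linear_combination:
  assumes "f differentiable at x" "g differentiable at x"
  shows "pd e (\<lambda>x. \<alpha> * f x + \<beta> * g x :: complex) x = \<alpha> * pd e f x + \<beta> * pd e g x"
proof -
  have "((\<lambda>x. \<alpha> * f x + \<beta> * g x) has_derivative
      (\<lambda>h. \<alpha> * frechet_derivative f (at x) h + \<beta> * frechet_derivative g (at x) h)) (at x)"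
    using assms by (auto intro!: derivative_intros simp: frechet_derivative_works)
  then show ?thesis
    unfolding pd_def by (metis frechet_derivative_at)
qed

text \<open>A space of differentiable functions closed under all partial derivatives, hence of smooth functions.\<close>

inductive packet_span ::
    "real \<Rightarrow> real \<Rightarrow> (nat \<Rightarrow> real \<Rightarrow> real) \<Rightarrow> (real \<times> (real^3) \<Rightarrow> complex) \<Rightarrow> bool" for c \<tau> E where
  packet: "packet_span c \<tau> E (\<lambda>x. \<alpha> * packet c \<tau> E a b d e x)"
| add: "packet_span c \<tau> E f \<Longrightarrow> packet_span c \<tau> E g \<Longrightarrow> packet_span c \<tau> E (\<lambda>x. f x + g x)"

locale wave_profile =
  fixes c \<tau> :: real and E :: "nat \<Rightarrow> real \<Rightarrow> real"
  assumes DERIV_E: "\<And>k s. (E k has_real_derivative E (Suc k) s) (at s)"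
    and c_nz: "c \<noteq> 0"
begin

abbreviation "pk \<equiv> packet c \<tau> E"

lemma has_derivative_packet:
  "(pk a b d e has_derivative (\<lambda>h.
      of_real (fst h) * pk a b d (Suc e) x
      + cxy (snd h) * (of_nat a * pk (a - 1) b d e x)
      + cnj (cxy (snd h)) * (of_nat b * pk a (b - 1) d e x)
      + of_real (snd h $ 3) * (of_nat d * pk a b (d - 1) e x + pk a b d (Suc e) x / of_real c))) (at x)"
proof -
  obtain t r where x: "x = (t, r)" by fastforce
  define s where "s = t - (\<tau> - r $ 3 / c)"
  have dw: "((\<lambda>y. cxy (snd y)) has_derivative (\<lambda>h. cxy (snd h))) (at x)"
    by (intro bounded_linear.has_derivative[OF bounded_linear_cxy] derivative_intros)
  have dz: "((\<lambda>y. of_real (snd y $ 3) :: complex) has_derivative (\<lambda>h. of_real (snd h $ 3))) (at x)"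
    using c_nz by (auto intro!: derivative_eq_intros bounded_linear.has_derivative[OF bounded_linear_vec_nth])
  have ds: "((\<lambda>y. fst y - (\<tau> - snd y $ 3 / c)) has_derivative (\<lambda>h. fst h + snd h $ 3 / c)) (at x)"
    using c_nz by (auto intro!: derivative_eq_intros bounded_linear.has_derivative[OF bounded_linear_vec_nth])
  have "((\<lambda>y. E e (fst y - (\<tau> - snd y $ 3 / c))) has_derivative (\<lambda>h. (fst h + snd h $ 3 / c) * E (Suc e) s)) (at x)"
    using DERIV_compose_FDERIV[OF DERIV_E[of e] ds] by (simp add: x s_def mult_ac)
  then have dE: "((\<lambda>y. of_real (E e (fst y - (\<tau> - snd y $ 3 / c))) :: complex) has_derivative
      (\<lambda>h. of_real ((fst h + snd h $ 3 / c) * E (Suc e) s))) (at x)"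
    by (intro derivative_intros)
  have "(\<lambda>y. cxy (snd y) ^ a * cnj (cxy (snd y)) ^ b * of_real (snd y $ 3) ^ d *
     of_real (E e (fst y - (\<tau> - snd y $ 3 / c)))) = pk a b d e"
    by (auto simp: packet_def)
  with has_derivative_mult[OF has_derivative_mult[OF has_derivative_mult[OF has_derivative_power[OF dw, of a]
    has_derivative_power[OF has_derivative_cnj[OF dw], of b]] has_derivative_power[OF dz, of d]] dE]
  show ?thesis
    by (auto elim!: has_derivative_eq_rhs simp: x packet_def s_def algebra_simps add_divide_distrib)
qed

lemmas pd_packet = pd_eqI[OF has_derivative_packet]

lemma differentiable_packet: "pk a b d e differentiable at x"
  using has_derivative_packet by (rule differentiableI)

lemma cxy_axis: "cxy (axis 1 1) = 1" "cxy (axis 2 1) = \<i>" "cxy (axis 3 1) = 0"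
  by (auto simp: cxy_def axis_def complex_eq_iff)

lemma D_t_packet: "D_t (pk a b d e) = pk a b d (Suc e)"
  by (auto simp: pd_packet cxy_def complex_eq_iff)

lemma D_sp_packet:
  "D_sp 1 (pk a b d e) = (\<lambda>x. of_nat a * pk (a - 1) b d e x + of_nat b * pk a (b - 1) d e x)"
  "D_sp 2 (pk a b d e) = (\<lambda>x. (\<i> * of_nat a) * pk (a - 1) b d e x + (- \<i> * of_nat b) * pk a (b - 1) d e x)"
  "D_sp 3 (pk a b d e) = (\<lambda>x. of_nat d * pk a b (d - 1) e x + inverse (of_real c) * pk a b d (Suc e) x)"
    apply (rule ext, simp add: pd_packet cxy_axis, simp add: axis_def)
   apply (rule ext, simp add: pd_packet cxy_axis, simp add: axis_def)
  apply (rule ext, simp add: pd_packet cxy_axis axis_nth divide_inverse)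
  done

lemma pd_packet_combination:
  "pd h (\<lambda>x. \<alpha> * pk a b d e x + \<beta> * pk a' b' d' e' x) =
      (\<lambda>x. \<alpha> * pd h (pk a b d e) x + \<beta> * pd h (pk a' b' d' e') x)"
  by (auto simp: pd_linear_combination differentiable_packet)

lemma wave_op_packet_combination:
  "wave_op c (\<lambda>x. \<alpha> * pk a b d e x + \<beta> * pk a' b' d' e' x) x =
     \<alpha> * wave_op c (pk a b d e) x + \<beta> * wave_op c (pk a' b' d' e') x"
proof -
  have "pd (0, axis i 1) (pk a b d e) differentiable at x" for i x a b d e
    using exhaust_3[of i] unfolding D_sp_packet
    by (elim disjE; simp only: D_sp_packet)
      (intro differentiable_add differentiable_mult differentiable_const differentiable_packet)+
  then show ?thesis
    by (simp add: wave_op_def pd_packet_combination pd_linear_combination D_t_packet differentiable_packet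
        sum.distrib sum_distrib_left algebra_simps)
qed

text \<open>The functions \<open>z \<mapsto> E(t + z/c)\<close> solve the wave equation, so the terms with two derivatives of the profile
cancel. What is left comes from \<open>\<partial>\<^sub>x\<^sup>2 + \<partial>\<^sub>y\<^sup>2 = 4 \<partial>\<^sub>w \<partial>\<^bsub>cnj w\<^esub>\<close> and from the derivatives that hit \<open>z ^ d\<close>.\<close>

lemma wave_op_packet:
  "wave_op c (pk a b d e) x =
    - (4 * of_nat a * of_nat b * pk (a - 1) (b - 1) d e x
       + of_nat d * of_nat (d - 1) * pk a b (d - 2) e x
       + 2 * of_nat d * inverse (of_real c) * pk a b (d - 1) (Suc e) x)"
proof -
  have "D_sp 1 (D_sp 1 (pk a b d e)) x + D_sp 2 (D_sp 2 (pk a b d e)) x =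
      4 * of_nat a * of_nat b * pk (a - 1) (b - 1) d e x"
    by (simp only: D_sp_packet pd_packet_combination) (simp add: algebra_simps)
  moreover have "D_sp 3 (D_sp 3 (pk a b d e)) x =
      of_nat d * of_nat (d - 1) * pk a b (d - 2) e x
      + 2 * of_nat d * inverse (of_real c) * pk a b (d - 1) (Suc e) x
      + inverse (of_real c) * inverse (of_real c) * pk a b d (Suc (Suc e)) x"
    by (simp only: D_sp_packet pd_packet_combination) (simp add: algebra_simps numeral_2_eq_2)
  ultimately show ?thesis
    by (simp add: wave_op_def sum_3 D_t_packet power2_eq_square divide_inverse)
qed

lemma packet_span_differentiable: "packet_span c \<tau> E f \<Longrightarrow> f differentiable at x"
  by (induction rule: packet_span.induct) (auto intro!: derivative_intros differentiable_packet)

lemma packet_span_pd: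
  assumes "packet_span c \<tau> E f"
  shows "packet_span c \<tau> E (pd h f)"
  using assms
proof induction
  case (packet \<alpha> a b d e)
  have "pd h (\<lambda>x. \<alpha> * pk a b d e x) = (\<lambda>x.
      (\<alpha> * (of_real (fst h) + of_real (snd h $ 3) / of_real c)) * pk a b d (Suc e) x
      + (\<alpha> * cxy (snd h) * of_nat a) * pk (a - 1) b d e x
      + (\<alpha> * cnj (cxy (snd h)) * of_nat b) * pk a (b - 1) d e x
      + (\<alpha> * of_real (snd h $ 3) * of_nat d) * pk a b (d - 1) e x)"
  proof
    fix x
    have "pd h (\<lambda>x. \<alpha> * pk a b d e x) x = \<alpha> * pd h (pk a b d e) x"
      using pd_packet_combination[of h \<alpha> a b d e 0 a b d e] by simp
    then show "pd h (\<lambda>x. \<alpha> * pk a b d e x) x =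
      (\<alpha> * (of_real (fst h) + of_real (snd h $ 3) / of_real c)) * pk a b d (Suc e) x
      + (\<alpha> * cxy (snd h) * of_nat a) * pk (a - 1) b d e x
      + (\<alpha> * cnj (cxy (snd h)) * of_nat b) * pk a (b - 1) d e x
      + (\<alpha> * of_real (snd h $ 3) * of_nat d) * pk a b (d - 1) e x"
      by (simp add: pd_packet algebra_simps)
  qed
  then show ?case
    by (simp only:) (intro packet_span.intros)
next
  case (add f g)
  have "pd h (\<lambda>x. f x + g x) = (\<lambda>x. pd h f x + pd h g x)"
    using pd_linear_combination[of f _ g h 1 1] add.hyps packet_span_differentiable by fastforce
  then show ?case
    using packet_span.add[OF add.IH] by simp
qed

lemma smooth_on_packet_span:
  assumes "packet_span c \<tau> E f"
  shows "smooth_on S f"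
proof -
  have "packet_span c \<tau> E (foldr pd es f)" for es
    by (induction es) (auto simp: assms packet_span_pd)
  then show ?thesis
    by (simp add: smooth_on_def packet_span_differentiable)
qed

lemma smooth_on_packet_combination: "smooth_on S (\<lambda>x. \<alpha> * pk a b d e x + \<beta> * pk a' b' d' e' x)"
  by (intro smooth_on_packet_span packet_span.intros)

end

section \<open>The reciprocity gap functional as a functional of the sources\<close>

lemma foldr_pd_zero: "foldr pd es (\<lambda>_. 0) = (\<lambda>_. 0)"
  by (induction es) (auto simp: pd_def[abs_def])

lemma test_fun_zero: "test_fun A (\<lambda>_. 0)"
  by (simp add: test_fun_def smooth_on_def foldr_pd_zero)

lemma distribution_zero:
  assumes "distribution A u"
  shows "u (\<lambda>_. 0) = 0"
proof -
  have "u (\<lambda>x. a * \<psi> x + b * \<theta> x) = a * u \<psi> + b * u \<theta>"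
    if "test_fun A \<psi>" "test_fun A \<theta>" for \<psi> \<theta> a b
    using assms that unfolding distribution_def by blast
  from this[OF test_fun_zero test_fun_zero, of 0 0] show ?thesis by simp
qed

lemma dist_time_deriv_zero:
  assumes "T > 0" and "\<And>t. t \<in> {0..T} \<Longrightarrow> distribution A (u t)" and "t \<in> {0..T}"
  shows "dist_time_deriv T u t (\<lambda>_. 0) = 0"
proof -
  have "((\<lambda>s. u s (\<lambda>_. 0)) has_vector_derivative 0) (at t within {0..T})"
    by (rule has_vector_derivative_transform[OF assms(3) _ has_vector_derivative_const[of 0]])
       (simp add: distribution_zero[OF assms(2)])
  then show ?thesis
    using assms(1,3) unfolding dist_time_deriv_def time_deriv_def
    by (simp add: vector_derivative_within_closed_interval)
qed

text \<open>The cutoff is supported in \<open>\<Omega>\<close>, so both parts of the pairing are evaluated at the zero function.\<close>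

lemma pairing_eq_0:
  assumes "u (\<lambda>_. 0) = 0" and "{r. \<kappa> r \<noteq> 0} \<subseteq> \<Omega>" and "\<And>r. r \<in> \<Omega> \<Longrightarrow> \<psi> r = 0"
  shows "pairing \<Omega> \<kappa> u U \<psi> = 0"
proof -
  have "(\<lambda>r. of_real (\<kappa> r) * \<psi> r) = (\<lambda>_. 0)"
    using assms(2,3) by fastforce
  moreover have "(LINT r:\<Omega>|lebesgue. of_real (U r * (1 - \<kappa> r)) * \<psi> r) = (LINT r:\<Omega>|lebesgue. (0::complex))"
    unfolding set_lebesgue_integral_def
    by (rule arg_cong[where f="integral\<^sup>L lebesgue"]) (auto simp: assms(3) indicator_def)
  ultimately show ?thesis
    by (simp add: pairing_def assms(1))
qed

text \<open>The pairings at the final time vanish because of the values of \<open>v\<close> and \<open>\<partial>\<^sub>t v\<close> there, and the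
space-time pairing because \<open>v\<close> solves the wave equation.\<close>

lemma recip_gap_eq_dipole_functional:
  assumes ws: "weak_solution \<Omega> D c T K p m u \<phi>" and "T > 0"
    and "smooth_on UNIV v" and wave: "\<And>x. wave_op c v x = 0"
    and final: "\<And>r. r \<in> \<Omega> \<Longrightarrow> v (T, r) = 0" "\<And>r. r \<in> \<Omega> \<Longrightarrow> D_t v (T, r) = 0"
  shows "recip_gap \<Omega> T \<phi> v = dipole_functional T K p m v"
proof -
  note ws = ws[unfolded weak_solution_def]
  have dist: "distribution \<Omega> (u t)" if "t \<in> {0..T}" for t
    using bspec[OF conjunct1[OF ws] that] .
  note ws = ws[THEN conjunct2, THEN conjunct2, THEN conjunct2, THEN conjunct2, THEN conjunct2]
  from ws obtain U V \<kappa> where cut: "cutoff \<Omega> D \<kappa>"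
    and ids: "\<forall>v. smooth_on UNIV v \<longrightarrow>
           of_real (1 / c\<^sup>2) * pairing \<Omega> \<kappa> (dist_time_deriv T u T) (V T) (\<lambda>r. v (T, r))
           - of_real (1 / c\<^sup>2) * pairing \<Omega> \<kappa> (u T) (U T) (\<lambda>r. D_t v (T, r))
           - lateral_integral \<Omega> T \<phi> v
           + integral {0..T} (\<lambda>t. pairing \<Omega> \<kappa> (u t) (U t) (\<lambda>r. wave_op c v (t, r)))
           = dipole_functional T K p m v"
    by (elim exE conjE) (rule that, assumption, assumption)
  note id = ids[rule_format, OF \<open>smooth_on UNIV v\<close>]
  have \<kappa>: "{r. \<kappa> r \<noteq> 0} \<subseteq> \<Omega>"
    using cut closure_subset[of "{r. \<kappa> r \<noteq> 0}"] unfolding cutoff_def by (elim conjE) (rule subset_trans)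
  have "pairing \<Omega> \<kappa> (dist_time_deriv T u T) (V T) (\<lambda>r. v (T, r)) = 0"
    using \<open>T > 0\<close> by (intro pairing_eq_0 \<kappa> final dist_time_deriv_zero[where A=\<Omega>] dist) auto
  moreover have "pairing \<Omega> \<kappa> (u T) (U T) (\<lambda>r. D_t v (T, r)) = 0"
    using \<open>T > 0\<close> by (intro pairing_eq_0 \<kappa> final distribution_zero[OF dist]) auto
  moreover have "integral {0..T} (\<lambda>t. pairing \<Omega> \<kappa> (u t) (U t) (\<lambda>r. wave_op c v (t, r))) =
      integral {0..T} (\<lambda>_. 0)"
    by (intro integral_cong pairing_eq_0 \<kappa> wave distribution_zero[OF dist])
  ultimately show ?thesis
    using id by (simp add: recip_gap_def)
qed

section \<open>Concentration of mollified integrals\<close>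

lemma DERIV_mollifier_deriv_shift:
  assumes "\<epsilon> > 0"
  shows "((\<lambda>s. mollifier_deriv \<epsilon> k (s - \<tau>)) has_real_derivative mollifier_deriv \<epsilon> (Suc k) (s - \<tau>)) (at s)"
proof -
  have "((\<lambda>s. s - \<tau>) has_real_derivative 1) (at s)"
    by (auto intro!: derivative_eq_intros)
  from DERIV_chain2[OF DERIV_mollifier_deriv[OF assms] this] show ?thesis by simp
qed

lemma continuous_on_mollifier_deriv_shift:
  assumes "\<epsilon> > 0"
  shows "continuous_on S (\<lambda>s. mollifier_deriv \<epsilon> k (s - \<tau>))"
  by (rule continuous_at_imp_continuous_on, rule ballI, rule DERIV_isCont,
      rule DERIV_mollifier_deriv_shift[OF assms])

text \<open>The mollifier has integral \<open>1\<close>, so the error is a weighted mean of \<open>A s - A \<tau>\<close> over a small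
interval.\<close>

lemma mollifier_tendsto:
  fixes A :: "real \<Rightarrow> complex"
  assumes "open J" "\<tau> \<in> J" "continuous_on J A"
  shows "((\<lambda>\<epsilon>. integral {\<tau> - \<epsilon>..\<tau> + \<epsilon>} (\<lambda>s. A s * of_real (mollifier \<epsilon> (s - \<tau>)))) \<longlongrightarrow> A \<tau>) (at_right 0)"
proof (rule tendstoI)
  fix e :: real assume "e > 0"
  then have "e / 2 > 0" by simp
  have "isCont A \<tau>"
    using assms by (simp add: continuous_on_eq_continuous_at)
  then obtain d1 where d1: "d1 > 0" "\<And>s. dist s \<tau> < d1 \<Longrightarrow> dist (A s) (A \<tau>) < e / 2"
    using \<open>e / 2 > 0\<close> unfolding continuous_at_eps_delta by (metis dist_norm)
  obtain d2 where d2: "d2 > 0" "cball \<tau> d2 \<subseteq> J"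
    using assms(1,2) open_contains_cball by blast
  show "\<forall>\<^sub>F \<epsilon> in at_right 0. dist (integral {\<tau> - \<epsilon>..\<tau> + \<epsilon>} (\<lambda>s. A s * of_real (mollifier \<epsilon> (s - \<tau>)))) (A \<tau>) < e"
    unfolding eventually_at_right_field
  proof (intro exI[of _ "min d1 d2"] conjI allI impI)
    fix \<epsilon> assume \<epsilon>: "0 < \<epsilon>" "\<epsilon> < min d1 d2"
    let ?I = "{\<tau> - \<epsilon>..\<tau> + \<epsilon>}" and ?\<eta> = "\<lambda>s. mollifier \<epsilon> (s - \<tau>)"
    have "?I \<subseteq> J"
      using \<epsilon> d2(2) by (fastforce simp: cball_def dist_real_def)
    then have contA: "continuous_on ?I A"
      using assms(3) continuous_on_subset by blast
    have cont\<eta>: "continuous_on ?I ?\<eta>"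
      using continuous_on_mollifier_deriv_shift[OF \<epsilon>(1), of _ 0] by (simp add: mollifier_deriv_0)
    note \<eta> = has_integral_mollifier[OF \<epsilon>(1), of \<tau>]
    have "((\<lambda>s. A \<tau> * of_real (?\<eta> s)) has_integral A \<tau> * of_real 1) ?I"
      by (intro has_integral_mult_right has_integral_of_real \<eta>)
    moreover have "((\<lambda>s. A s * of_real (?\<eta> s)) has_integral integral ?I (\<lambda>s. A s * of_real (?\<eta> s))) ?I"
      by (intro integrable_integral integrable_continuous_real continuous_intros contA cont\<eta>)
    ultimately have diff: "((\<lambda>s. A s * of_real (?\<eta> s) - A \<tau> * of_real (?\<eta> s)) has_integral
        integral ?I (\<lambda>s. A s * of_real (?\<eta> s)) - A \<tau>) ?I"
      using has_integral_diff[of "\<lambda>s. A s * of_real (?\<eta> s)" _ ?I "\<lambda>s. A \<tau> * of_real (?\<eta> s)" "A \<tau>"] by simp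
    have "norm (integral ?I (\<lambda>s. A s * of_real (?\<eta> s)) - A \<tau>) \<le> integral ?I (\<lambda>s. e / 2 * ?\<eta> s)"
      unfolding integral_unique[OF diff, symmetric]
    proof (rule integral_norm_bound_integral)
      show "(\<lambda>s. e / 2 * ?\<eta> s) integrable_on ?I"
        using has_integral_mult_right[OF \<eta>] by (rule has_integral_integrable)
      fix s assume "s \<in> ?I"
      then have "dist s \<tau> < d1"
        using \<epsilon> by (auto simp: dist_real_def)
      then have "norm (A s - A \<tau>) \<le> e / 2"
        using d1(2)[of s] by (simp add: dist_norm)
      then show "norm (A s * of_real (?\<eta> s) - A \<tau> * of_real (?\<eta> s)) \<le> e / 2 * ?\<eta> s"
        using mollifier_nonneg[OF \<epsilon>(1), of "s - \<tau>"]
        by (simp only: left_diff_distrib [symmetric] norm_mult norm_of_real abs_of_nonneg mult_right_mono)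
    qed (use diff in auto)
    also have "\<dots> = e / 2"
      using integral_unique[OF has_integral_mult_right[OF \<eta>, of "e / 2"]] by simp
    finally show "dist (integral ?I (\<lambda>s. A s * of_real (?\<eta> s))) (A \<tau>) < e"
      using \<open>e > 0\<close> by (simp add: dist_norm)
  qed (use d1 d2 in auto)
qed

text \<open>No boundary terms arise, as all derivatives of the mollifier vanish at \<open>\<plusminus>\<epsilon>\<close>.\<close>

lemma mollifier_deriv_by_parts:
  fixes A :: "real \<Rightarrow> complex"
  assumes "\<epsilon> > 0" "{\<tau> - \<epsilon>..\<tau> + \<epsilon>} \<subseteq> J" "C_on n J A"
  shows "((\<lambda>s. A s * of_real (mollifier_deriv \<epsilon> n (s - \<tau>))) has_integral
    (-1) ^ n * integral {\<tau> - \<epsilon>..\<tau> + \<epsilon>} (\<lambda>s. (dv ^^ n) A s * of_real (mollifier \<epsilon> (s - \<tau>)))) {\<tau> - \<epsilon>..\<tau> + \<epsilon>}"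
  using assms(3)
proof (induction n arbitrary: A)
  have dE: "((\<lambda>s. of_real (mollifier_deriv \<epsilon> k (s - \<tau>)) :: complex) has_vector_derivative
      of_real (mollifier_deriv \<epsilon> (Suc k) (s - \<tau>))) (at s)" for k s
    using DERIV_mollifier_deriv_shift[OF assms(1)]
    by (intro has_vector_derivative_of_real) (simp add: has_real_derivative_iff_has_vector_derivative)
  {
    case 0
    have "continuous_on {\<tau> - \<epsilon>..\<tau> + \<epsilon>} (\<lambda>s. A s * of_real (mollifier_deriv \<epsilon> 0 (s - \<tau>)))"
      using 0 assms(2)
      by (intro continuous_intros continuous_on_mollifier_deriv_shift assms(1)) (auto intro: continuous_on_subset)
    then show ?case
      by (simp add: mollifier_deriv_0 integrable_continuous_real integrable_integral)
  next
    case (Suc n)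
    let ?I = "{\<tau> - \<epsilon>..\<tau> + \<epsilon>}"
    let ?E = "\<lambda>k s. of_real (mollifier_deriv \<epsilon> k (s - \<tau>)) :: complex"
    define y where "y = (-1) ^ Suc n * integral ?I (\<lambda>s. (dv ^^ Suc n) A s * of_real (mollifier \<epsilon> (s - \<tau>)))"
    have "((\<lambda>s. ?E n s * dv A s) has_integral - y) ?I"
      using Suc.IH[OF C_on_dv[OF Suc.prems]]
      by (simp add: mult.commute y_def funpow_Suc_right o_def del: funpow.simps)
    moreover have "mollifier_deriv \<epsilon> n \<epsilon> = 0" "mollifier_deriv \<epsilon> n (-\<epsilon>) = 0"
      using assms(1) by (simp_all add: mollifier_deriv_eq_0)
    ultimately have "((\<lambda>s. ?E n s * dv A s) has_integral
        ?E n (\<tau> + \<epsilon>) * A (\<tau> + \<epsilon>) - ?E n (\<tau> - \<epsilon>) * A (\<tau> - \<epsilon>) - y) ?I"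
      by simp
    then have "((\<lambda>s. ?E (Suc n) s * A s) has_integral y) ?I"
      using assms(1,2) Suc.prems dE[of n]
      by (intro integration_by_parts[OF bounded_bilinear_mult, where f="?E n" and g=A and g'="dv A"]
          C_on_has_vector_derivative continuous_on_subset[OF C_on_imp_continuous_on[OF Suc.prems]]
          continuous_on_of_real continuous_on_mollifier_deriv_shift)
         auto
    then show ?case
      by (simp only: y_def mult.commute)
  }
qed

section \<open>Arrival time of a moving point\<close>

text \<open>The value of \<open>t + z/c\<close> along the path: the parameter of the front that the source meets at time \<open>t\<close>.\<close>

definition phase :: "real \<Rightarrow> (real \<Rightarrow> real^3) \<Rightarrow> real \<Rightarrow> real" where
  "phase c q t = t + q t $ 3 / c"

text \<open>A source path slower than the waves. Its phase \<open>\<theta>\<close> has derivative at least \<open>1 - \<bar>q'\<bar>/c > 0\<close> and is a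
bijection from \<open>{0..T}\<close> to \<open>{\<theta> 0..\<theta> T}\<close>. The arrival time \<open>arr\<close> is its inverse.\<close>

locale moving_point =
  fixes c T :: real and q :: "real \<Rightarrow> real^3"
  assumes c_pos: "c > 0" and T_pos: "T > 0"
    and C6: "C_time 6 T q"
    and subsonic: "\<And>t. t \<in> {0..T} \<Longrightarrow> norm (time_deriv T q t) < c"
begin

abbreviation \<theta> :: "real \<Rightarrow> real" where "\<theta> \<equiv> phase c q"
definition \<theta>' :: "real \<Rightarrow> real" where "\<theta>' t = 1 + time_deriv T q t $ 3 / c"
abbreviation arr :: "real \<Rightarrow> real" where "arr \<equiv> arrival_time c T q"
abbreviation J where "J \<equiv> {\<theta> 0<..<\<theta> T}"

lemma q_differentiable: "t \<in> {0..T} \<Longrightarrow> q differentiable (at t within {0..T})"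
  using C6 C_time_Suc[of 5 T q] by simp

lemma q_C_on: "C_on 6 {0<..<T} q"
  using C6 by (rule C_time_imp_C_on)

lemma continuous_on_\<theta>: "continuous_on {0..T} \<theta>"
proof -
  have "continuous_on {0..T} q"
    by (simp add: continuous_on_eq_continuous_within differentiable_imp_continuous_within q_differentiable)
  then show ?thesis
    using c_pos unfolding phase_def by (intro continuous_intros) auto
qed

lemma DERIV_\<theta>:
  assumes "t \<in> {0<..<T}"
  shows "(\<theta> has_real_derivative \<theta>' t) (at t)"
proof -
  have "(q has_vector_derivative time_deriv T q t) (at t)"
    using assms by (intro has_vector_derivative_time_deriv q_differentiable) auto
  then have "((\<lambda>t. q t $ 3) has_vector_derivative time_deriv T q t $ 3) (at t)"
    by (rule bounded_linear.has_vector_derivative[OF bounded_linear_vec_nth])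
  then show ?thesis
    using c_pos unfolding phase_def[abs_def] \<theta>'_def
    by (auto intro!: derivative_eq_intros simp flip: has_real_derivative_iff_has_vector_derivative)
qed

lemma \<theta>'_pos:
  assumes "t \<in> {0<..<T}"
  shows "\<theta>' t > 0"
proof -
  have "\<bar>time_deriv T q t $ 3\<bar> < c"
    using component_le_norm_cart[of "time_deriv T q t" 3] subsonic[of t] assms by auto
  then show ?thesis
    using c_pos by (auto simp: \<theta>'_def field_simps)
qed

lemma \<theta>_less:
  assumes "0 \<le> s" "s < t" "t \<le> T"
  shows "\<theta> s < \<theta> t"
proof (rule DERIV_pos_imp_increasing_open[OF assms(2)])
  show "continuous_on {s..t} \<theta>"
    using assms by (intro continuous_on_subset[OF continuous_on_\<theta>]) auto
  show "\<exists>y. (\<theta> has_real_derivative y) (at x) \<and> 0 < y" if "s < x" "x < t" for x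
    using DERIV_\<theta>[of x] \<theta>'_pos[of x] that assms by auto
qed

lemma \<theta>_eq_iff: "s \<in> {0..T} \<Longrightarrow> t \<in> {0..T} \<Longrightarrow> \<theta> s = \<theta> t \<longleftrightarrow> s = t"
  using \<theta>_less[of s t] \<theta>_less[of t s] by (cases s t rule: linorder_cases) auto

lemma arr_\<theta>:
  assumes "t \<in> {0..T}"
  shows "arr (\<theta> t) = t"
  unfolding arrival_time_def
proof (rule the_equality)
  fix s assume s: "s \<in> {0..T} \<and> s - \<theta> t + q s $ 3 / c = 0"
  then have "\<theta> s = \<theta> t" by (simp add: phase_def)
  then show "s = t" using s assms \<theta>_eq_iff by blast
qed (use assms in \<open>simp add: phase_def\<close>)

lemma arr:
  assumes "s \<in> J"
  shows "arr s \<in> {0<..<T}" and "\<theta> (arr s) = s"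
proof -
  obtain t where t: "0 \<le> t" "t \<le> T" "\<theta> t = s"
    using IVT'[of \<theta> 0 s T] assms continuous_on_\<theta> T_pos by auto
  moreover from this assms have "t \<noteq> 0" "t \<noteq> T" by auto
  ultimately show "arr s \<in> {0<..<T}" "\<theta> (arr s) = s"
    using arr_\<theta>[of t] by auto
qed

lemma \<theta>_J: "t \<in> {0<..<T} \<Longrightarrow> \<theta> t \<in> J"
  using \<theta>_less[of 0 t] \<theta>_less[of t T] by auto

lemma DERIV_arr:
  assumes "s \<in> J"
  shows "(arr has_real_derivative inverse (\<theta>' (arr s))) (at s)"
proof (rule DERIV_inverse_function[where f=\<theta> and a="\<theta> 0" and b="\<theta> T"])
  show "(\<theta> has_real_derivative \<theta>' (arr s)) (at (arr s))"
    using arr(1)[OF assms] by (rule DERIV_\<theta>)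
  show "\<theta>' (arr s) \<noteq> 0"
    using \<theta>'_pos[OF arr(1)[OF assms]] by simp
  show "\<theta> (arr y) = y" if "\<theta> 0 < y" "y < \<theta> T" for y
    using that by (intro arr(2)) auto
  have "isCont arr (\<theta> (arr s))"
  proof (rule isCont_inverse_function2[where f=\<theta> and x="arr s" and a="arr s / 2" and b="(arr s + T) / 2"])
    show "arr s / 2 < arr s" "arr s < (arr s + T) / 2"
      using arr(1)[OF assms] by auto
  next
    fix t assume "arr s / 2 \<le> t" "t \<le> (arr s + T) / 2"
    then have "t \<in> {0<..<T}"
      using arr(1)[OF assms] by auto
    then show "arr (\<theta> t) = t" "isCont \<theta> t"
      using arr_\<theta>[of t] DERIV_isCont[OF DERIV_\<theta>] by auto
  qed
  then show "isCont arr s"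
    by (simp add: arr(2)[OF assms])
qed (use assms in auto)

lemma dv_arr: "s \<in> J \<Longrightarrow> dv arr s = inverse (\<theta>' (arr s))"
  using DERIV_arr by (simp add: has_real_derivative_iff_has_vector_derivative vector_derivative_at)

lemma dv_arr_pos: "s \<in> J \<Longrightarrow> dv arr s > 0"
  using \<theta>'_pos arr by (simp add: dv_arr)

lemma \<theta>'_C_on: "C_on 5 {0<..<T} \<theta>'"
proof -
  have "C_on 5 {0<..<T} (time_deriv T q)"
    using C6 C_time_Suc[of 5 T q] by (intro C_time_imp_C_on) simp
  then have "C_on 5 {0<..<T} (\<lambda>t. time_deriv T q t $ 3 / c)"
    by (intro C_on_bounded_linear[where L="\<lambda>v. v $ 3 / c"])
       (auto intro: bounded_linear_compose[OF bounded_linear_divide bounded_linear_vec_nth])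
  then show ?thesis
    unfolding \<theta>'_def[abs_def] by (intro C_on_add C_on_const) auto
qed

text \<open>Bootstrapping: \<open>arr' = 1 / \<theta>'(arr)\<close> is as smooth as \<open>arr\<close> itself, up to the smoothness of \<open>\<theta>'\<close>.\<close>

lemma arr_C_on: "C_on 6 J arr"
proof -
  have "C_on n J arr" if "n \<le> 6" for n
    using that
  proof (induction n)
    case 0
    show ?case
      using DERIV_isCont[OF DERIV_arr] by (auto intro: continuous_at_imp_continuous_on)
  next
    case (Suc n)
    have "C_on n J (\<lambda>s. \<theta>' (arr s))"
      using Suc arr(1) by (intro C_on_compose[OF _ _ C_on_mono[OF \<theta>'_C_on]]) auto
    then have "C_on n J (\<lambda>s. inverse (\<theta>' (arr s)))"
      using \<theta>'_pos[OF arr(1)] by (intro C_on_inverse) fastforce+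
    then show ?case
      using DERIV_arr by (intro C_onI) (auto simp: has_real_derivative_iff_has_vector_derivative)
  qed
  then show ?thesis by simp
qed

text \<open>The substitution \<open>s = \<theta> t\<close> on the short time interval in which the source is inside the front; outside
of it the integrand vanishes.\<close>

lemma has_integral_change_to_arrival:
  fixes a :: "real \<Rightarrow> complex"
  assumes "\<epsilon> > 0" "{\<sigma> - \<epsilon>..\<sigma> + \<epsilon>} \<subseteq> J" "continuous_on {0..T} a"
    and "continuous_on UNIV g" and g0: "\<And>s. \<bar>s\<bar> \<ge> \<epsilon> \<Longrightarrow> g s = 0"
  shows "((\<lambda>t. a t * of_real (g (\<theta> t - \<sigma>))) has_integral
    integral {\<sigma> - \<epsilon>..\<sigma> + \<epsilon>} (\<lambda>s. (of_real (dv arr s) * a (arr s)) * of_real (g (s - \<sigma>)))) {0..T}"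
proof -
  define t1 t2 where "t1 = arr (\<sigma> - \<epsilon>)" and "t2 = arr (\<sigma> + \<epsilon>)"
  have "\<sigma> - \<epsilon> \<in> J" "\<sigma> + \<epsilon> \<in> J"
    using assms(1) by (auto intro!: subsetD[OF assms(2)] simp del: greaterThanLessThan_iff)
  note t12 = arr[OF this(1), folded t1_def] arr[OF this(2), folded t2_def]
  have "t1 < t2"
    using \<theta>_less[of t2 t1] t12 assms(1) by (cases t1 t2 rule: linorder_cases) auto
  have \<theta>_in: "\<theta> t \<in> {\<sigma> - \<epsilon>..\<sigma> + \<epsilon>} \<longleftrightarrow> t \<in> {t1..t2}" if "t \<in> {0..T}" for t
    using \<theta>_less[of t t1] \<theta>_less[of t1 t] \<theta>_less[of t t2] \<theta>_less[of t2 t] t12 that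
    by (cases t t1 rule: linorder_cases; cases t t2 rule: linorder_cases) auto
  let ?f = "\<lambda>s. (of_real (dv arr s) * a (arr s)) * of_real (g (s - \<sigma>)) :: complex"
  have "continuous_on J (dv arr)"
    using C_on_imp_continuous_on[of 5 J "dv arr"] arr_C_on C_on_dv[of 5 J arr] by simp
  moreover have "continuous_on J (\<lambda>s. a (arr s))"
    using arr(1) by (intro continuous_on_compose2[OF assms(3) C_on_imp_continuous_on[OF arr_C_on]]) force
  ultimately have "continuous_on J ?f"
    by (intro continuous_intros continuous_on_compose2[OF assms(4)]) auto
  then have contf: "continuous_on {\<sigma> - \<epsilon>..\<sigma> + \<epsilon>} ?f"
    using assms(2) by (rule continuous_on_subset)
  have int: "((\<lambda>t. \<theta>' t *\<^sub>R ?f (\<theta> t)) has_integral integral {\<theta> t1..\<theta> t2} ?f) {t1..t2}"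
  proof (rule has_integral_substitution[OF _ _ _ contf])
    show "\<theta> ` {t1..t2} \<subseteq> {\<sigma> - \<epsilon>..\<sigma> + \<epsilon>}"
      using \<theta>_in t12 by fastforce
    show "(\<theta> has_real_derivative \<theta>' t) (at t within {t1..t2})" if "t \<in> {t1..t2}" for t
      using that t12 by (intro DERIV_subset[OF DERIV_\<theta>]) auto
  qed (use \<open>t1 < t2\<close> t12 assms(1) in auto)
  have eq: "\<theta>' t *\<^sub>R ?f (\<theta> t) = a t * of_real (g (\<theta> t - \<sigma>))" if "t \<in> {t1..t2}" for t
  proof -
    have t: "t \<in> {0<..<T}"
      using that t12 by auto
    then have "dv arr (\<theta> t) = inverse (\<theta>' t)" "arr (\<theta> t) = t"
      using dv_arr[OF \<theta>_J[OF t]] arr_\<theta>[of t] by auto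
    then show ?thesis
      using \<theta>'_pos[OF t] by (simp add: scaleR_conv_of_real)
  qed
  have "((\<lambda>t. a t * of_real (g (\<theta> t - \<sigma>))) has_integral integral {\<sigma> - \<epsilon>..\<sigma> + \<epsilon>} ?f) {t1..t2}"
    using has_integral_eq[OF eq int] t12(2,4) by simp
  then have "((\<lambda>t. if t \<in> {t1..t2} then a t * of_real (g (\<theta> t - \<sigma>)) else 0) has_integral
      integral {\<sigma> - \<epsilon>..\<sigma> + \<epsilon>} ?f) {0..T}"
    using t12 by (subst has_integral_restrict) auto
  then show ?thesis
  proof (rule has_integral_eq[rotated])
    fix t assume t: "t \<in> {0..T}"
    have "g (\<theta> t - \<sigma>) = 0" if "t \<notin> {t1..t2}"
      using \<theta>_in[OF t] that by (intro g0) auto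
    then show "(if t \<in> {t1..t2} then a t * of_real (g (\<theta> t - \<sigma>)) else 0) = a t * of_real (g (\<theta> t - \<sigma>))"
      by auto
  qed
qed

lemma source_integral_tendsto:
  fixes a :: "real \<Rightarrow> complex"
  assumes "\<sigma> \<in> J" "continuous_on {0..T} a" and C: "C_on n J (\<lambda>s. of_real (dv arr s) * a (arr s))"
  shows "((\<lambda>\<epsilon>. integral {0..T} (\<lambda>t. a t * of_real (mollifier_deriv \<epsilon> n (\<theta> t - \<sigma>))))
    \<longlongrightarrow> (-1) ^ n * (dv ^^ n) (\<lambda>s. of_real (dv arr s) * a (arr s)) \<sigma>) (at_right 0)"
proof -
  let ?A = "\<lambda>s. of_real (dv arr s) * a (arr s)"
  obtain d where d: "d > 0" "cball \<sigma> d \<subseteq> J"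
    using assms(1) open_contains_cball[THEN iffD1, OF open_greaterThanLessThan] by blast
  have "continuous_on J ((dv ^^ n) ?A)"
    using C_on_funpow_dv[of 0 n] C by simp
  then have "((\<lambda>\<epsilon>. (-1) ^ n * integral {\<sigma> - \<epsilon>..\<sigma> + \<epsilon>} (\<lambda>s. (dv ^^ n) ?A s * of_real (mollifier \<epsilon> (s - \<sigma>))))
      \<longlongrightarrow> (-1) ^ n * (dv ^^ n) ?A \<sigma>) (at_right 0)"
    by (intro tendsto_mult_left mollifier_tendsto[OF _ assms(1)]) auto
  moreover have "\<forall>\<^sub>F \<epsilon> in at_right 0. (-1) ^ n * integral {\<sigma> - \<epsilon>..\<sigma> + \<epsilon>} (\<lambda>s. (dv ^^ n) ?A s * of_real (mollifier \<epsilon> (s - \<sigma>)))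
      = integral {0..T} (\<lambda>t. a t * of_real (mollifier_deriv \<epsilon> n (\<theta> t - \<sigma>)))"
    unfolding eventually_at_right_field
  proof (intro exI[of _ d] conjI allI impI)
    fix \<epsilon> assume \<epsilon>: "0 < \<epsilon>" "\<epsilon> < d"
    then have sub: "{\<sigma> - \<epsilon>..\<sigma> + \<epsilon>} \<subseteq> J"
      by (intro subset_trans[OF _ d(2)]) (auto simp: cball_def dist_real_def)
    have "continuous_on UNIV (mollifier_deriv \<epsilon> n)"
      using continuous_on_mollifier_deriv_shift[OF \<epsilon>(1), of UNIV n 0] by simp
    from integral_unique[OF has_integral_change_to_arrival[OF \<epsilon>(1) sub assms(2) this mollifier_deriv_eq_0[OF \<epsilon>(1)]]]
      integral_unique[OF mollifier_deriv_by_parts[OF \<epsilon>(1) sub C]]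
    show "(-1) ^ n * integral {\<sigma> - \<epsilon>..\<sigma> + \<epsilon>} (\<lambda>s. (dv ^^ n) ?A s * of_real (mollifier \<epsilon> (s - \<sigma>)))
      = integral {0..T} (\<lambda>t. a t * of_real (mollifier_deriv \<epsilon> n (\<theta> t - \<sigma>)))"
      by simp
  qed (use d in auto)
  ultimately show ?thesis
    by (rule Lim_transform_eventually)
qed

end

section \<open>The five test families\<close>

lemma f_test_eq_packet:
  "f_test c n \<epsilon> \<tau> = packet c \<tau> (mollifier_deriv \<epsilon>) n 0 0 0"
  by (auto simp: f_test_def packet_def mollifier_deriv_0)

context
  fixes c \<tau> \<epsilon> :: real
  assumes c_nz: "c \<noteq> 0" and \<epsilon>_pos: "\<epsilon> > 0"
begin

interpretation wave_profile c \<tau> "mollifier_deriv \<epsilon>"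
  using DERIV_mollifier_deriv[OF \<epsilon>_pos] c_nz by unfold_locales

lemma g_test_eq_packet: "g_test c n \<epsilon> \<tau> = (\<lambda>x. - pk n 0 0 1 x)"
  by (simp add: g_test_def f_test_eq_packet D_t_packet)

lemma i_test_eq_packet: "i_test c n \<epsilon> \<tau> = pk n 0 0 2"
  by (simp add: i_test_def f_test_eq_packet D_t_packet numeral_2_eq_2)

text \<open>The operator \<open>\<partial>\<^sub>x - i \<partial>\<^sub>y = 2 \<partial>\<^sub>w\<close> gives the first packet, and \<open>\<partial>\<^sub>z\<close>, which only sees the profile,
the second.\<close>

lemma h_test_eq_packet:
  "h_test c n \<epsilon> \<tau> = (\<lambda>x. (2 * of_nat n) * pk (n - 1) 0 1 0 x + (- inverse (of_real c)) * pk n 1 0 1 x)"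
proof
  fix x
  have "pk (n - 1) 0 1 0 x = of_real (snd x $ 3) * pk (n - 1) 0 0 0 x"
    "pk n 1 0 1 x = cnj (cxy (snd x)) * pk n 0 0 1 x"
    by (simp_all add: packet_def case_prod_beta)
  then show "h_test c n \<epsilon> \<tau> x = (2 * of_nat n) * pk (n - 1) 0 1 0 x + (- inverse (of_real c)) * pk n 1 0 1 x"
    by (simp add: h_test_def f_test_eq_packet D_sp_packet algebra_simps)
qed

lemma j_test_eq_packet:
  "j_test c n \<epsilon> \<tau> = (\<lambda>x. (- (2 * of_nat n)) * pk (n - 1) 0 1 1 x + inverse (of_real c) * pk n 1 0 2 x)"
  by (simp only: j_test_def h_test_eq_packet pd_packet_combination D_t_packet)
    (simp add: numeral_2_eq_2)

lemma wave_op_fgi: "wave_op c (pk n 0 0 e) x = 0"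
  by (simp add: wave_op_packet)

text \<open>Each of the two packets of \<open>h\<^sub>n\<close> leaves a multiple of \<open>w^(n-1) E'\<close>, and the coefficients are chosen so
that they cancel. The factor \<open>\<alpha>\<close> and the order \<open>e\<close> make the lemma cover \<open>j\<^sub>n\<close> too.\<close>

lemma wave_op_hj:
  "wave_op c (\<lambda>x. (2 * of_nat n * \<alpha>) * pk (n - 1) 0 1 e x + (- inverse (of_real c) * \<alpha>) * pk n 1 0 (Suc e) x) x = 0"
  by (simp only: wave_op_packet_combination wave_op_packet) simp

end

section \<open>Functionals of a source configuration\<close>

text \<open>The derivative of \<open>w^a (cnj w)^b z^d\<close> at \<open>r\<close> in the horizontal direction \<open>v\<close>.\<close>

definition amplitude :: "nat \<Rightarrow> nat \<Rightarrow> nat \<Rightarrow> real^3 \<Rightarrow> real^3 \<Rightarrow> complex" where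
  "amplitude a b d r v = of_real (r $ 3) ^ d *
     (of_nat a * cxy r ^ (a - 1) * cnj (cxy r) ^ b * cxy v + of_nat b * cxy r ^ a * cnj (cxy r) ^ (b - 1) * cnj (cxy v))"

lemma (in wave_profile) dipole_packet:
  assumes "v $ 3 = 0"
  shows "(\<Sum>i\<in>UNIV. of_real (v $ i) * D_sp i (\<lambda>x. \<alpha> * pk a b d e x + \<beta> * pk a' b' d' e' x) (t, r)) =
    \<alpha> * (amplitude a b d r v * of_real (E e (t + r $ 3 / c - \<tau>))) +
    \<beta> * (amplitude a' b' d' r v * of_real (E e' (t + r $ 3 / c - \<tau>)))"
proof -
  have v: "cxy v = of_real (v $ 1) + \<i> * of_real (v $ 2)" "cnj (cxy v) = of_real (v $ 1) - \<i> * of_real (v $ 2)"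
    by (auto simp: cxy_def complex_eq_iff)
  have single: "of_real (v $ 1) * D_sp 1 (pk a b d e) (t, r) + of_real (v $ 2) * D_sp 2 (pk a b d e) (t, r) =
      amplitude a b d r v * of_real (E e (t + r $ 3 / c - \<tau>))" for a b d e
    unfolding D_sp_packet unfolding packet_def amplitude_def v by (simp add: algebra_simps)
  show ?thesis
    unfolding pd_packet_combination sum_3 assms single[symmetric] by (simp add: algebra_simps)
qed

lemma C_time_imp_continuous_on:
  assumes "C_time n T f" "n > 0"
  shows "continuous_on {0..T} f"
  using assms
  by (cases n) (auto simp: C_time_Suc continuous_on_eq_continuous_within differentiable_imp_continuous_within)

lemma continuous_on_amplitude:
  "continuous_on S f \<Longrightarrow> continuous_on S g \<Longrightarrow> continuous_on S (\<lambda>t. amplitude a b d (f t) (g t))"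
  unfolding amplitude_def
  by (intro continuous_intros bounded_linear.continuous_on[OF bounded_linear_cxy])

lemma C_on_cxy: "open J \<Longrightarrow> C_on n J f \<Longrightarrow> C_on n J (\<lambda>s. cxy (f s))"
  by (rule C_on_bounded_linear[OF _ bounded_linear_cxy])

lemma C_on_cnj: "open J \<Longrightarrow> C_on n J f \<Longrightarrow> C_on n J (\<lambda>s. cnj (f s))"
  by (rule C_on_bounded_linear[OF _ bounded_linear_cnj])

lemma C_on_of_real: "open J \<Longrightarrow> C_on n J f \<Longrightarrow> C_on n J (\<lambda>s. complex_of_real (f s))"
  by (rule C_on_bounded_linear[OF _ bounded_linear_of_real])

lemma C_on_nth: "open J \<Longrightarrow> C_on n J f \<Longrightarrow> C_on n J (\<lambda>s. (f s :: real^3) $ i)"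
  by (rule C_on_bounded_linear[OF _ bounded_linear_vec_nth])

lemma C_on_amplitude:
  assumes "open J" "C_on n J f" "C_on n J g"
  shows "C_on n J (\<lambda>s. amplitude a b d (f s) (g s))"
  unfolding amplitude_def
  by (intro C_on_add C_on_mult C_on_power C_on_const C_on_cxy C_on_cnj C_on_of_real C_on_nth assms)

text \<open>What a packet detects of one source: the amplitude at the arrival time, with the Jacobian of
the substitution.\<close>

definition source_moment ::
    "real \<Rightarrow> real \<Rightarrow> (real \<Rightarrow> real^3) \<Rightarrow> (real \<Rightarrow> real^3) \<Rightarrow> nat \<Rightarrow> nat \<Rightarrow> nat \<Rightarrow> real \<Rightarrow> complex" where
  "source_moment c T q \<mu> a b d s = of_real (dv (arrival_time c T q) s) *
     amplitude a b d (q (arrival_time c T q s)) (\<mu> (arrival_time c T q s))"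

context moving_point begin

lemma C_on_dv_arr: "C_on 5 J (dv arr)"
  using arr_C_on C_on_dv[of 5 J arr] by simp

lemma C_on_compose_arr:
  assumes "C_on 6 {0<..<T} f"
  shows "C_on 5 J (\<lambda>s. f (arr s))"
proof (rule C_on_compose[of "{0<..<T}"])
  show "C_on 5 {0<..<T} f" "C_on 5 J arr"
    using C_on_mono[OF assms] C_on_mono[OF arr_C_on] by simp_all
qed (use arr(1) in auto)

lemma C_on_source_moment:
  assumes "C_time 6 T \<mu>"
  shows "C_on 5 J (source_moment c T q \<mu> a b d)"
proof -
  show ?thesis
    unfolding source_moment_def[abs_def]
    using C_on_compose_arr[OF q_C_on] C_on_compose_arr[OF C_time_imp_C_on[OF assms]]
    by (intro C_on_mult C_on_of_real C_on_amplitude C_on_dv_arr) auto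
qed

end

text \<open>The part of the hypotheses on one configuration that involves neither the wave field nor the parameter
\<open>\<tau>\<close>.\<close>

locale dipole_config =
  fixes \<Omega> D :: "(real^3) set" and c T :: real and K :: nat and p m :: "nat \<Rightarrow> real \<Rightarrow> real^3"
  assumes \<Omega>: "open \<Omega>" "bounded \<Omega>" "D \<subseteq> \<Omega>"
    and c_pos: "c > 0" and T_pos: "T > 0"
    and sources: "dipole_sources D c T K p m"
    and horizontal: "\<And>k t. k < K \<Longrightarrow> t \<in> {0..T} \<Longrightarrow> m k t $ 3 = 0"
begin

lemma source: "k < K \<Longrightarrow> moving_point c T (p k)"
  using sources c_pos T_pos by unfold_locales (auto simp: dipole_sources_def)

lemma C_time_moment: "k < K \<Longrightarrow> C_time 6 T (m k)"
  using sources by (simp add: dipole_sources_def)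

text \<open>The parameters at which all sources meet the front strictly between the times \<open>0\<close> and \<open>T\<close>.\<close>

definition arrival_window :: "real set" where "arrival_window = (\<Inter>k<K. {phase c (p k) 0<..<phase c (p k) T})"

lemma open_arrival_window: "open arrival_window"
  by (auto simp: arrival_window_def)

text \<open>The bounds are strict because \<open>\<Omega>\<close> is open. This is what keeps the end points of \<open>I0\<close> inside the
open arrival window, so that the extension by continuity to them is no special case.\<close>

lemma bounds_z: "r \<in> \<Omega> \<Longrightarrow> r $ 3 / c < (SUP r\<in>\<Omega>. r $ 3 / c)" "r \<in> \<Omega> \<Longrightarrow> (INF r\<in>\<Omega>. r $ 3 / c) < r $ 3 / c"
proof -
  assume r: "r \<in> \<Omega>"
  have "bounded ((\<lambda>r. r $ 3 / c) ` \<Omega>)"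
    using \<Omega>(2) by (intro bounded_linear_image bounded_linear_compose[OF bounded_linear_divide bounded_linear_vec_nth])
  then have bdd: "bdd_above ((\<lambda>r. r $ 3 / c) ` \<Omega>)" "bdd_below ((\<lambda>r. r $ 3 / c) ` \<Omega>)"
    by (auto intro: bounded_imp_bdd_above bounded_imp_bdd_below)
  obtain e where e: "e > 0" "cball r e \<subseteq> \<Omega>"
    using \<Omega>(1) r open_contains_cball by blast
  have "r + e *\<^sub>R axis 3 1 \<in> \<Omega>" "r - e *\<^sub>R axis 3 1 \<in> \<Omega>"
    using e by (auto intro!: subsetD[OF e(2)] simp: dist_norm norm_axis_1)
  from cSUP_upper[OF this(1) bdd(1)] cINF_lower[OF bdd(2) this(2)]
  have "r $ 3 / c + e / c \<le> (SUP r\<in>\<Omega>. r $ 3 / c)" "(INF r\<in>\<Omega>. r $ 3 / c) \<le> r $ 3 / c - e / c"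
    by (simp_all add: axis_def add_divide_distrib diff_divide_distrib)
  moreover have "e / c > 0"
    using e c_pos by simp
  ultimately show "r $ 3 / c < (SUP r\<in>\<Omega>. r $ 3 / c)" "(INF r\<in>\<Omega>. r $ 3 / c) < r $ 3 / c"
    by linarith+
qed

lemma I0_subset_arrival_window: "I0 \<Omega> c T \<subseteq> arrival_window"
proof -
  have "p k 0 \<in> \<Omega>" "p k T \<in> \<Omega>" if "k < K" for k
    using sources that \<Omega>(3) T_pos by (auto simp: dipole_sources_def)
  from bounds_z(1)[OF this(1)] bounds_z(2)[OF this(2)] show ?thesis
    by (fastforce simp: arrival_window_def I0_def phase_def)
qed

definition moment_sum :: "nat \<Rightarrow> nat \<Rightarrow> nat \<Rightarrow> nat \<Rightarrow> real \<Rightarrow> complex" where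
  "moment_sum e a b d s = (\<Sum>k<K. (dv ^^ e) (source_moment c T (p k) (m k) a b d) s)"

lemma continuous_on_moment_sum:
  assumes "e \<le> 2"
  shows "continuous_on arrival_window (moment_sum e a b d)"
proof -
  have "continuous_on arrival_window ((dv ^^ e) (source_moment c T (p k) (m k) a b d))" if "k < K" for k
  proof -
    interpret moving_point c T "p k" by (rule source[OF that])
    have "C_on e {phase c (p k) 0<..<phase c (p k) T} (source_moment c T (p k) (m k) a b d)"
      using C_on_mono[OF C_on_source_moment[OF C_time_moment[OF that]], of e] assms by simp
    then have "continuous_on {phase c (p k) 0<..<phase c (p k) T} ((dv ^^ e) (source_moment c T (p k) (m k) a b d))"
      using C_on_funpow_dv[of 0 e] by simp
    then show ?thesis
      by (rule continuous_on_subset) (use that in \<open>auto simp: arrival_window_def\<close>)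
  qed
  then show ?thesis
    unfolding moment_sum_def[abs_def] by (intro continuous_on_sum) auto
qed

lemma dipole_functional_tendsto:
  assumes "\<sigma> \<in> arrival_window" "e \<le> 2" "e' \<le> 2"
  shows "((\<lambda>\<epsilon>. dipole_functional T K p m (\<lambda>x. \<alpha> * packet c \<sigma> (mollifier_deriv \<epsilon>) a b d e x +
        \<beta> * packet c \<sigma> (mollifier_deriv \<epsilon>) a' b' d' e' x))
    \<longlongrightarrow> \<alpha> * ((-1) ^ e * moment_sum e a b d \<sigma>) + \<beta> * ((-1) ^ e' * moment_sum e' a' b' d' \<sigma>)) (at_right 0)"
proof -
  define I where "I \<epsilon> k a b d e = integral {0..T} (\<lambda>t. amplitude a b d (p k t) (m k t) *
      of_real (mollifier_deriv \<epsilon> e (phase c (p k) t - \<sigma>)))" for \<epsilon> k a b d e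
  have lim: "((\<lambda>\<epsilon>. I \<epsilon> k a b d e) \<longlongrightarrow> (-1) ^ e * (dv ^^ e) (source_moment c T (p k) (m k) a b d) \<sigma>) (at_right 0)"
    if "k < K" "e \<le> 2" for k a b d e
  proof -
    interpret moving_point c T "p k" by (rule source[OF that(1)])
    have J: "\<sigma> \<in> {phase c (p k) 0<..<phase c (p k) T}"
      using assms(1) that(1) by (auto simp: arrival_window_def)
    have "C_time 6 T (p k)" "C_time 6 T (m k)"
      using sources that by (auto simp: dipole_sources_def)
    then have "continuous_on {0..T} (\<lambda>t. amplitude a b d (p k t) (m k t))"
      by (intro continuous_on_amplitude C_time_imp_continuous_on[where n=6]) auto
    from source_integral_tendsto[OF J this, of e]
      C_on_mono[OF C_on_source_moment[OF C_time_moment[OF that(1)]], of e a b d] that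
    show ?thesis
      by (simp add: I_def source_moment_def[abs_def])
  qed
  have split: "dipole_functional T K p m (\<lambda>x. \<alpha> * packet c \<sigma> (mollifier_deriv \<epsilon>) a b d e x +
        \<beta> * packet c \<sigma> (mollifier_deriv \<epsilon>) a' b' d' e' x) = (\<Sum>k<K. \<alpha> * I \<epsilon> k a b d e + \<beta> * I \<epsilon> k a' b' d' e')"
    if "\<epsilon> > 0" for \<epsilon>
  proof -
    interpret wave_profile c \<sigma> "mollifier_deriv \<epsilon>"
      using DERIV_mollifier_deriv[OF that] c_pos by unfold_locales auto
    have int: "(\<lambda>t. amplitude a b d (p k t) (m k t) * of_real (mollifier_deriv \<epsilon> e (phase c (p k) t - \<sigma>))) integrable_on {0..T}"
      if "k < K" for k a b d e
    proof -
      have "C_time 6 T (p k)" "C_time 6 T (m k)"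
        using sources that by (auto simp: dipole_sources_def)
      then have "continuous_on {0..T} (p k)" "continuous_on {0..T} (m k)"
        by (simp_all add: C_time_imp_continuous_on[where n=6])
      note amp = continuous_on_amplitude[OF this]
      have "continuous_on {0..T} (\<lambda>t. phase c (p k) t - \<sigma>)"
        by (intro continuous_intros moving_point.continuous_on_\<theta>[OF source[OF that]])
      moreover have "continuous_on UNIV (mollifier_deriv \<epsilon> e)"
        using continuous_on_mollifier_deriv_shift[OF \<open>\<epsilon> > 0\<close>, of UNIV e 0] by simp
      ultimately have "continuous_on {0..T} (\<lambda>t. mollifier_deriv \<epsilon> e (phase c (p k) t - \<sigma>))"
        using continuous_on_compose2 by blast
      then show ?thesis
        by (intro integrable_continuous_real continuous_on_mult amp continuous_on_of_real)
    qed
    have "integral {0..T} (\<lambda>t. \<Sum>i\<in>UNIV. of_real (m k t $ i) * D_sp i (\<lambda>x. \<alpha> * pk a b d e x + \<beta> * pk a' b' d' e' x) (t, p k t)) =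
        \<alpha> * I \<epsilon> k a b d e + \<beta> * I \<epsilon> k a' b' d' e'" if "k < K" for k
    proof -
      have "integral {0..T} (\<lambda>t. \<Sum>i\<in>UNIV. of_real (m k t $ i) * D_sp i (\<lambda>x. \<alpha> * pk a b d e x + \<beta> * pk a' b' d' e' x) (t, p k t)) =
        integral {0..T} (\<lambda>t. \<alpha> * (amplitude a b d (p k t) (m k t) * of_real (mollifier_deriv \<epsilon> e (phase c (p k) t - \<sigma>))) +
          \<beta> * (amplitude a' b' d' (p k t) (m k t) * of_real (mollifier_deriv \<epsilon> e' (phase c (p k) t - \<sigma>))))"
        unfolding phase_def by (intro integral_cong dipole_packet horizontal that)
      also have "\<dots> = \<alpha> * I \<epsilon> k a b d e + \<beta> * I \<epsilon> k a' b' d' e'"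
        unfolding I_def using int[OF that]
        by (subst integral_add) (auto intro: integrable_on_mult_right)
      finally show ?thesis .
    qed
    then show ?thesis
      by (simp add: dipole_functional_def)
  qed
  have "((\<lambda>\<epsilon>. \<Sum>k<K. \<alpha> * I \<epsilon> k a b d e + \<beta> * I \<epsilon> k a' b' d' e') \<longlongrightarrow>
      (\<Sum>k<K. \<alpha> * ((-1) ^ e * (dv ^^ e) (source_moment c T (p k) (m k) a b d) \<sigma>) +
        \<beta> * ((-1) ^ e' * (dv ^^ e') (source_moment c T (p k) (m k) a' b' d') \<sigma>))) (at_right 0)"
    using assms by (intro tendsto_intros lim) auto
  moreover have "(\<Sum>k<K. \<alpha> * ((-1) ^ e * (dv ^^ e) (source_moment c T (p k) (m k) a b d) \<sigma>) +
        \<beta> * ((-1) ^ e' * (dv ^^ e') (source_moment c T (p k) (m k) a' b' d') \<sigma>)) =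
      \<alpha> * ((-1) ^ e * moment_sum e a b d \<sigma>) + \<beta> * ((-1) ^ e' * moment_sum e' a' b' d' \<sigma>)"
    by (simp add: moment_sum_def sum.distrib sum_distrib_left)
  ultimately have lim_sum: "((\<lambda>\<epsilon>. \<Sum>k<K. \<alpha> * I \<epsilon> k a b d e + \<beta> * I \<epsilon> k a' b' d' e') \<longlongrightarrow>
      \<alpha> * ((-1) ^ e * moment_sum e a b d \<sigma>) + \<beta> * ((-1) ^ e' * moment_sum e' a' b' d' \<sigma>)) (at_right 0)"
    by simp
  show ?thesis
  proof -
    have "\<forall>\<^sub>F \<epsilon> in at_right 0. (\<Sum>k<K. \<alpha> * I \<epsilon> k a b d e + \<beta> * I \<epsilon> k a' b' d' e') =
        dipole_functional T K p m (\<lambda>x. \<alpha> * packet c \<sigma> (mollifier_deriv \<epsilon>) a b d e x +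
          \<beta> * packet c \<sigma> (mollifier_deriv \<epsilon>) a' b' d' e' x)"
      unfolding eventually_at_right_field by (intro exI[of _ 1] conjI allI impI split[symmetric]) auto
    then show ?thesis
      using lim_sum by (rule Lim_transform_eventually[rotated])
  qed
qed

text \<open>For \<open>\<sigma>\<close> inside \<open>I0\<close> and small \<open>\<epsilon>\<close> the front has left \<open>\<Omega>\<close> before the time \<open>T\<close>, and the packet is
an admissible test function. At the end points of \<open>I0\<close> the formula follows by continuity of the
moment sums.\<close>

lemma RG_eq_moment_sum:
  assumes ws: "weak_solution \<Omega> D c T K p m u \<phi>"
    and int: "interior (I0 \<Omega> c T) \<noteq> {}" and \<tau>: "\<tau> \<in> I0 \<Omega> c T" and le: "e \<le> 2" "e' \<le> 2"
    and w: "\<And>\<sigma> \<epsilon>. \<epsilon> > 0 \<Longrightarrow> w c n \<epsilon> \<sigma> = (\<lambda>x. \<alpha> * packet c \<sigma> (mollifier_deriv \<epsilon>) a b d e x +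
        \<beta> * packet c \<sigma> (mollifier_deriv \<epsilon>) a' b' d' e' x)"
    and wave: "\<And>\<sigma> \<epsilon> x. \<epsilon> > 0 \<Longrightarrow> wave_op c (w c n \<epsilon> \<sigma>) x = 0"
  shows "RG \<Omega> c T \<phi> w n \<tau> =
    \<alpha> * ((-1) ^ e * moment_sum e a b d \<tau>) + \<beta> * ((-1) ^ e' * moment_sum e' a' b' d' \<tau>)"
proof -
  define L where "L \<sigma> = \<alpha> * ((-1) ^ e * moment_sum e a b d \<sigma>) + \<beta> * ((-1) ^ e' * moment_sum e' a' b' d' \<sigma>)" for \<sigma>
  have int_sub: "interior (I0 \<Omega> c T) \<subseteq> arrival_window"
    using I0_subset_arrival_window interior_subset by (rule subset_trans[rotated])
  have lim: "recip_gap_lim \<Omega> T \<phi> (w c) n \<sigma> = L \<sigma>" if \<sigma>: "\<sigma> \<in> interior (I0 \<Omega> c T)" for \<sigma>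
  proof -
    \<comment> \<open>the time between the last contact of the centre of the front with \<open>\<Omega>\<close> and \<open>T\<close>\<close>
    define \<epsilon>0 where "\<epsilon>0 = T + (INF r\<in>\<Omega>. r $ 3 / c) - \<sigma>"
    have "\<epsilon>0 > 0"
      using \<sigma> by (simp add: \<epsilon>0_def I0_def interior_atLeastAtMost_real)
    have "recip_gap \<Omega> T \<phi> (w c n \<epsilon> \<sigma>) = dipole_functional T K p m (w c n \<epsilon> \<sigma>)" if \<epsilon>: "0 < \<epsilon>" "\<epsilon> < \<epsilon>0" for \<epsilon>
    proof -
      interpret wave_profile c \<sigma> "mollifier_deriv \<epsilon>"
        using DERIV_mollifier_deriv[OF \<epsilon>(1)] c_pos by unfold_locales auto
      have 0: "pk a b d e (T, r) = 0" if "r \<in> \<Omega>" for a b d e r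
      proof -
        have "T - (\<sigma> - r $ 3 / c) \<ge> \<epsilon>"
          using bounds_z(2)[OF that] \<epsilon>(2) by (simp add: \<epsilon>0_def)
        then show ?thesis
          using \<epsilon>(1) by (simp add: packet_def mollifier_deriv_eq_0)
      qed
      show ?thesis
      proof (rule recip_gap_eq_dipole_functional[OF ws T_pos _ wave[OF \<epsilon>(1)]])
        show "smooth_on UNIV (w c n \<epsilon> \<sigma>)"
          unfolding w[OF \<epsilon>(1)] by (rule smooth_on_packet_combination)
        show "w c n \<epsilon> \<sigma> (T, r) = 0" "D_t (w c n \<epsilon> \<sigma>) (T, r) = 0" if "r \<in> \<Omega>" for r
          unfolding w[OF \<epsilon>(1)] pd_packet_combination D_t_packet using 0[OF that] by simp_all
      qed
    qed
    then have "\<forall>\<^sub>F \<epsilon> in at_right 0. dipole_functional T K p m (\<lambda>x. \<alpha> * packet c \<sigma> (mollifier_deriv \<epsilon>) a b d e x +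
        \<beta> * packet c \<sigma> (mollifier_deriv \<epsilon>) a' b' d' e' x) = recip_gap \<Omega> T \<phi> (w c n \<epsilon> \<sigma>)"
      using \<open>\<epsilon>0 > 0\<close> w by (auto simp: eventually_at_right_field intro!: exI[of _ \<epsilon>0])
    then have "((\<lambda>\<epsilon>. recip_gap \<Omega> T \<phi> (w c n \<epsilon> \<sigma>)) \<longlongrightarrow> L \<sigma>) (at_right 0)"
      unfolding L_def using \<sigma> int_sub le
      by (intro Lim_transform_eventually[OF dipole_functional_tendsto]) auto
    then show ?thesis
      unfolding recip_gap_lim_def by (intro tendsto_Lim) simp_all
  qed
  show ?thesis
  proof (cases "\<tau> \<in> interior (I0 \<Omega> c T)")
    case True
    then show ?thesis
      by (simp add: RG_def lim L_def)
  next
    case False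
    have "continuous_on arrival_window L"
      unfolding L_def[abs_def] by (intro continuous_intros continuous_on_moment_sum le)
    then have "isCont L \<tau>"
      using open_arrival_window I0_subset_arrival_window \<tau> by (auto simp: continuous_on_eq_continuous_at)
    then have "(L \<longlongrightarrow> L \<tau>) (at \<tau> within interior (I0 \<Omega> c T))"
      using isCont_def tendsto_within_subset by blast
    then have "(recip_gap_lim \<Omega> T \<phi> (w c) n \<longlongrightarrow> L \<tau>) (at \<tau> within interior (I0 \<Omega> c T))"
      by (rule Lim_transform_eventually) (auto simp: eventually_at_filter lim)
    moreover have "at \<tau> within interior (I0 \<Omega> c T) \<noteq> bot"
    proof -
      define l u where "l = max 0 (SUP r\<in>\<Omega>. r $ 3 / c)" and "u = min (T + (INF r\<in>\<Omega>. r $ 3 / c)) T"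
      have I: "I0 \<Omega> c T = {l..u}" and intI: "interior (I0 \<Omega> c T) = {l<..<u}"
        by (simp_all add: I0_def l_def u_def interior_atLeastAtMost_real)
      then have "\<tau> \<in> closure {l<..<u}"
        using int \<tau> closure_greaterThanLessThan[of l u] by simp
      then have "\<tau> islimpt {l<..<u}"
        using False intI by (auto simp: closure_def)
      then show ?thesis
        by (simp add: intI trivial_limit_within)
    qed
    ultimately have "Lim (at \<tau> within interior (I0 \<Omega> c T)) (recip_gap_lim \<Omega> T \<phi> (w c) n) = L \<tau>"
      by (intro tendsto_Lim)
    then show ?thesis
      using False by (simp add: RG_def L_def)
  qed
qed

context
  fixes u \<phi> \<tau>
  assumes ws: "weak_solution \<Omega> D c T K p m u \<phi>"
    and int: "interior (I0 \<Omega> c T) \<noteq> {}" and \<tau>: "\<tau> \<in> I0 \<Omega> c T"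
begin

lemmas RG_packet = RG_eq_moment_sum[OF ws int \<tau>]

lemma c_neq_0: "c \<noteq> 0"
  using c_pos by simp

lemma RG_f_test: "RG \<Omega> c T \<phi> f_test n \<tau> = moment_sum 0 n 0 0 \<tau>"
  using RG_packet[of 0 0 f_test n 1 n 0 0 0 n 0 0] wave_op_fgi[OF c_neq_0] by (simp add: f_test_eq_packet)

lemma RG_g_test: "RG \<Omega> c T \<phi> g_test n \<tau> = moment_sum 1 n 0 0 \<tau>"
proof -
  have "wave_op c (g_test c n \<epsilon> \<sigma>) x = 0" if "\<epsilon> > 0" for \<epsilon> \<sigma> x
  proof -
    interpret wave_profile c \<sigma> "mollifier_deriv \<epsilon>"
      using DERIV_mollifier_deriv[OF that] c_pos by unfold_locales auto
    show ?thesis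
      using wave_op_packet_combination[of "-1" n 0 0 1 0 n 0 0 1 x] wave_op_fgi[OF c_neq_0 that]
      by (simp add: g_test_eq_packet[OF c_neq_0 that])
  qed
  then show ?thesis
    using RG_packet[of 1 0 g_test n "-1" n 0 0 0 n 0 0] by (simp add: g_test_eq_packet[OF c_neq_0])
qed

lemma RG_i_test: "RG \<Omega> c T \<phi> i_test n \<tau> = moment_sum 2 n 0 0 \<tau>"
  using RG_packet[of 2 0 i_test n 1 n 0 0 0 n 0 0] wave_op_fgi[OF c_neq_0] by (simp add: i_test_eq_packet[OF c_neq_0])

lemma RG_h_test:
  "RG \<Omega> c T \<phi> h_test n \<tau> =
     2 * of_nat n * moment_sum 0 (n - 1) 0 1 \<tau> + inverse (of_real c) * moment_sum 1 n 1 0 \<tau>"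
  using RG_packet[of 0 1 h_test n "2 * of_nat n" "n - 1" 0 1 "- inverse (of_real c)" n 1 0, OF _ _ h_test_eq_packet[OF c_neq_0]]
    wave_op_hj[OF c_neq_0, where n=n and \<alpha>=1 and e=0] by (simp add: h_test_eq_packet[OF c_neq_0])

lemma RG_j_test:
  "RG \<Omega> c T \<phi> j_test n \<tau> =
     2 * of_nat n * moment_sum 1 (n - 1) 0 1 \<tau> + inverse (of_real c) * moment_sum 2 n 1 0 \<tau>"
  using RG_packet[of 1 2 j_test n "- (2 * of_nat n)" "n - 1" 0 1 "inverse (of_real c)" n 1 0, OF _ _ j_test_eq_packet[OF c_neq_0]]
    wave_op_hj[OF c_neq_0, where n=n and \<alpha>="-1" and e=1] by (simp add: j_test_eq_packet[OF c_neq_0] numeral_2_eq_2)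

end

end

section \<open>Derivatives of the source moments\<close>

lemma dv_mult:
  fixes f g :: "real \<Rightarrow> complex"
  assumes "C_on 1 J f" "C_on 1 J g" "s \<in> J"
  shows "dv (\<lambda>s. f s * g s) s = f s * dv g s + dv f s * g s"
  using assms by (intro vector_derivative_at has_vector_derivative_mult C_on_has_vector_derivative[of 0]) auto

lemma dv_add:
  assumes "C_on 1 J f" "C_on 1 J g" "s \<in> J"
  shows "dv (\<lambda>s. f s + g s) s = dv f s + dv g s"
  using assms by (intro vector_derivative_at has_vector_derivative_add C_on_has_vector_derivative[of 0]) auto

lemma dv_bounded_linear:
  assumes "bounded_linear L" "C_on 1 J f" "s \<in> J"
  shows "dv (\<lambda>s. L (f s)) s = L (dv f s)"
  using assms by (intro vector_derivative_at bounded_linear.has_vector_derivative[OF assms(1)] C_on_has_vector_derivative[of 0]) auto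

lemma dv_power:
  fixes f :: "real \<Rightarrow> complex"
  assumes "open J" "C_on 1 J f" "s \<in> J"
  shows "dv (\<lambda>s. f s ^ j) s = of_nat j * f s ^ (j - 1) * dv f s"
proof (induction j)
  case (Suc j)
  have "dv (\<lambda>s. f s ^ Suc j) s = f s * dv (\<lambda>s. f s ^ j) s + dv f s * f s ^ j"
    using assms by (simp only: power_Suc) (intro dv_mult C_on_power)
  with Suc show ?case
    by (cases j) (simp_all add: algebra_simps)
qed simp

lemma C_on_2_D: "C_on 2 J f \<Longrightarrow> C_on 1 J f" "C_on 2 J f \<Longrightarrow> C_on 1 J (dv f)"
  using C_on_SucD[of 1 J f] C_on_dv[of 1 J f] by (simp_all add: numeral_2_eq_2)

lemma dv_dv_mult:
  fixes f g :: "real \<Rightarrow> complex"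
  assumes "open J" "C_on 2 J f" "C_on 2 J g" "s \<in> J"
  shows "dv (dv (\<lambda>s. f s * g s)) s = f s * dv (dv g) s + 2 * dv f s * dv g s + dv (dv f) s * g s"
proof -
  note C1 = C_on_2_D[OF assms(2)] C_on_2_D[OF assms(3)]
  have "dv (dv (\<lambda>s. f s * g s)) s = dv (\<lambda>s. f s * dv g s + dv f s * g s) s"
    using assms(1,4) dv_mult[OF C1(1,3)] by (rule dv_cong)
  also have "\<dots> = dv (\<lambda>s. f s * dv g s) s + dv (\<lambda>s. dv f s * g s) s"
    using assms(1,4) C1 by (intro dv_add C_on_mult) auto
  finally show ?thesis
    using assms(4) C1 by (simp add: dv_mult algebra_simps)
qed

lemma dv_dv_add:
  assumes "open J" "C_on 2 J f" "C_on 2 J g" "s \<in> J"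
  shows "dv (dv (\<lambda>s. f s + g s)) s = dv (dv f) s + dv (dv g) s"
proof -
  note C1 = C_on_2_D[OF assms(2)] C_on_2_D[OF assms(3)]
  have "dv (dv (\<lambda>s. f s + g s)) s = dv (\<lambda>s. dv f s + dv g s) s"
    using assms(1,4) dv_add[OF C1(1,3)] by (rule dv_cong)
  with dv_add[OF C1(2,4) assms(4)] show ?thesis by simp
qed

lemma dv_dv_bounded_linear:
  assumes "open J" "bounded_linear L" "C_on 2 J f" "s \<in> J"
  shows "dv (dv (\<lambda>s. L (f s))) s = L (dv (dv f) s)"
proof -
  note C1 = C_on_2_D[OF assms(3)]
  have "dv (dv (\<lambda>s. L (f s))) s = dv (\<lambda>s. L (dv f s)) s"
    using assms(1,4) dv_bounded_linear[OF assms(2) C1(1)] by (rule dv_cong)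
  with dv_bounded_linear[OF assms(2) C1(2) assms(4)] show ?thesis by simp
qed

lemmas dv_cnj = dv_bounded_linear[OF bounded_linear_cnj]
lemmas dv_dv_cnj = dv_dv_bounded_linear[OF _ bounded_linear_cnj]

lemma dv_dv_power:
  fixes f :: "real \<Rightarrow> complex"
  assumes "open J" "C_on 2 J f" "s \<in> J"
  shows "dv (dv (\<lambda>s. f s ^ j)) s =
    of_nat j * (f s ^ (j - 1) * dv (dv f) s + of_nat (j - 1) * f s ^ (j - 2) * (dv f s)\<^sup>2)"
proof -
  note C1 = C_on_2_D[OF assms(2)]
  have "dv (dv (\<lambda>s. f s ^ j)) s = dv (\<lambda>s. of_nat j * (f s ^ (j - 1) * dv f s)) s"
    using dv_power[OF assms(1) C1(1), of _ j] by (intro dv_cong[OF assms(1,3)]) (simp add: mult_ac)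
  also have "\<dots> = of_nat j * dv (\<lambda>s. f s ^ (j - 1) * dv f s) s"
    using assms(1,3) C1 by (intro dv_bounded_linear[OF bounded_linear_mult_right] C_on_mult C_on_power) auto
  also have "dv (\<lambda>s. f s ^ (j - 1) * dv f s) s = f s ^ (j - 1) * dv (dv f) s + dv (\<lambda>s. f s ^ (j - 1)) s * dv f s"
    using assms(1,3) C1 by (intro dv_mult C_on_power) auto
  finally show ?thesis
    using dv_power[OF assms(1) C1(1) assms(3), of "j - 1"]
    by (simp add: algebra_simps power2_eq_square numeral_2_eq_2)
qed

text \<open>The first two derivatives of \<open>w ^ j * q\<close> in terms of those of \<open>w\<close> (\<open>w1\<close>, \<open>w2\<close>) and of \<open>q\<close> (\<open>q1\<close>, \<open>q2\<close>).
They are linear in the highest derivatives, which enter as \<open>w ^ j * q1\<close> and \<open>j * w ^ (j - 1) * (q * w1)\<close>: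
this is the confluent Vandermonde structure.\<close>

definition dv_moment :: "nat \<Rightarrow> complex \<Rightarrow> complex \<Rightarrow> complex \<Rightarrow> complex \<Rightarrow> complex" where
  "dv_moment j w w1 q q1 = w ^ j * q1 + of_nat j * w ^ (j - 1) * w1 * q"

definition dv2_moment :: "nat \<Rightarrow> complex \<Rightarrow> complex \<Rightarrow> complex \<Rightarrow> complex \<Rightarrow> complex \<Rightarrow> complex \<Rightarrow> complex" where
  "dv2_moment j w w1 w2 q q1 q2 = w ^ j * q2 + 2 * (of_nat j * w ^ (j - 1) * w1) * q1
     + of_nat j * (w ^ (j - 1) * w2 + of_nat (j - 1) * w ^ (j - 2) * w1\<^sup>2) * q"

lemma dv_power_mult:
  fixes f g :: "real \<Rightarrow> complex"
  assumes "open J" "C_on 2 J f" "C_on 2 J g" "s \<in> J"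
  shows "dv (\<lambda>s. f s ^ j * g s) s = dv_moment j (f s) (dv f s) (g s) (dv g s)"
    and "dv (dv (\<lambda>s. f s ^ j * g s)) s = dv2_moment j (f s) (dv f s) (dv (dv f) s) (g s) (dv g s) (dv (dv g) s)"
proof -
  have P: "C_on 2 J (\<lambda>s. f s ^ j)"
    using assms(1,2) by (rule C_on_power)
  show "dv (\<lambda>s. f s ^ j * g s) s = dv_moment j (f s) (dv f s) (g s) (dv g s)"
    by (simp add: dv_mult[OF C_on_2_D(1)[OF P] C_on_2_D(1)[OF assms(3)] assms(4)]
        dv_power[OF assms(1) C_on_2_D(1)[OF assms(2)] assms(4)] dv_moment_def)
  show "dv (dv (\<lambda>s. f s ^ j * g s)) s = dv2_moment j (f s) (dv f s) (dv (dv f) s) (g s) (dv g s) (dv (dv g) s)"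
    by (simp add: dv_dv_mult[OF assms(1) P assms(3,4)]
        dv_power[OF assms(1) C_on_2_D(1)[OF assms(2)] assms(4)] dv_dv_power[OF assms(1,2,4)] dv2_moment_def)
qed

definition pos_xy :: "real \<Rightarrow> real \<Rightarrow> (real \<Rightarrow> real^3) \<Rightarrow> real \<Rightarrow> complex" where
  "pos_xy c T q s = cxy (q (arrival_time c T q s))"

definition pos_z :: "real \<Rightarrow> real \<Rightarrow> (real \<Rightarrow> real^3) \<Rightarrow> real \<Rightarrow> complex" where
  "pos_z c T q s = of_real (q (arrival_time c T q s) $ 3)"

text \<open>The weight \<open>q\<^sub>k\<close>, a horizontal moment seen as a complex number and scaled by the rate of arrival.\<close>

definition mom_xy :: "real \<Rightarrow> real \<Rightarrow> (real \<Rightarrow> real^3) \<Rightarrow> (real \<Rightarrow> real^3) \<Rightarrow> real \<Rightarrow> complex" where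
  "mom_xy c T q \<mu> s = of_real (dv (arrival_time c T q) s) * cxy (\<mu> (arrival_time c T q s))"

text \<open>The shapes that occur: \<open>(n, 0, 0)\<close> in \<open>f\<close>, \<open>g\<close>, \<open>i\<close>, and \<open>(n - 1, 0, 1)\<close> with \<open>(n, 1, 0)\<close> in \<open>h\<close>, \<open>j\<close>.
Each is built from terms \<open>W ^ j * g\<close>, to which \<open>dv_power_mult\<close> applies.\<close>

lemma source_moment_xy:
  "source_moment c T q \<mu> n 0 0 = (\<lambda>s. of_nat n * (pos_xy c T q s ^ (n - 1) * mom_xy c T q \<mu> s))"
  "source_moment c T q \<mu> n 0 1 = (\<lambda>s. of_nat n * (pos_z c T q s * (pos_xy c T q s ^ (n - 1) * mom_xy c T q \<mu> s)))"
  "source_moment c T q \<mu> n 1 0 = (\<lambda>s. of_nat n * (pos_xy c T q s ^ (n - 1) * (cnj (pos_xy c T q s) * mom_xy c T q \<mu> s))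
     + pos_xy c T q s ^ n * cnj (mom_xy c T q \<mu> s))"
  by (auto simp: source_moment_def amplitude_def pos_xy_def pos_z_def mom_xy_def algebra_simps)

context moving_point
begin

context
  fixes \<mu> :: "real \<Rightarrow> real^3" assumes C6_moment: "C_time 6 T \<mu>"
begin

abbreviation "W \<equiv> pos_xy c T q"
abbreviation "Z \<equiv> pos_z c T q"
abbreviation "Q \<equiv> mom_xy c T q \<mu>"

lemma C_on_WZQ: "C_on 2 J W" "C_on 2 J Z" "C_on 2 J Q"
proof -
  have "C_on 5 J W" "C_on 5 J Z" "C_on 5 J Q"
    unfolding pos_xy_def[abs_def] pos_z_def[abs_def] mom_xy_def[abs_def]
    using C_on_compose_arr[OF q_C_on] C_on_compose_arr[OF C_time_imp_C_on[OF C6_moment]]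
    by (auto intro!: C_on_mult C_on_of_real C_on_cxy C_on_nth C_on_dv_arr simp del: C_on.simps)
  then show "C_on 2 J W" "C_on 2 J Z" "C_on 2 J Q"
    using C_on_mono[of 5 J _ 2] by simp_all
qed

context
  fixes s assumes s: "s \<in> J"
begin

lemma dv_source_moment:
  shows "(dv ^^ 1) (source_moment c T q \<mu> n 0 0) s = of_nat n * dv_moment (n - 1) (W s) (dv W s) (Q s) (dv Q s)"
    and "(dv ^^ 2) (source_moment c T q \<mu> n 0 0) s =
      of_nat n * dv2_moment (n - 1) (W s) (dv W s) (dv (dv W) s) (Q s) (dv Q s) (dv (dv Q) s)"
    and "(dv ^^ 1) (source_moment c T q \<mu> n 0 1) s =
      of_nat n * (Z s * dv_moment (n - 1) (W s) (dv W s) (Q s) (dv Q s) + dv Z s * (W s ^ (n - 1) * Q s))"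
    and "(dv ^^ 1) (source_moment c T q \<mu> n 1 0) s =
      of_nat n * dv_moment (n - 1) (W s) (dv W s) (cnj (W s) * Q s) (cnj (W s) * dv Q s + cnj (dv W s) * Q s)
      + dv_moment n (W s) (dv W s) (cnj (Q s)) (cnj (dv Q s))"
    and "(dv ^^ 2) (source_moment c T q \<mu> n 1 0) s =
      of_nat n * dv2_moment (n - 1) (W s) (dv W s) (dv (dv W) s) (cnj (W s) * Q s) (cnj (W s) * dv Q s + cnj (dv W s) * Q s)
        (cnj (W s) * dv (dv Q) s + 2 * cnj (dv W s) * dv Q s + cnj (dv (dv W) s) * Q s)
      + dv2_moment n (W s) (dv W s) (dv (dv W) s) (cnj (Q s)) (cnj (dv Q s)) (cnj (dv (dv Q) s))"
proof -
  note W = C_on_WZQ(1) and Z = C_on_WZQ(2) and Q = C_on_WZQ(3)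
  have o: "open J" by simp
  note cW = C_on_cnj[OF o W] and cQ = C_on_cnj[OF o Q]
  note cWQ = C_on_mult[OF o cW Q]
  have PQ: "C_on 2 J (\<lambda>s. W s ^ j * Q s)" and PcQ: "C_on 2 J (\<lambda>s. W s ^ j * cnj (Q s))"
    and PcWQ: "C_on 2 J (\<lambda>s. W s ^ j * (cnj (W s) * Q s))" for j
    by (intro C_on_mult C_on_power W Q cQ cWQ o)+
  note lin = dv_bounded_linear[OF bounded_linear_mult_right[of "of_nat n"] C_on_2_D(1) s]
    dv_dv_bounded_linear[OF o bounded_linear_mult_right[of "of_nat n"] _ s]
  note nPcWQ = C_on_bounded_linear[OF o bounded_linear_mult_right[of "of_nat n"] PcWQ]
  note c1 = dv_cnj[OF C_on_2_D(1) s] dv_dv_cnj[OF o _ s]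
  have cWQ': "dv (\<lambda>s. cnj (W s) * Q s) s = cnj (W s) * dv Q s + cnj (dv W s) * Q s"
    "dv (dv (\<lambda>s. cnj (W s) * Q s)) s = cnj (W s) * dv (dv Q) s + 2 * cnj (dv W s) * dv Q s + cnj (dv (dv W) s) * Q s"
    by (simp_all add: dv_mult[OF C_on_2_D(1)[OF cW] C_on_2_D(1)[OF Q] s] dv_dv_mult[OF o cW Q s] c1[OF W])
  show "(dv ^^ 1) (source_moment c T q \<mu> n 0 0) s = of_nat n * dv_moment (n - 1) (W s) (dv W s) (Q s) (dv Q s)"
    unfolding source_moment_xy by (simp add: lin[OF PQ] dv_power_mult[OF o W Q s])
  show "(dv ^^ 2) (source_moment c T q \<mu> n 0 0) s =
      of_nat n * dv2_moment (n - 1) (W s) (dv W s) (dv (dv W) s) (Q s) (dv Q s) (dv (dv Q) s)"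
    unfolding source_moment_xy by (simp add: numeral_2_eq_2 lin[OF PQ] dv_power_mult[OF o W Q s])
  show "(dv ^^ 1) (source_moment c T q \<mu> n 0 1) s =
      of_nat n * (Z s * dv_moment (n - 1) (W s) (dv W s) (Q s) (dv Q s) + dv Z s * (W s ^ (n - 1) * Q s))"
    unfolding source_moment_xy
    by (simp add: lin[OF C_on_mult[OF o Z PQ]] dv_mult[OF C_on_2_D(1)[OF Z] C_on_2_D(1)[OF PQ] s] dv_power_mult[OF o W Q s])
  show "(dv ^^ 1) (source_moment c T q \<mu> n 1 0) s =
      of_nat n * dv_moment (n - 1) (W s) (dv W s) (cnj (W s) * Q s) (cnj (W s) * dv Q s + cnj (dv W s) * Q s)
      + dv_moment n (W s) (dv W s) (cnj (Q s)) (cnj (dv Q s))"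
    unfolding source_moment_xy
    by (simp add: dv_add[OF C_on_2_D(1)[OF nPcWQ] C_on_2_D(1)[OF PcQ] s] lin[OF PcWQ] dv_power_mult[OF o W cWQ s]
        dv_power_mult[OF o W cQ s] cWQ' c1[OF Q])
  show "(dv ^^ 2) (source_moment c T q \<mu> n 1 0) s =
      of_nat n * dv2_moment (n - 1) (W s) (dv W s) (dv (dv W) s) (cnj (W s) * Q s) (cnj (W s) * dv Q s + cnj (dv W s) * Q s)
        (cnj (W s) * dv (dv Q) s + 2 * cnj (dv W s) * dv Q s + cnj (dv (dv W) s) * Q s)
      + dv2_moment n (W s) (dv W s) (dv (dv W) s) (cnj (Q s)) (cnj (dv Q s)) (cnj (dv (dv Q) s))"
    unfolding source_moment_xy
    by (simp add: numeral_2_eq_2 dv_dv_add[OF o nPcWQ PcQ s] lin[OF PcWQ] dv_power_mult[OF o W cWQ s]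
        dv_power_mult[OF o W cQ s] cWQ' c1[OF Q])
qed

text \<open>Differentiate \<open>arr s = s - Z s / c\<close>. This recovers the Jacobian from the motion in \<open>z\<close>.\<close>

lemma dv_arr_eq: "complex_of_real (dv arr s) = 1 - dv Z s / of_real c"
proof -
  have Z: "C_on 1 J Z"
    using C_on_2_D(1)[OF C_on_WZQ(2)] .
  have "(Z has_vector_derivative dv Z s) (at s)"
    using Z s by (intro C_on_has_vector_derivative[of 0]) auto
  then have "((\<lambda>s. of_real s - Z s / of_real c) has_vector_derivative 1 - dv Z s / of_real c) (at s)"
    by (auto intro!: derivative_eq_intros has_vector_derivative_of_real)
  moreover have "((\<lambda>s. of_real (arr s)) has_vector_derivative complex_of_real (dv arr s)) (at s)"
    using DERIV_arr[OF s] dv_arr[OF s]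
    by (intro has_vector_derivative_of_real) (simp add: has_real_derivative_iff_has_vector_derivative)
  then have "((\<lambda>s. of_real s - Z s / of_real c) has_vector_derivative complex_of_real (dv arr s)) (at s)"
  proof (rule has_vector_derivative_transform_within_open[OF _ _ s])
    fix y assume "y \<in> J"
    from arr(2)[OF this] have "arr y = y - q (arr y) $ 3 / c"
      by (simp add: phase_def)
    then have "complex_of_real (arr y) = of_real (y - q (arr y) $ 3 / c)"
      by simp
    then show "complex_of_real (arr y) = of_real y - Z y / of_real c"
      by (simp add: pos_z_def)
  qed simp
  ultimately show ?thesis
    using vector_derivative_unique_at by blast
qed

lemma dv_compose_arr:
  assumes "C_on 1 {0<..<T} f" and "y \<in> J"
  shows "dv (\<lambda>s. f (arr s)) y = dv arr y *\<^sub>R dv f (arr y)"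
proof -
  have a: "(arr has_vector_derivative dv arr y) (at y)"
    using DERIV_arr[OF assms(2)] dv_arr[OF assms(2)] by (simp add: has_real_derivative_iff_has_vector_derivative)
  have "(f has_vector_derivative dv f (arr y)) (at (arr y))"
    using assms(1) arr(1)[OF assms(2)] by (intro C_on_has_vector_derivative[of 0]) auto
  from vector_diff_chain_at[OF a this] show ?thesis
    by (simp add: o_def vector_derivative_at)
qed

text \<open>By the chain and product rules, every term of the weight and of its first two derivatives contains
one of the moment's derivatives of order at most two at the arrival time.\<close>

lemma mom_xy_flat:
  assumes "\<forall>j\<le>2. (time_deriv T ^^ j) \<mu> (arr s) = 0"
  shows "Q s = 0" "dv Q s = 0" "dv (dv Q) s = 0"
proof -
  have \<mu>0: "\<mu> (arr s) = 0" "time_deriv T \<mu> (arr s) = 0" "time_deriv T (time_deriv T \<mu>) (arr s) = 0"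
    using assms[rule_format, of 0] assms[rule_format, of 1] assms[rule_format, of 2] by (simp_all add: numeral_2_eq_2)
  have C: "C_time 5 T (time_deriv T \<mu>)" "\<And>t. t \<in> {0..T} \<Longrightarrow> \<mu> differentiable (at t within {0..T})"
    using C6_moment C_time_Suc[of 5 T \<mu>] by auto
  have "C_time 4 T (time_deriv T (time_deriv T \<mu>))"
    "\<And>t. t \<in> {0..T} \<Longrightarrow> time_deriv T \<mu> differentiable (at t within {0..T})"
    using C(1) C_time_Suc[of 4 T "time_deriv T \<mu>"] by auto
  have d1: "dv \<mu> t = time_deriv T \<mu> t" "dv (time_deriv T \<mu>) t = time_deriv T (time_deriv T \<mu>) t" if "t \<in> {0<..<T}" for t
    using that by (auto intro!: vector_derivative_at has_vector_derivative_time_deriv C(2) \<open>\<And>t. _ \<Longrightarrow> time_deriv T \<mu> differentiable _\<close>)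
  have o: "open J" by simp
  have CN: "C_on 2 J (\<lambda>s. \<mu> (arr s))"
    using C_on_mono[OF C_on_compose_arr[OF C_time_imp_C_on[OF C6_moment]]] by simp
  have C\<mu>: "C_on 2 {0<..<T} \<mu>"
    using C_on_mono[OF C_time_imp_C_on[OF C6_moment]] by simp
  have N1: "dv (\<lambda>s. \<mu> (arr s)) y = dv arr y *\<^sub>R time_deriv T \<mu> (arr y)" if "y \<in> J" for y
    using dv_compose_arr[OF C_on_2_D(1)[OF C\<mu>] that] d1(1)[OF arr(1)[OF that]] by simp
  have C\<mu>': "C_on 1 {0<..<T} (time_deriv T \<mu>)"
    by (rule C_on_mono[OF C_time_imp_C_on[OF C(1)]]) simp
  have "C_on 1 J arr" "C_on 1 J (dv arr)"
    by (rule C_on_mono[OF arr_C_on] C_on_mono[OF C_on_dv_arr]; simp)+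
  have "((\<lambda>y. dv arr y *\<^sub>R time_deriv T \<mu> (arr y)) has_vector_derivative
      dv arr s *\<^sub>R dv (\<lambda>y. time_deriv T \<mu> (arr y)) s + dv (dv arr) s *\<^sub>R time_deriv T \<mu> (arr s)) (at s)"
    using s \<open>C_on 1 J (dv arr)\<close> C_on_compose[OF _ o C\<mu>' \<open>C_on 1 J arr\<close>] arr(1)
    by (intro bounded_bilinear.has_vector_derivative[OF bounded_bilinear_scaleR] C_on_has_vector_derivative[of 0]) auto
  then have "dv (dv (\<lambda>s. \<mu> (arr s))) s = dv arr s *\<^sub>R dv (\<lambda>y. time_deriv T \<mu> (arr y)) s + dv (dv arr) s *\<^sub>R time_deriv T \<mu> (arr s)"
    using dv_cong[OF o s, of "dv (\<lambda>s. \<mu> (arr s))"] N1 by (simp add: vector_derivative_at)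
  then have N2: "dv (dv (\<lambda>s. \<mu> (arr s))) s = 0"
    using dv_compose_arr[OF C\<mu>' s] d1(2)[OF arr(1)[OF s]] by (simp add: \<mu>0)
  have cxy0: "cxy 0 = 0"
    by (simp add: cxy_def complex_eq_iff)
  have t1: "C_on 2 J (\<lambda>s. complex_of_real (dv arr s))"
    using C_on_mono[OF C_on_of_real[OF o C_on_dv_arr]] by simp
  note cN = C_on_cxy[OF o CN]
  have "cxy (\<mu> (arr s)) = 0" "dv (\<lambda>s. cxy (\<mu> (arr s))) s = 0" "dv (dv (\<lambda>s. cxy (\<mu> (arr s)))) s = 0"
    by (simp_all add: \<mu>0 cxy0 N1[OF s] N2 dv_bounded_linear[OF bounded_linear_cxy C_on_2_D(1)[OF CN] s]
        dv_dv_bounded_linear[OF o bounded_linear_cxy CN s])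
  then show "Q s = 0" "dv Q s = 0" "dv (dv Q) s = 0"
    unfolding mom_xy_def[abs_def]
    by (simp_all add: dv_mult[OF C_on_2_D(1)[OF t1] C_on_2_D(1)[OF cN] s] dv_dv_mult[OF o t1 cN s])
qed

end
end
end

section \<open>Recovery of the sources\<close>

context dipole_config
begin

context
  fixes \<tau>
  assumes \<tau>: "\<tau> \<in> I0 \<Omega> c T"
begin

abbreviation "act \<equiv> active c T K p m \<tau>"
abbreviation "w k \<equiv> pos_xy c T (p k) \<tau>"
abbreviation "w1 k \<equiv> dv (pos_xy c T (p k)) \<tau>"
abbreviation "w2 k \<equiv> dv (dv (pos_xy c T (p k))) \<tau>"
abbreviation "z k \<equiv> pos_z c T (p k) \<tau>"
abbreviation "z1 k \<equiv> dv (pos_z c T (p k)) \<tau>"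
abbreviation "q k \<equiv> mom_xy c T (p k) (m k) \<tau>"
abbreviation "q1 k \<equiv> dv (mom_xy c T (p k) (m k)) \<tau>"
abbreviation "q2 k \<equiv> dv (dv (mom_xy c T (p k) (m k))) \<tau>"

lemma active_subset: "act \<subseteq> {..<K}"
  by (auto simp: active_def)

lemma \<tau>_J: "k < K \<Longrightarrow> \<tau> \<in> {phase c (p k) 0<..<phase c (p k) T}"
  using \<tau> I0_subset_arrival_window by (auto simp: arrival_window_def)

text \<open>A horizontal moment is zero iff its complex number is, and the rate of arrival is positive.\<close>

lemma mom_xy_eq_0_iff: "k < K \<Longrightarrow> q k = 0 \<longleftrightarrow> k \<notin> act"
proof -
  assume k: "k < K"
  interpret moving_point c T "p k" by (rule source[OF k])
  have "m k (arr \<tau>) $ 3 = 0"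
    using arr(1)[OF \<tau>_J[OF k]] by (intro horizontal k) auto
  then have "cxy (m k (arr \<tau>)) = 0 \<longleftrightarrow> m k (arr \<tau>) = 0"
    by (auto simp: cxy_def complex_eq_iff vec_eq_iff forall_3)
  then show ?thesis
    using dv_arr_pos[OF \<tau>_J[OF k]] k by (auto simp: mom_xy_def active_def)
qed

lemma moment_sum_active_0:
  "moment_sum 0 n 0 0 \<tau> = of_nat n * (\<Sum>k\<in>act. w k ^ (n - 1) * q k)"
  "moment_sum 0 n 0 1 \<tau> = of_nat n * (\<Sum>k\<in>act. z k * (w k ^ (n - 1) * q k))"
proof -
  have "(\<Sum>k<K. f k * q k) = (\<Sum>k\<in>act. f k * q k)" for f
    using active_subset mom_xy_eq_0_iff by (intro sum.mono_neutral_right) auto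
  from this[of "\<lambda>k. w k ^ (n - 1)"] this[of "\<lambda>k. z k * w k ^ (n - 1)"]
  show "moment_sum 0 n 0 0 \<tau> = of_nat n * (\<Sum>k\<in>act. w k ^ (n - 1) * q k)"
    "moment_sum 0 n 0 1 \<tau> = of_nat n * (\<Sum>k\<in>act. z k * (w k ^ (n - 1) * q k))"
    by (simp_all add: moment_sum_def source_moment_xy mult.assoc flip: sum_distrib_left One_nat_def)
qed

text \<open>Flatness removes the inactive sources from the derivatives of the moment sums as well.\<close>

lemma moment_sum_active:
  assumes flat: "inactive_flat c T K p m \<tau>"
  shows "moment_sum 1 n 0 0 \<tau> = of_nat n * (\<Sum>k\<in>act. dv_moment (n - 1) (w k) (w1 k) (q k) (q1 k))"
    and "moment_sum 2 n 0 0 \<tau> = of_nat n * (\<Sum>k\<in>act. dv2_moment (n - 1) (w k) (w1 k) (w2 k) (q k) (q1 k) (q2 k))"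
    and "moment_sum 1 n 0 1 \<tau> =
      of_nat n * (\<Sum>k\<in>act. z k * dv_moment (n - 1) (w k) (w1 k) (q k) (q1 k) + z1 k * (w k ^ (n - 1) * q k))"
    and "moment_sum 1 n 1 0 \<tau> = (\<Sum>k\<in>act.
      of_nat n * dv_moment (n - 1) (w k) (w1 k) (cnj (w k) * q k) (cnj (w k) * q1 k + cnj (w1 k) * q k)
      + dv_moment n (w k) (w1 k) (cnj (q k)) (cnj (q1 k)))"
    and "moment_sum 2 n 1 0 \<tau> = (\<Sum>k\<in>act.
      of_nat n * dv2_moment (n - 1) (w k) (w1 k) (w2 k) (cnj (w k) * q k) (cnj (w k) * q1 k + cnj (w1 k) * q k)
        (cnj (w k) * q2 k + 2 * cnj (w1 k) * q1 k + cnj (w2 k) * q k)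
      + dv2_moment n (w k) (w1 k) (w2 k) (cnj (q k)) (cnj (q1 k)) (cnj (q2 k)))"
proof -
  have inactive: "q k = 0" "q1 k = 0" "q2 k = 0" if "k \<in> {..<K} - act" for k
  proof -
    have k: "k < K" "m k (arrival_time c T (p k) \<tau>) = 0"
      using that by (auto simp: active_def)
    then have "\<forall>j\<le>2. (time_deriv T ^^ j) (m k) (arrival_time c T (p k) \<tau>) = 0"
      using flat by (simp add: inactive_flat_def)
    from moving_point.mom_xy_flat[OF source C_time_moment \<tau>_J this] k(1)
    show "q k = 0" "q1 k = 0" "q2 k = 0" by auto
  qed
  have restrict: "(\<Sum>k<K. f k) = (\<Sum>k\<in>act. f k)" if "\<And>k. k \<in> {..<K} - act \<Longrightarrow> f k = 0" for f :: "nat \<Rightarrow> complex"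
    using active_subset that by (intro sum.mono_neutral_right) auto
  note d = moving_point.dv_source_moment[OF source C_time_moment \<tau>_J]
  have zero: "dv_moment j x y 0 0 = 0" "dv2_moment j x y y' 0 0 0 = 0" for j x y y'
    by (simp_all add: dv_moment_def dv2_moment_def)
  show "moment_sum 1 n 0 0 \<tau> = of_nat n * (\<Sum>k\<in>act. dv_moment (n - 1) (w k) (w1 k) (q k) (q1 k))"
    unfolding moment_sum_def by (subst restrict[symmetric]) (auto simp: inactive zero sum_distrib_left d simp del: One_nat_def intro!: sum.cong)
  show "moment_sum 2 n 0 0 \<tau> = of_nat n * (\<Sum>k\<in>act. dv2_moment (n - 1) (w k) (w1 k) (w2 k) (q k) (q1 k) (q2 k))"
    unfolding moment_sum_def by (subst restrict[symmetric]) (auto simp: inactive zero sum_distrib_left d simp del: One_nat_def intro!: sum.cong)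
  show "moment_sum 1 n 0 1 \<tau> =
      of_nat n * (\<Sum>k\<in>act. z k * dv_moment (n - 1) (w k) (w1 k) (q k) (q1 k) + z1 k * (w k ^ (n - 1) * q k))"
    unfolding moment_sum_def by (subst restrict[symmetric]) (auto simp: inactive zero sum_distrib_left d simp del: One_nat_def intro!: sum.cong)
  show "moment_sum 1 n 1 0 \<tau> = (\<Sum>k\<in>act.
      of_nat n * dv_moment (n - 1) (w k) (w1 k) (cnj (w k) * q k) (cnj (w k) * q1 k + cnj (w1 k) * q k)
      + dv_moment n (w k) (w1 k) (cnj (q k)) (cnj (q1 k)))"
    unfolding moment_sum_def by (subst restrict[symmetric]) (auto simp: inactive zero d simp del: One_nat_def intro!: sum.cong)
  show "moment_sum 2 n 1 0 \<tau> = (\<Sum>k\<in>act.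
      of_nat n * dv2_moment (n - 1) (w k) (w1 k) (w2 k) (cnj (w k) * q k) (cnj (w k) * q1 k + cnj (w1 k) * q k)
        (cnj (w k) * q2 k + 2 * cnj (w1 k) * q1 k + cnj (w2 k) * q k)
      + dv2_moment n (w k) (w1 k) (w2 k) (cnj (q k)) (cnj (q1 k)) (cnj (q2 k)))"
    unfolding moment_sum_def by (subst restrict[symmetric]) (auto simp: inactive zero d simp del: One_nat_def intro!: sum.cong)
qed

end
end

text \<open>Two confluent Vandermonde systems in succession. Once the first derivatives agree, the terms in
\<open>w1 * q1\<close> and \<open>w1\<^sup>2\<close> drop out of the difference of the second derivatives, and the system for
\<open>q2\<close>, \<open>q * w2\<close> has the form of the one for \<open>q1\<close>, \<open>q * w1\<close>.\<close>

lemma jets_determined: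
  fixes w w1 w2 q q1 q2 w1' w2' q1' q2' :: "'k \<Rightarrow> complex"
  assumes fin: "finite A" and inj: "inj_on w A" and nz: "\<And>k. k \<in> A \<Longrightarrow> q k \<noteq> 0"
    and g: "\<And>j. j < 2 * card A \<Longrightarrow>
      (\<Sum>k\<in>A. dv_moment j (w k) (w1 k) (q k) (q1 k)) = (\<Sum>k\<in>A. dv_moment j (w k) (w1' k) (q k) (q1' k))"
    and i: "\<And>j. j < 2 * card A \<Longrightarrow>
      (\<Sum>k\<in>A. dv2_moment j (w k) (w1 k) (w2 k) (q k) (q1 k) (q2 k)) =
      (\<Sum>k\<in>A. dv2_moment j (w k) (w1' k) (w2' k) (q k) (q1' k) (q2' k))"
  shows "\<And>k. k \<in> A \<Longrightarrow> w1 k = w1' k \<and> q1 k = q1' k \<and> w2 k = w2' k \<and> q2 k = q2' k"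
proof -
  have "(\<Sum>k\<in>A. (q1 k - q1' k) * w k ^ j + (q k * (w1 k - w1' k)) * (of_nat j * w k ^ (j - 1))) = 0"
    if "j < 2 * card A" for j
    using g[OF that] by (simp add: dv_moment_def sum.distrib sum_subtractf algebra_simps)
  from confluent_vandermonde[OF fin inj this]
  have 1: "q1 k = q1' k" "w1 k = w1' k" if "k \<in> A" for k
    using that nz by auto
  have "(\<Sum>k\<in>A. (q2 k - q2' k) * w k ^ j + (q k * (w2 k - w2' k)) * (of_nat j * w k ^ (j - 1))) = 0"
    if "j < 2 * card A" for j
  proof -
    have "(\<Sum>k\<in>A. dv2_moment j (w k) (w1 k) (w2 k) (q k) (q1 k) (q2 k) - dv2_moment j (w k) (w1' k) (w2' k) (q k) (q1' k) (q2' k)) = 0"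
      using i[OF that] by (simp add: sum_subtractf)
    moreover have "dv2_moment j (w k) (w1 k) (w2 k) (q k) (q1 k) (q2 k) - dv2_moment j (w k) (w1' k) (w2' k) (q k) (q1' k) (q2' k)
        = (q2 k - q2' k) * w k ^ j + (q k * (w2 k - w2' k)) * (of_nat j * w k ^ (j - 1))" if "k \<in> A" for k
      using 1[OF that] by (simp add: dv2_moment_def algebra_simps)
    ultimately show ?thesis by simp
  qed
  from confluent_vandermonde[OF fin inj this]
  show "\<And>k. k \<in> A \<Longrightarrow> w1 k = w1' k \<and> q1 k = q1' k \<and> w2 k = w2' k \<and> q2 k = q2' k"
    using 1 nz by auto
qed

lemma reindex_moments:
  assumes "bij_betw \<sigma> A B"
  shows "(\<Sum>k\<in>B. f k) = (\<Sum>k\<in>A. f (\<sigma> k))"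
  using sum.reindex_bij_betw[OF assms] by metis

theorem theorem3p2:
  fixes \<Omega> D :: "(real^3) set" and c T \<tau> :: real and KM K K' :: nat
    and p m p' m' :: "nat \<Rightarrow> real \<Rightarrow> real^3"
    and u u' :: "real \<Rightarrow> (real^3 \<Rightarrow> complex) \<Rightarrow> complex"
    and \<phi> \<phi>' :: "real \<Rightarrow> real^3 \<Rightarrow> real"
  assumes "smooth_sc_domain \<Omega>" and "compact D" and "D \<subseteq> \<Omega>"
    and "c > 0" and "T > 2 * diameter \<Omega> / c"
    and "interior (I0 \<Omega> c T) \<noteq> {}" and "\<tau> \<in> I0 \<Omega> c T"
    and "admissible \<Omega> D c T KM \<tau> K p m u \<phi>"
    and "admissible \<Omega> D c T KM \<tau> K' p' m' u' \<phi>'"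
  shows "((\<forall>n\<in>{1..2 * KM + 1}. RG \<Omega> c T \<phi> f_test n \<tau> = RG \<Omega> c T \<phi>' f_test n \<tau>) \<longrightarrow>
            card (active c T K p m \<tau>) = card (active c T K' p' m' \<tau>)) \<and>
         (\<forall>N. card (active c T K p m \<tau>) = N \<and> card (active c T K' p' m' \<tau>) = N \<and>
            inactive_flat c T K p m \<tau> \<and> inactive_flat c T K' p' m' \<tau> \<and>
            (\<forall>n\<in>{1..2 * N}. RG \<Omega> c T \<phi> f_test n \<tau> = RG \<Omega> c T \<phi>' f_test n \<tau>) \<and>
            (\<forall>n\<in>{1..2 * N}. RG \<Omega> c T \<phi> g_test n \<tau> = RG \<Omega> c T \<phi>' g_test n \<tau>) \<and>
            (\<forall>n\<in>{2..N + 1}. RG \<Omega> c T \<phi> h_test n \<tau> = RG \<Omega> c T \<phi>' h_test n \<tau>) \<and>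
            (\<forall>n\<in>{1..2 * N}. RG \<Omega> c T \<phi> i_test n \<tau> = RG \<Omega> c T \<phi>' i_test n \<tau>) \<and>
            (\<forall>n\<in>{2..N + 1}. RG \<Omega> c T \<phi> j_test n \<tau> = RG \<Omega> c T \<phi>' j_test n \<tau>) \<longrightarrow>
            (\<exists>\<sigma>. bij_betw \<sigma> (active c T K p m \<tau>) (active c T K' p' m' \<tau>) \<and>
               (\<forall>k\<in>active c T K p m \<tau>.
                  p' (\<sigma> k) (arrival_time c T (p' (\<sigma> k)) \<tau>) = p k (arrival_time c T (p k) \<tau>) \<and>
                  m' (\<sigma> k) (arrival_time c T (p' (\<sigma> k)) \<tau>) = m k (arrival_time c T (p k) \<tau>))))"
proof -
  have T: "T > 0"
  proof -
    have "0 \<le> 2 * diameter \<Omega> / c"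
      using assms(1,4) by (simp add: smooth_sc_domain_def diameter_ge_0)
    then show ?thesis using assms(5) by linarith
  qed
  have adm: "dipole_sources D c T K p m" "weak_solution \<Omega> D c T K p m u \<phi>"
    "card (active c T K p m \<tau>) \<le> KM"
    "\<And>j k. j < K \<Longrightarrow> k < K \<Longrightarrow> j \<noteq> k \<Longrightarrow>
        cxy (p j (arrival_time c T (p j) \<tau>)) \<noteq> cxy (p k (arrival_time c T (p k) \<tau>))"
    "\<And>k t. k < K \<Longrightarrow> t \<in> {0..T} \<Longrightarrow> m k t $ 3 = 0"
    using assms(8) unfolding admissible_def by blast+
  have adm': "dipole_sources D c T K' p' m'" "weak_solution \<Omega> D c T K' p' m' u' \<phi>'"
    "card (active c T K' p' m' \<tau>) \<le> KM"
    "\<And>j k. j < K' \<Longrightarrow> k < K' \<Longrightarrow> j \<noteq> k \<Longrightarrow>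
        cxy (p' j (arrival_time c T (p' j) \<tau>)) \<noteq> cxy (p' k (arrival_time c T (p' k) \<tau>))"
    "\<And>k t. k < K' \<Longrightarrow> t \<in> {0..T} \<Longrightarrow> m' k t $ 3 = 0"
    using assms(9) unfolding admissible_def by blast+
  interpret A: dipole_config \<Omega> D c T K p m
    using assms(1,3,4) T adm(1,5) by unfold_locales (auto simp: smooth_sc_domain_def)
  interpret B: dipole_config \<Omega> D c T K' p' m'
    using assms(1,3,4) T adm'(1,5) by unfold_locales (auto simp: smooth_sc_domain_def)
  note \<tau> = assms(7)
  note RG_A = A.RG_f_test[OF adm(2) assms(6) \<tau>] A.RG_g_test[OF adm(2) assms(6) \<tau>] A.RG_h_test[OF adm(2) assms(6) \<tau>]
    A.RG_i_test[OF adm(2) assms(6) \<tau>] A.RG_j_test[OF adm(2) assms(6) \<tau>]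
  note RG_B = B.RG_f_test[OF adm'(2) assms(6) \<tau>] B.RG_g_test[OF adm'(2) assms(6) \<tau>] B.RG_h_test[OF adm'(2) assms(6) \<tau>]
    B.RG_i_test[OF adm'(2) assms(6) \<tau>] B.RG_j_test[OF adm'(2) assms(6) \<tau>]
  define A B where "A = active c T K p m \<tau>" and "B = active c T K' p' m' \<tau>"
  define w z q where "w k = pos_xy c T (p k) \<tau>" and "z k = pos_z c T (p k) \<tau>"
    and "q k = mom_xy c T (p k) (m k) \<tau>" for k
  define w' z' q' where "w' k = pos_xy c T (p' k) \<tau>" and "z' k = pos_z c T (p' k) \<tau>"
    and "q' k = mom_xy c T (p' k) (m' k) \<tau>" for k
  have fin: "finite A" "finite B"
    by (simp_all add: A_def B_def active_def)
  have AK: "k < K" if "k \<in> A" for k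
    using that by (simp add: A_def active_def)
  have BK: "k < K'" if "k \<in> B" for k
    using that by (simp add: B_def active_def)
  have inj: "inj_on w A" "inj_on w' B"
    unfolding inj_on_def w_def w'_def pos_xy_def using adm(4) adm'(4) AK BK by metis+
  have q_nz: "q k \<noteq> 0" if "k \<in> A" for k
    using A.mom_xy_eq_0_iff[OF \<tau> AK[OF that]] that by (simp add: q_def A_def)
  have q'_nz: "q' k \<noteq> 0" if "k \<in> B" for k
    using B.mom_xy_eq_0_iff[OF \<tau> BK[OF that]] that by (simp add: q'_def B_def)
  \<comment> \<open>The \<open>f\<close> data for \<open>n = j + 1\<close> are \<open>n\<close> times the power moments of order \<open>j\<close>.\<close>
  have match: "\<exists>\<sigma>. bij_betw \<sigma> A B \<and> (\<forall>k\<in>A. w' (\<sigma> k) = w k \<and> q' (\<sigma> k) = q k)"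
    if "card A + card B \<le> n" "\<forall>n\<in>{1..n}. RG \<Omega> c T \<phi> f_test n \<tau> = RG \<Omega> c T \<phi>' f_test n \<tau>" for n
  proof -
    have "(\<Sum>k\<in>A. q k * w k ^ j) = (\<Sum>k\<in>B. q' k * w' k ^ j)" if "j < card A + card B" for j
    proof -
      have "RG \<Omega> c T \<phi> f_test (Suc j) \<tau> = RG \<Omega> c T \<phi>' f_test (Suc j) \<tau>"
        using \<open>card A + card B \<le> n\<close> \<open>\<forall>n\<in>_. _\<close> that by auto
      then have "of_nat (Suc j) * (\<Sum>k\<in>A. w k ^ j * q k) = of_nat (Suc j) * (\<Sum>k\<in>B. w' k ^ j * q' k)"
        unfolding RG_A(1) RG_B(1) A.moment_sum_active_0[OF \<tau>] B.moment_sum_active_0[OF \<tau>]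
        by (simp only: A_def B_def w_def w'_def q_def q'_def diff_Suc_1)
      then show ?thesis
        by (simp only: mult_cancel_left of_nat_eq_0_iff) (simp add: mult.commute)
    qed
    with fin inj q_nz q'_nz show ?thesis
      by (rule prony_uniqueness) blast+
  qed
  have part1: "card A = card B"
    if "\<forall>n\<in>{1..2 * KM + 1}. RG \<Omega> c T \<phi> f_test n \<tau> = RG \<Omega> c T \<phi>' f_test n \<tau>"
    using match[OF _ that] adm(3) adm'(3) bij_betw_same_card unfolding A_def B_def by fastforce
  have part2: "\<exists>\<sigma>. bij_betw \<sigma> A B \<and> (\<forall>k\<in>A.
        p' (\<sigma> k) (arrival_time c T (p' (\<sigma> k)) \<tau>) = p k (arrival_time c T (p k) \<tau>) \<and>
        m' (\<sigma> k) (arrival_time c T (p' (\<sigma> k)) \<tau>) = m k (arrival_time c T (p k) \<tau>))"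
    if card: "card A = N" "card B = N"
      and flat: "inactive_flat c T K p m \<tau>" "inactive_flat c T K' p' m' \<tau>"
      and f: "\<forall>n\<in>{1..2 * N}. RG \<Omega> c T \<phi> f_test n \<tau> = RG \<Omega> c T \<phi>' f_test n \<tau>"
      and g: "\<forall>n\<in>{1..2 * N}. RG \<Omega> c T \<phi> g_test n \<tau> = RG \<Omega> c T \<phi>' g_test n \<tau>"
      and h: "\<forall>n\<in>{2..N + 1}. RG \<Omega> c T \<phi> h_test n \<tau> = RG \<Omega> c T \<phi>' h_test n \<tau>"
      and i: "\<forall>n\<in>{1..2 * N}. RG \<Omega> c T \<phi> i_test n \<tau> = RG \<Omega> c T \<phi>' i_test n \<tau>"
      and j: "\<forall>n\<in>{2..N + 1}. RG \<Omega> c T \<phi> j_test n \<tau> = RG \<Omega> c T \<phi>' j_test n \<tau>" for N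
  proof -
    obtain \<sigma> where \<sigma>: "bij_betw \<sigma> A B" and \<sigma>w: "\<And>k. k \<in> A \<Longrightarrow> w' (\<sigma> k) = w k" and \<sigma>q: "\<And>k. k \<in> A \<Longrightarrow> q' (\<sigma> k) = q k"
      using match[of "2 * N"] f card by auto
    define w1 w2 z1 q1 q2 where "w1 k = dv (pos_xy c T (p k)) \<tau>" and "w2 k = dv (dv (pos_xy c T (p k))) \<tau>"
      and "z1 k = dv (pos_z c T (p k)) \<tau>" and "q1 k = dv (mom_xy c T (p k) (m k)) \<tau>"
      and "q2 k = dv (dv (mom_xy c T (p k) (m k))) \<tau>" for k
    define w1' w2' z1' q1' q2' where "w1' k = dv (pos_xy c T (p' k)) \<tau>" and "w2' k = dv (dv (pos_xy c T (p' k))) \<tau>"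
      and "z1' k = dv (pos_z c T (p' k)) \<tau>" and "q1' k = dv (mom_xy c T (p' k) (m' k)) \<tau>"
      and "q2' k = dv (dv (mom_xy c T (p' k) (m' k))) \<tau>" for k
    note fold_A = A_def[symmetric] w_def[symmetric] z_def[symmetric] q_def[symmetric] w1_def[symmetric] w2_def[symmetric]
      z1_def[symmetric] q1_def[symmetric] q2_def[symmetric]
    note fold_B = B_def[symmetric] w'_def[symmetric] z'_def[symmetric] q'_def[symmetric] w1'_def[symmetric] w2'_def[symmetric]
      z1'_def[symmetric] q1'_def[symmetric] q2'_def[symmetric]
    note MA = A.moment_sum_active_0[OF \<tau>, unfolded fold_A] A.moment_sum_active[OF \<tau> flat(1), unfolded fold_A]
    note MB = B.moment_sum_active_0[OF \<tau>, unfolded fold_B reindex_moments[OF \<sigma>]]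
      B.moment_sum_active[OF \<tau> flat(2), unfolded fold_B reindex_moments[OF \<sigma>]]
    have first: "(\<Sum>k\<in>A. dv_moment n (w k) (w1 k) (q k) (q1 k)) = (\<Sum>k\<in>A. dv_moment n (w k) (w1' (\<sigma> k)) (q k) (q1' (\<sigma> k)))"
      if "n < 2 * card A" for n
    proof -
      have "Suc n \<in> {1..2 * N}"
        using that card by simp
      from g[rule_format, OF this]
      have "(\<Sum>k\<in>A. dv_moment n (w k) (w1 k) (q k) (q1 k)) =
          (\<Sum>k\<in>A. dv_moment n (w' (\<sigma> k)) (w1' (\<sigma> k)) (q' (\<sigma> k)) (q1' (\<sigma> k)))"
        by (simp only: RG_A RG_B MA MB mult_cancel_left of_nat_eq_0_iff) simp
      then show ?thesis
        by (simp add: \<sigma>w \<sigma>q)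
    qed
    have second: "(\<Sum>k\<in>A. dv2_moment n (w k) (w1 k) (w2 k) (q k) (q1 k) (q2 k)) =
        (\<Sum>k\<in>A. dv2_moment n (w k) (w1' (\<sigma> k)) (w2' (\<sigma> k)) (q k) (q1' (\<sigma> k)) (q2' (\<sigma> k)))"
      if "n < 2 * card A" for n
    proof -
      have "Suc n \<in> {1..2 * N}"
        using that card by simp
      from i[rule_format, OF this]
      have "(\<Sum>k\<in>A. dv2_moment n (w k) (w1 k) (w2 k) (q k) (q1 k) (q2 k)) =
          (\<Sum>k\<in>A. dv2_moment n (w' (\<sigma> k)) (w1' (\<sigma> k)) (w2' (\<sigma> k)) (q' (\<sigma> k)) (q1' (\<sigma> k)) (q2' (\<sigma> k)))"
        by (simp only: RG_A RG_B MA MB mult_cancel_left of_nat_eq_0_iff) simp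
      then show ?thesis
        by (simp add: \<sigma>w \<sigma>q)
    qed
    \<comment> \<open>The \<open>g\<close> and \<open>i\<close> data determine the derivatives of the horizontal positions and of the weights.\<close>
    have jets: "w1' (\<sigma> k) = w1 k" "q1' (\<sigma> k) = q1 k" "w2' (\<sigma> k) = w2 k" "q2' (\<sigma> k) = q2 k" if "k \<in> A" for k
      using jets_determined[OF fin(1) inj(1) q_nz first second that] by simp_all
    have nz: "1 + complex_of_nat n \<noteq> 0" "4 + 2 * complex_of_nat n \<noteq> 0" for n
      using of_nat_eq_0_iff[of "Suc n", where 'a=complex] of_nat_eq_0_iff[of "4 + 2 * n", where 'a=complex]
      by (simp_all del: of_nat_eq_0_iff)
    note known = nz \<sigma>w \<sigma>q jets
    \<comment> \<open>In the \<open>h\<close> data everything but the heights is known by now.\<close>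
    have "(\<Sum>k\<in>A. ((z k - z' (\<sigma> k)) * q k) * w k ^ n) = 0" if "n < card A" for n
    proof -
      have "n + 2 \<in> {2..N + 1}"
        using that card by simp
      from h[rule_format, OF this]
      have "(\<Sum>k\<in>A. z k * (w k ^ n * q k)) = (\<Sum>k\<in>A. z' (\<sigma> k) * (w k ^ n * q k))"
        by (simp only: RG_A RG_B MA MB) (simp add: known)
      then show ?thesis
        by (simp add: sum_subtractf algebra_simps)
    qed
    from vandermonde[OF fin(1) inj(1) this]
    have zeq: "z' (\<sigma> k) = z k" if "k \<in> A" for k
      using that q_nz[OF that] by fastforce
    \<comment> \<open>The \<open>j\<close> data then leave the vertical velocities as the only unknowns.\<close>
    have "(\<Sum>k\<in>A. ((z1 k - z1' (\<sigma> k)) * q k) * w k ^ n) = 0" if "n < card A" for n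
    proof -
      have "n + 2 \<in> {2..N + 1}"
        using that card by simp
      from j[rule_format, OF this]
      have "(\<Sum>k\<in>A. z k * dv_moment n (w k) (w1 k) (q k) (q1 k) + z1 k * (w k ^ n * q k)) =
          (\<Sum>k\<in>A. z k * dv_moment n (w k) (w1 k) (q k) (q1 k) + z1' (\<sigma> k) * (w k ^ n * q k))"
        by (simp only: RG_A RG_B MA MB) (simp add: known zeq)
      then show ?thesis
        by (simp add: sum.distrib sum_subtractf algebra_simps)
    qed
    from vandermonde[OF fin(1) inj(1) this]
    have z1eq: "z1' (\<sigma> k) = z1 k" if "k \<in> A" for k
      using that q_nz[OF that] by fastforce
    have "p' (\<sigma> k) (arrival_time c T (p' (\<sigma> k)) \<tau>) = p k (arrival_time c T (p k) \<tau>) \<and>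
        m' (\<sigma> k) (arrival_time c T (p' (\<sigma> k)) \<tau>) = m k (arrival_time c T (p k) \<tau>)" if k: "k \<in> A" for k
    proof -
      let ?t = "arrival_time c T (p k)" and ?t' = "arrival_time c T (p' (\<sigma> k))"
      have "\<sigma> k \<in> B"
        using \<sigma> k by (rule bij_betwE[THEN bspec])
      interpret a: moving_point c T "p k"
        using AK[OF k] by (rule A.source)
      interpret b: moving_point c T "p' (\<sigma> k)"
        using BK[OF \<open>\<sigma> k \<in> B\<close>] by (rule B.source)
      have J: "\<tau> \<in> a.J" "\<tau> \<in> b.J"
        using A.\<tau>_J[OF \<tau> AK[OF k]] B.\<tau>_J[OF \<tau> BK[OF \<open>\<sigma> k \<in> B\<close>]] by auto
      \<comment> \<open>Equal vertical velocities give equal rates of arrival, by which the weights are divided.\<close>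
      have t1: "complex_of_real (dv ?t' \<tau>) = of_real (dv ?t \<tau>)"
        using a.dv_arr_eq[OF A.C_time_moment[OF AK[OF k]] J(1)]
          b.dv_arr_eq[OF B.C_time_moment[OF BK[OF \<open>\<sigma> k \<in> B\<close>]] J(2)] z1eq[OF k]
        by (simp add: z1_def z1'_def)
      have m_xy: "cxy (m' (\<sigma> k) (?t' \<tau>)) = cxy (m k (?t \<tau>))"
        using \<sigma>q[OF k] a.dv_arr_pos[OF J(1)] by (simp add: q_def q'_def mom_xy_def t1)
      have m_z: "m' (\<sigma> k) (?t' \<tau>) $ 3 = m k (?t \<tau>) $ 3"
        using A.horizontal[OF AK[OF k], of "?t \<tau>"] B.horizontal[OF BK[OF \<open>\<sigma> k \<in> B\<close>], of "?t' \<tau>"]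
          a.arr(1)[OF J(1)] b.arr(1)[OF J(2)] by simp
      have p_xy: "cxy (p' (\<sigma> k) (?t' \<tau>)) = cxy (p k (?t \<tau>))"
        using \<sigma>w[OF k] by (simp add: w_def w'_def pos_xy_def)
      have p_z: "p' (\<sigma> k) (?t' \<tau>) $ 3 = p k (?t \<tau>) $ 3"
        using zeq[OF k] by (simp add: z_def z'_def pos_z_def)
      show ?thesis
        using m_xy m_z p_xy p_z by (simp add: cxy_def vec_eq_iff forall_3)
    qed
    with \<sigma> show ?thesis by blast
  qed
  show ?thesis
    using part1 part2 unfolding A_def B_def by blast
qed

end
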